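(* Let $K$ be a field containing $\mathbb{Q}$, let $n\in\mathbb{N}^+$ and let $r=r(n)$ be the number of primes $\le n$. Let $I_n\subseteq K[x_1,\dots,x_r]$ be the monomial ideal generated by all monomials $x_1^{a_1}\cdots x_r^{a_r}$ with $p_1^{a_1}\cdots p_r^{a_r}>n$ (where $p_i$ is the $i$-th prime, $p_1=2$). Then: (I) $\Gamma_n\cong K[x_1,\dots,x_r]/I_n$ as $K$-algebras, and $I_n$ is strongly stable with respect to the reverse order of the variables, i.e. whenever $m$ is a monomial and $x_jm\in I_n$, then $x_im\in I_n$ for all $i$ with $j\le i\le r$. (II) $\Gamma_n$ is artinian with $\dim_K\Gamma_n=n$. Moreover, if $\Gamma_n$ is graded by giving each $\chi_i$ (the image of $x_i$) degree $1$, its Hilbert series is $\sum_i d_i t^i$, where $d_i$ is the number of integers $w$ with $1\le w\le n$ and $\lambda(w)=i$. (III) For each $v$, there is a bijection between the minimal monomial generators $m$ of $I_n$ with $\min(m)=v$ and the tuples $(b_v,\dots,b_r)$ of non-negative integers satisfying $$\log n-\log p_v<\sum_{i=v}^r b_i\log p_i\le \log n.$$ (IV) Writing $C_{n,v}$ for the number of such solutions (equivalently, the number of minimal monomial generators $m$ of $I_n$ with $\min(m)=v$), the Poincaré–Betti series of $K$ over $\Gamma_n$ is $$P(\mathrm{Tor}^{\Gamma_n}_*(K,K),t)=\frac{(1+t)^r}{1-t^2\left(\sum_{i=1}^r(1+t)^{i-1}C_{n,r-i+1}\right)}.$$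
   Context: $\Gamma$ denotes the set of all functions $\mathbb{N}^+\to K$ with pointwise addition and scalar multiplication and the convolution product $(fg)(m)=\sum_{ab=m}f(a)g(b)$. For $n\in\mathbb{N}^+$, $\Gamma_n=\{f\in\Gamma: f(m)=0 \text{ for all } m>n\}$, made into a $K$-algebra with the truncated product $(fg)(m)=\sum_{ab=m}f(a)g(b)$ for $m\le n$ and $(fg)(m)=0$ for $m>n$; equivalently $\Gamma_n\cong\Gamma/J_n$ with $J_n=\{f\in\Gamma: f(m)=0\ \forall m\le n\}$. For $i\ge1$, $\chi_i\in\Gamma$ is the function with $\chi_i(p_i)=1$ and $\chi_i(m)=0$ for $m\ne p_i$. $\lambda:\mathbb{N}^+\to\mathbb{N}$ is given by $\lambda(1)=0$ and $\lambda(q_1\cdots q_l)=l$ for primes $q_1,\dots,q_l$ (not necessarily distinct). For a monomial $m=x_1^{\alpha_1}\cdots x_r^{\alpha_r}$, its support is $\{i:\alpha_i>0\}$ and $\min(m)$ is the smallest element of the support. $\Gamma_n$ is a local ring with residue field $K$, and $P(\mathrm{Tor}^{R}_*(K,K),t)=\sum_{q\ge0}\dim_K\mathrm{Tor}^R_q(K,K)\,t^q$. *)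

theory Defs
  imports "HOL-Analysis.Analysis" "HOL-Library.Poly_Mapping" "HOL-Library.Function_Algebras"
    "HOL-Computational_Algebra.Computational_Algebra"
begin

text \<open>The i-th prime, 1-indexed: pr 1 = 2, pr 2 = 3, ...\<close>
definition pr :: "nat \<Rightarrow> nat" where
  "pr i = enumerate {q::nat. prime q} (i - 1)"

definition rr :: "nat \<Rightarrow> nat" where
  "rr n = card {q::nat. prime q \<and> q \<le> n}"

definition lam :: "nat \<Rightarrow> nat" where
  "lam w = size (prime_factorization w)"

definition vdim :: "('a \<Rightarrow> 'k::field) set \<Rightarrow> nat" where
  "vdim S = vector_space.dim (\<lambda>c f. (\<lambda>x. c * f x)) S"

definition vspan :: "('a \<Rightarrow> 'k::field) set \<Rightarrow> ('a \<Rightarrow> 'k) set" where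
  "vspan S = module.span (\<lambda>c f. (\<lambda>x. c * f x)) S"

text \<open>Elements of Gamma are functions N+ -> K, represented as nat => 'k
  with the (irrelevant) value at 0 set to 0.\<close>
definition Gamma :: "nat \<Rightarrow> (nat \<Rightarrow> 'k::field) set" where
  "Gamma n = {f. \<forall>m. (m = 0 \<or> n < m) \<longrightarrow> f m = 0}"

definition gmul :: "nat \<Rightarrow> (nat \<Rightarrow> 'k::field) \<Rightarrow> (nat \<Rightarrow> 'k) \<Rightarrow> (nat \<Rightarrow> 'k)" where
  "gmul n f g = (\<lambda>m. if 1 \<le> m \<and> m \<le> n then (\<Sum>a\<in>{a. a dvd m}. f a * g (m div a)) else 0)"

definition gunit :: "nat \<Rightarrow> 'k::field" where
  "gunit = (\<lambda>m. if m = 1 then 1 else 0)"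

definition gscale :: "'k::field \<Rightarrow> (nat \<Rightarrow> 'k) \<Rightarrow> (nat \<Rightarrow> 'k)" where
  "gscale c f = (\<lambda>m. c * f m)"

definition trunc :: "nat \<Rightarrow> (nat \<Rightarrow> 'k::field) \<Rightarrow> (nat \<Rightarrow> 'k)" where
  "trunc n f = (\<lambda>m. if 1 \<le> m \<and> m \<le> n then f m else 0)"

definition chi :: "nat \<Rightarrow> nat \<Rightarrow> 'k::field" where
  "chi i = (\<lambda>m. if m = pr i then 1 else 0)"

definition delta :: "nat \<Rightarrow> nat \<Rightarrow> 'k::field" where
  "delta a = (\<lambda>m. if m = a then 1 else 0)"

fun gprod :: "nat \<Rightarrow> (nat \<Rightarrow> 'k::field) list \<Rightarrow> (nat \<Rightarrow> 'k)" where
  "gprod n [] = gunit"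
| "gprod n (f # fs) = gmul n f (gprod n fs)"

definition gideal :: "nat \<Rightarrow> (nat \<Rightarrow> 'k::field) set \<Rightarrow> bool" where
  "gideal n I \<longleftrightarrow> I \<subseteq> Gamma n \<and> 0 \<in> I \<and> (\<forall>x\<in>I. \<forall>y\<in>I. x + y \<in> I) \<and> (\<forall>x\<in>I. - x \<in> I)
     \<and> (\<forall>f\<in>Gamma n. \<forall>x\<in>I. gmul n f x \<in> I)"

definition artinian :: "'k::field itself \<Rightarrow> nat \<Rightarrow> bool" where
  "artinian _ n \<longleftrightarrow> (\<forall>I :: nat \<Rightarrow> (nat \<Rightarrow> 'k) set.
      (\<forall>k. gideal n (I k) \<and> I (Suc k) \<subseteq> I k) \<longrightarrow> (\<exists>N. \<forall>k\<ge>N. I k = I N))"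

text \<open>degree-i component of Gamma_n when each chi_i has degree 1: the K-span of
  all products of i of the elements chi_1, ..., chi_r (images in Gamma_n)\<close>
definition gdeg :: "'k::field itself \<Rightarrow> nat \<Rightarrow> nat \<Rightarrow> (nat \<Rightarrow> 'k) set" where
  "gdeg _ n i = vspan {gprod n (map (\<lambda>j. trunc n (chi j)) js) | js.
                        length js = i \<and> set js \<subseteq> {1..rr n}}"

text \<open>Gamma_n is augmented via f |-> f(1) (residue field K).  The augmentation ideal
  has K-basis delta_w, 2 \<le> w \<le> n; hence its q-th tensor power has basis indexed by
  words of length q over {2..n}.  Chains are functions on words.\<close>
definition words :: "nat \<Rightarrow> nat \<Rightarrow> nat list set" where
  "words n q = {ws. length ws = q \<and> set ws \<subseteq> {2..n}}"

definition bchains :: "'k::field itself \<Rightarrow> nat \<Rightarrow> nat \<Rightarrow> (nat list \<Rightarrow> 'k) set" where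
  "bchains _ n q = {x. \<forall>ws. ws \<notin> words n q \<longrightarrow> x ws = 0}"

text \<open>bar differential on a basis element [w_1|...|w_q]:
  sum_{i=1}^{q-1} (-1)^i [w_1|...|w_i w_{i+1}|...|w_q], the product w_i w_{i+1}
  computed in Gamma_n and expanded in the basis delta_c, 2 \<le> c \<le> n\<close>
definition bar_d_basis :: "nat \<Rightarrow> nat list \<Rightarrow> nat list \<Rightarrow> 'k::field" where
  "bar_d_basis n ws = (\<lambda>vs. \<Sum>i\<in>{1..<length ws}. (-1) ^ i *
      (\<Sum>c\<in>{2..n}. if vs = take (i - 1) ws @ c # drop (i + 1) ws
                     then gmul n (delta (ws ! (i - 1))) (delta (ws ! i)) c else 0))"

definition bar_d :: "nat \<Rightarrow> nat \<Rightarrow> (nat list \<Rightarrow> 'k::field) \<Rightarrow> (nat list \<Rightarrow> 'k)" where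
  "bar_d n q x = (\<lambda>vs. \<Sum>ws\<in>words n q. x ws * bar_d_basis n ws vs)"

definition tor_dim :: "'k::field itself \<Rightarrow> nat \<Rightarrow> nat \<Rightarrow> nat" where
  "tor_dim K n q = vdim {x \<in> bchains K n q. bar_d n q x = 0} - vdim (bar_d n (Suc q) ` bchains K n (Suc q))"

text \<open>polynomials: finitely supported maps from exponent vectors (nat =>0 nat) to K;
  K[x_1..x_r] = those whose monomials only involve the variables 1..r\<close>
definition PR :: "nat \<Rightarrow> ((nat \<Rightarrow>\<^sub>0 nat) \<Rightarrow>\<^sub>0 'k::field) set" where
  "PR r = {f. \<forall>\<alpha>\<in>Poly_Mapping.keys f. Poly_Mapping.keys \<alpha> \<subseteq> {1..r}}"

definition monom :: "(nat \<Rightarrow>\<^sub>0 nat) \<Rightarrow> ((nat \<Rightarrow>\<^sub>0 nat) \<Rightarrow>\<^sub>0 'k::field)" where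
  "monom \<alpha> = Poly_Mapping.single \<alpha> 1"

definition pscale :: "'k::field \<Rightarrow> ((nat \<Rightarrow>\<^sub>0 nat) \<Rightarrow>\<^sub>0 'k) \<Rightarrow> ((nat \<Rightarrow>\<^sub>0 nat) \<Rightarrow>\<^sub>0 'k)" where
  "pscale c f = Poly_Mapping.map (\<lambda>x. c * x) f"

definition mval :: "(nat \<Rightarrow>\<^sub>0 nat) \<Rightarrow> nat" where
  "mval \<alpha> = (\<Prod>i\<in>Poly_Mapping.keys \<alpha>. pr i ^ Poly_Mapping.lookup \<alpha> i)"

definition ideal_gen :: "((nat \<Rightarrow>\<^sub>0 nat) \<Rightarrow>\<^sub>0 'k::field) set \<Rightarrow> ((nat \<Rightarrow>\<^sub>0 nat) \<Rightarrow>\<^sub>0 'k) set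
    \<Rightarrow> ((nat \<Rightarrow>\<^sub>0 nat) \<Rightarrow>\<^sub>0 'k) set" where
  "ideal_gen R G = {\<Sum>g\<in>F. c g * g | F c. finite F \<and> F \<subseteq> G \<and> (\<forall>g\<in>F. c g \<in> R)}"

definition In :: "'k::field itself \<Rightarrow> nat \<Rightarrow> ((nat \<Rightarrow>\<^sub>0 nat) \<Rightarrow>\<^sub>0 'k) set" where
  "In _ n = ideal_gen (PR (rr n)) {monom \<alpha> | \<alpha>. Poly_Mapping.keys \<alpha> \<subseteq> {1..rr n} \<and> n < mval \<alpha>}"

definition mingens :: "'k::field itself \<Rightarrow> nat \<Rightarrow> (nat \<Rightarrow>\<^sub>0 nat) set" where
  "mingens K n = {\<alpha>. Poly_Mapping.keys \<alpha> \<subseteq> {1..rr n} \<and> (monom \<alpha> :: (_ \<Rightarrow>\<^sub>0 'k)) \<in> In K n \<and>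
      (\<forall>\<beta>. (\<forall>j. Poly_Mapping.lookup \<beta> j \<le> Poly_Mapping.lookup \<alpha> j) \<and> \<beta> \<noteq> \<alpha> \<longrightarrow> (monom \<beta> :: (_ \<Rightarrow>\<^sub>0 'k)) \<notin> In K n)}"

text \<open>tuples (b_v,...,b_r), encoded as functions vanishing outside {v..r}\<close>
definition sols :: "nat \<Rightarrow> nat \<Rightarrow> (nat \<Rightarrow> nat) set" where
  "sols n v = {b. (\<forall>i. (i < v \<or> rr n < i) \<longrightarrow> b i = 0) \<and>
      ln (real n) - ln (real (pr v)) < (\<Sum>i=v..rr n. real (b i) * ln (real (pr i))) \<and>
      (\<Sum>i=v..rr n. real (b i) * ln (real (pr i))) \<le> ln (real n)}"

definition Cnv :: "nat \<Rightarrow> nat \<Rightarrow> nat" where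
  "Cnv n v = card (sols n v)"

end

theory Submission
  imports Defs
begin

text \<open>
  Unique factorisation identifies the monomials outside \<open>I\<^sub>n\<close> with the integers \<open>1, \<dots>, n\<close>; this gives
  the first three parts.

  For the Poincare series, let \<open>R\<close> be the subring of \<open>\<Gamma>\<^sub>n\<close> spanned by the integers all of whose prime
  factors are at least \<open>p = p\<^sub>v\<close>, and \<open>R'\<close> the corresponding subring for the next prime, which is also
  the quotient \<open>R / (p)\<close>. Since \<open>p\<close> is the smallest prime of \<open>R\<close>, its annihilator is the socle \<open>S\<close> of
  \<open>R\<close>, of dimension \<open>C\<^sub>n\<^sub>,\<^sub>v\<close>. A word of the bar complex \<open>B\<close> of \<open>R\<close> either lies in the bar complex \<open>B'\<close>
  of \<open>R'\<close> or has a last letter \<open>p f\<close> divisible by \<open>p\<close>, with \<open>f\<close> in a basis of \<open>R / S\<close>; the words of the second kind form the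
  quotient of the complex \<open>D = B \<otimes> R \<otimes> B'\<close> by \<open>B \<otimes> S \<otimes> B'\<close>. The complex \<open>D\<close> is quasi-isomorphic to
  \<open>B'\<close> via the augmentation, which kills \<open>S\<close>, so the long exact sequence splits and
  \<open>P = (1 + t) P' + t\<^sup>2 C\<^sub>n\<^sub>,\<^sub>v P P'\<close>. Descending induction on \<open>v\<close> solves this recursion. Proving the
  statement for the bar complexes tensored on the left with an arbitrary complex makes the Kuenneth
  formula for \<open>B \<otimes> S \<otimes> B'\<close> an instance of the induction hypothesis.
\<close>

section \<open>Finite-dimensional spaces of functions\<close>

text \<open>In all rings that occur, a product of two basis integers is a basis integer or zero.
  Hence every complex needed, including subquotients and tensor products, is spanned by a set of
  words, and one boundary operator restricted to such sets serves for all of them. Homology is never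
  formed as a space: only its dimension is tracked, through ranks of the boundary. The annihilator
  of p is the socle for reasons of size: if p f exceeds n, so does a f for each a \<ge> p. Division
  by p therefore identifies the ideal (p) with R / S, which is how a letter p f of an ordinary word
  becomes a coefficient f in D. This letter accounts for one factor t in both terms of the recursion
  that go beyond P'; the connecting map contributes the second factor t in the socle term. As P
  stands on both sides, the recursion is an equation for P, and the factor t^2 makes it uniquely
  solvable among power series.\<close>

interpretation fvs: vector_space "\<lambda>(c::'k::field) (f::'a \<Rightarrow> 'k). (\<lambda>x. c * f x)"
  by unfold_locales (auto simp: fun_eq_iff algebra_simps)

interpretation fvp: vector_space_pair "\<lambda>(c::'k::field) (f::'a \<Rightarrow> 'k). (\<lambda>x. c * f x)"
    "\<lambda>(c::'k::field) (f::'b \<Rightarrow> 'k). (\<lambda>x. c * f x)"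
  by unfold_locales

abbreviation (input) fscale :: "'k::field \<Rightarrow> ('a \<Rightarrow> 'k) \<Rightarrow> 'a \<Rightarrow> 'k" where
  "fscale \<equiv> \<lambda>c f x. c * f x"

abbreviation flinear :: "(('a \<Rightarrow> 'k::field) \<Rightarrow> ('b \<Rightarrow> 'k)) \<Rightarrow> bool" where
  "flinear \<equiv> Vector_Spaces.linear fscale fscale"

text \<open>The free vector space on \<open>Q\<close> when \<open>Q\<close> is finite. Functions on
  words form an infinite-dimensional space, so finite-dimensionality is always expressed as
  containment in some \<open>supp_on Q\<close> with \<open>Q\<close> finite.\<close>

definition supp_on :: "'a set \<Rightarrow> ('a \<Rightarrow> 'k::field) set" where
  "supp_on Q = {x. \<forall>w. w \<notin> Q \<longrightarrow> x w = 0}"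

definition restr :: "'a set \<Rightarrow> ('a \<Rightarrow> 'k::field) \<Rightarrow> 'a \<Rightarrow> 'k" where
  "restr Q x = (\<lambda>w. if w \<in> Q then x w else 0)"

lemma flinearI:
  assumes "\<And>x y. f (x + y) = f x + f y" "\<And>c x. f (\<lambda>a. c * x a) = (\<lambda>b. c * f x b)"
  shows "flinear f"
  using assms by unfold_locales (auto simp: fun_eq_iff algebra_simps)

lemma flinear_restr: "flinear (restr Q)"
  by (rule flinearI) (auto simp: restr_def fun_eq_iff)

lemma flinear_comp: "flinear f \<Longrightarrow> flinear g \<Longrightarrow> flinear (\<lambda>x. g (f x))"
  using Vector_Spaces.linear_compose[of _ _ f _ g] by (simp add: comp_def)

lemma subspace_supp_on: "fvs.subspace (supp_on Q)"
  by (auto simp: fvs.subspace_def supp_on_def)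

lemma vdim_eq: "vdim S = fvs.dim S" by (simp add: vdim_def)

lemma sum_fun_apply: "(\<Sum>i\<in>I. f i :: 'a \<Rightarrow> 'b::comm_monoid_add) x = (\<Sum>i\<in>I. f i x)"
  by (induction I rule: infinite_finite_induct) simp_all

lemma supp_on_span:
  assumes "finite Q"
  shows "supp_on Q = fvs.span ((\<lambda>a b. if b = a then 1 else 0 :: 'k::field) ` Q)"
proof
  let ?e = "\<lambda>a b. if b = a then 1 else 0 :: 'k"
  show "supp_on Q \<subseteq> fvs.span (?e ` Q)"
  proof
    fix x :: "'a \<Rightarrow> 'k" assume x: "x \<in> supp_on Q"
    have "x = (\<Sum>a\<in>Q. (\<lambda>b. x a * ?e a b))"
    proof
      fix b
      have "(\<Sum>a\<in>Q. (\<lambda>b. x a * ?e a b)) b = (\<Sum>a\<in>Q. x a * ?e a b)"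
        by (rule sum_fun_apply)
      also have "\<dots> = (\<Sum>a\<in>Q. if b = a then x a else 0)" by (rule sum.cong) auto
      also have "\<dots> = x b" using x assms by (auto simp: supp_on_def sum.delta)
      finally show "x b = (\<Sum>a\<in>Q. (\<lambda>b. x a * ?e a b)) b" by simp
    qed
    also have "\<dots> \<in> fvs.span (?e ` Q)"
      by (rule fvs.span_sum, rule fvs.span_scale, rule fvs.span_base) simp
    finally show "x \<in> fvs.span (?e ` Q)" .
  qed
  show "fvs.span (?e ` Q) \<subseteq> supp_on Q"
    by (rule fvs.span_minimal[OF _ subspace_supp_on]) (auto simp: supp_on_def)
qed

lemma supp_on_basis:
  assumes "finite Q"
  shows "fvs.independent ((\<lambda>a b. if b = a then 1 else 0 :: 'k::field) ` Q)"
    and "card ((\<lambda>a b. if b = a then 1 else 0 :: 'k) ` Q) = card Q"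
proof -
  let ?e = "\<lambda>a b. if b = a then 1 else 0 :: 'k"
  have inj: "inj_on ?e A" for A
    by (rule inj_onI) (auto simp: fun_eq_iff split: if_splits)
  show "card (?e ` Q) = card Q" by (rule card_image[OF inj])
  show "fvs.independent (?e ` Q)"
    unfolding fvs.dependent_def
  proof safe
    fix a assume a: "a \<in> Q" and s: "?e a \<in> fvs.span (?e ` Q - {?e a})"
    have "?e ` Q - {?e a} = ?e ` (Q - {a})"
      using inj[of UNIV] by (auto simp: inj_on_def)
    with s have "?e a \<in> supp_on (Q - {a})" using assms by (simp add: supp_on_span)
    then show False by (auto simp: supp_on_def)
  qed
qed

lemma dim_supp_on: "finite Q \<Longrightarrow> fvs.dim (supp_on Q :: ('a \<Rightarrow> 'k::field) set) = card Q"
  using supp_on_basis[of Q, where 'k='k] by (simp add: supp_on_span fvs.dim_eq_card_independent)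

lemma finite_of_independent_supp_on:
  fixes B :: "('a \<Rightarrow> 'k::field) set"
  assumes "fvs.independent B" "B \<subseteq> supp_on Q" "finite Q"
  shows "finite B" "card B \<le> card Q"
  using fvs.independent_span_bound[of "(\<lambda>a b. if b = a then 1 else 0) ` Q" B] assms
    supp_on_basis[of Q, where 'k='k] by (simp_all add: supp_on_span)

theorem rank_nullity:
  assumes f: "flinear f" and V: "fvs.subspace V" "V \<subseteq> supp_on Q" "finite Q"
  shows "fvs.dim V = fvs.dim {x\<in>V. f x = 0} + fvs.dim (f ` V)"
proof -
  interpret f: Vector_Spaces.linear fscale fscale f by (rule f)
  let ?K = "{x\<in>V. f x = 0}"
  obtain B where B: "B \<subseteq> ?K" "fvs.independent B" "?K \<subseteq> fvs.span B"
    using fvs.maximal_independent_subset[of ?K] by blast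
  obtain C where C: "B \<subseteq> C" "C \<subseteq> V" "fvs.independent C" "V \<subseteq> fvs.span C"
    using fvs.maximal_independent_subset_extend[of B V] B by blast
  have finC: "finite C" using finite_of_independent_supp_on(1)[OF C(3) _ V(3)] C(2) V(2) by blast
  have spC: "fvs.span C = V"
    by (rule antisym[OF fvs.span_minimal[OF C(2) V(1)] C(4)])
  have iCB: "fvs.independent (C - B)" using fvs.independent_mono[OF C(3)] by auto
  \<comment> \<open>A vector in the span of \<open>C - B\<close> that \<open>f\<close> kills also
    lies in the span of \<open>B\<close>. Its coordinates with respect to \<open>C\<close> are then
    supported in two disjoint sets.\<close>
  have inj: "inj_on f (fvs.span (C - B))"
    unfolding f.inj_on_iff_eq_0[OF fvs.subspace_span]
  proof (intro ballI impI)
    fix x assume x: "x \<in> fvs.span (C - B)" "f x = 0"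
    have "x \<in> V" using x(1) spC fvs.span_mono[of "C - B" C] by auto
    with x(2) B(3) have xB: "x \<in> fvs.span B" by auto
    have "fvs.representation C x = fvs.representation B x"
      by (rule fvs.representation_extend[OF C(3) xB C(1)])
    moreover have "fvs.representation C x = fvs.representation (C - B) x"
      by (rule fvs.representation_extend[OF C(3) x(1)]) auto
    ultimately have "fvs.representation B x b = 0" for b
      using fvs.representation_ne_zero[of B x b] fvs.representation_ne_zero[of "C - B" x b] by auto
    then show "x = 0" using fvs.sum_nonzero_representation_eq[OF B(2) xB] by simp
  qed
  have ind: "fvs.independent (f ` (C - B))" by (rule f.independent_injective_image[OF iCB inj])
  have sp: "f ` V \<subseteq> fvs.span (f ` (C - B))"
  proof -
    have "f ` V = fvs.span (f ` C)" using f.span_image[of C] spC by simp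
    also have "\<dots> \<subseteq> fvs.span (f ` (C - B))"
    proof (rule fvs.span_minimal[OF _ fvs.subspace_span], safe)
      fix c assume "c \<in> C"
      then show "f c \<in> fvs.span (f ` (C - B))"
        using B(1) by (cases "c \<in> B") (auto intro: fvs.span_base simp: fvs.span_zero)
    qed
    finally show ?thesis .
  qed
  have "card (f ` (C - B)) = fvs.dim (f ` V)"
    by (rule fvs.basis_card_eq_dim[OF _ sp ind]) (use C in auto)
  moreover have "card (f ` (C - B)) = card (C - B)"
    by (rule card_image) (rule inj_on_subset[OF inj fvs.span_superset])
  moreover have "card B = fvs.dim ?K" by (rule fvs.basis_card_eq_dim[OF B(1,3,2)])
  moreover have "card C = fvs.dim V" by (rule fvs.basis_card_eq_dim[OF C(2,4,3)])
  moreover have "card C = card B + card (C - B)"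
    using C(1) finC by (simp add: card_Diff_subset card_mono finite_subset)
  ultimately show ?thesis by simp
qed

lemma vdim_mono:
  assumes "V \<subseteq> W" "W \<subseteq> supp_on Q" "finite Q"
  shows "fvs.dim V \<le> fvs.dim W"
proof -
  obtain B where B: "B \<subseteq> V" "fvs.independent B" "V \<subseteq> fvs.span B"
    using fvs.maximal_independent_subset[of V] by blast
  obtain C where C: "B \<subseteq> C" "C \<subseteq> W" "fvs.independent C" "W \<subseteq> fvs.span C"
    using fvs.maximal_independent_subset_extend[of B W] B assms by blast
  have "finite C" using finite_of_independent_supp_on(1)[OF C(3) _ assms(3)] C(2) assms(2) by blast
  then have "card B \<le> card C" using C(1) by (rule card_mono)
  then show ?thesis
    using fvs.basis_card_eq_dim[OF B(1,3,2)] fvs.basis_card_eq_dim[OF C(2,4,3)] by simp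
qed

lemma subspace_eq_of_dim_eq:
  assumes "fvs.subspace V" "V \<subseteq> W" "W \<subseteq> supp_on Q" "finite Q" "fvs.dim V = fvs.dim W"
  shows "V = W"
proof -
  obtain B where B: "B \<subseteq> V" "fvs.independent B" "V \<subseteq> fvs.span B"
    using fvs.maximal_independent_subset[of V] by blast
  obtain C where C: "B \<subseteq> C" "C \<subseteq> W" "fvs.independent C" "W \<subseteq> fvs.span C"
    using fvs.maximal_independent_subset_extend[of B W] B assms by blast
  have "finite C" using finite_of_independent_supp_on(1)[OF C(3) _ assms(4)] C(2) assms(3) by blast
  moreover have "card B = card C"
    using fvs.basis_card_eq_dim[OF B(1,3,2)] fvs.basis_card_eq_dim[OF C(2,4,3)] assms by simp
  ultimately have "B = C" using C(1) by (simp add: card_subset_eq)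
  then have "W \<subseteq> V" using C(4) fvs.span_minimal[OF B(1) assms(1)] by auto
  then show ?thesis using assms(2) by auto
qed

lemma dim_image_inj_on:
  fixes f :: "('a \<Rightarrow> 'k::field) \<Rightarrow> ('b \<Rightarrow> 'k)"
  assumes f: "flinear f" and V: "fvs.subspace V" "V \<subseteq> supp_on Q" "finite Q"
    and "\<And>x. x \<in> V \<Longrightarrow> f x = 0 \<Longrightarrow> x = 0"
  shows "fvs.dim (f ` V) = fvs.dim V"
proof -
  interpret f: Vector_Spaces.linear fscale fscale f by (rule f)
  have "{x\<in>V. f x = 0} = {0}" using assms(5) fvs.subspace_0[OF V(1)] f.zero by auto
  moreover have "fvs.dim {0 :: 'a \<Rightarrow> 'k} = 0"
    using fvs.dim_le_card[of "{0 :: 'a \<Rightarrow> 'k}" "{}"] by simp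
  ultimately show ?thesis using rank_nullity[OF f V] by simp
qed

section \<open>Bar complexes of partial semigroups\<close>

text \<open>Basis elements multiply to a basis element or to zero, and \<open>None\<close> stands
  for zero. \<open>assoc\<close> says that both bracketings vanish together or agree. It is required
  of all letters, also outside \<open>A\<close>, so that the identities for \<open>cob\<close> hold
  for arbitrary words.\<close>

locale partial_semigroup =
  fixes mul :: "'a \<Rightarrow> 'a \<Rightarrow> 'a option" and A :: "'a set"
  assumes assoc: "Option.bind (mul a b) (\<lambda>c. mul c d) = Option.bind (mul b d) (mul a)"
    and finite_A: "finite A"
    and mul_A: "a \<in> A \<Longrightarrow> b \<in> A \<Longrightarrow> mul a b = Some c \<Longrightarrow> c \<in> A"
begin

text \<open>\<open>\<phi>\<close> evaluated at the word \<open>w\<close> with \<open>a\<close>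
  multiplied into its first letter. A zero product gives 0, and so does the empty word, where no
  neighbour is left to merge with.\<close>

definition head_mul :: "'a \<Rightarrow> ('a list \<Rightarrow> 'k::field) \<Rightarrow> 'a list \<Rightarrow> 'k" where
  "head_mul a \<phi> w = (case w of [] \<Rightarrow> 0 | b # w' \<Rightarrow> (case mul a b of None \<Rightarrow> 0 | Some c \<Rightarrow> \<phi> (c # w')))"

text \<open>\<open>cob w \<phi>\<close> is \<open>\<phi>\<close> evaluated at the bar boundary
  \<open>\<Sum>\<^sub>i (-1)\<^sup>i [a\<^sub>1 | \<dots> | a\<^sub>i a\<^sub>i\<^sub>+\<^sub>1 | \<dots> | a\<^sub>q]\<close> of the word \<open>w\<close>; in this dual form no formal sums
  of words are needed.\<close>
primrec cob :: "'a list \<Rightarrow> ('a list \<Rightarrow> 'k::field) \<Rightarrow> 'k" where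
  "cob [] = (\<lambda>\<phi>. 0)"
| "cob (a # w) = (\<lambda>\<phi>. - head_mul a \<phi> w - cob w (\<lambda>u. \<phi> (a # u)))"

definition merges :: "'a list \<Rightarrow> 'a list \<Rightarrow> bool" where
  "merges w u \<longleftrightarrow> (\<exists>l a b r c. w = l @ a # b # r \<and> mul a b = Some c \<and> u = l @ c # r)"

definition bd_coeff :: "'a list \<Rightarrow> 'a list \<Rightarrow> 'k::field" where
  "bd_coeff w u = cob w (\<lambda>v. if v = u then 1 else 0)"

definition U :: "nat \<Rightarrow> 'a list set" where
  "U k = {w. length w = k \<and> set w \<subseteq> A}"

text \<open>Acts in all degrees at once and on functions of any support: the value at
  \<open>u\<close> involves only the finitely many words over \<open>A\<close> that are one letter
  longer. Degrees are separated by \<open>gr\<close>.\<close>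

definition bd :: "('a list \<Rightarrow> 'k::field) \<Rightarrow> 'a list \<Rightarrow> 'k" where
  "bd x u = (\<Sum>w\<in>U (Suc (length u)). x w * bd_coeff w u)"

definition gr :: "'a list set \<Rightarrow> nat \<Rightarrow> 'a list set" where
  "gr Q q = {w\<in>Q. length w = q}"

text \<open>Restricting the boundary to \<open>Q\<close> gives the differential of a subquotient when \<open>Q\<close> is not closed
  under merging.\<close>
definition img :: "'a list set \<Rightarrow> nat \<Rightarrow> ('a list \<Rightarrow> 'k::field) set" where
  "img Q q = (\<lambda>x. restr Q (bd x)) ` supp_on (gr Q q)"

definition bd_rank :: "'k::field itself \<Rightarrow> 'a list set \<Rightarrow> nat \<Rightarrow> nat" where
  "bd_rank K Q q = fvs.dim (img Q q :: ('a list \<Rightarrow> 'k) set)"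

text \<open>The dimension of homology in degree \<open>q\<close>, expressed by ranks.\<close>
definition hom_dim :: "'k::field itself \<Rightarrow> 'a list set \<Rightarrow> nat \<Rightarrow> int" where
  "hom_dim K Q q = int (card (gr Q q)) - int (bd_rank K Q q) - int (bd_rank K Q (Suc q))"

definition H :: "'k::field itself \<Rightarrow> 'a list set \<Rightarrow> rat fps" where
  "H K Q = Abs_fps (\<lambda>q. of_int (hom_dim K Q q))"

definition closed :: "'a list set \<Rightarrow> bool" where
  "closed Q \<longleftrightarrow> Q \<subseteq> lists A \<and> (\<forall>w\<in>Q. \<forall>u. merges w u \<longrightarrow> u \<in> Q)"

section \<open>The boundary and its square\<close>

lemma head_mul_add: "head_mul a (\<lambda>u. \<phi> u + \<psi> u) w = head_mul a \<phi> w + head_mul a \<psi> w"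
  by (auto simp: head_mul_def split: list.split option.split)

lemma head_mul_scale: "head_mul a (\<lambda>u. c * \<phi> u) w = c * head_mul a \<phi> w"
  by (auto simp: head_mul_def split: list.split option.split)

lemma cob_add: "cob w (\<lambda>u. \<phi> u + \<psi> u) = cob w \<phi> + cob w \<psi>"
  by (induction w arbitrary: \<phi> \<psi>) (simp_all add: head_mul_add)

lemma cob_scale: "cob w (\<lambda>u. c * \<phi> u) = c * cob w \<phi>"
  by (induction w arbitrary: \<phi>) (simp_all add: head_mul_scale algebra_simps)

lemma cob_zero: "cob w (\<lambda>u. 0) = 0"
  using cob_scale[of w 0 "\<lambda>u. 0"] by simp

lemma cob_sum: "cob w (\<lambda>u. \<Sum>i\<in>I. \<phi> i u) = (\<Sum>i\<in>I. cob w (\<phi> i))"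
  by (induction I rule: infinite_finite_induct) (simp_all add: cob_zero cob_add)

text \<open>Multiplying \<open>a\<close> into the first letter commutes with the boundary. The term
  where the head of \<open>w\<close> merges with its neighbour is matched by associativity; all
  other terms do not see \<open>a\<close>.\<close>

lemma cob_head_mul: "cob w (head_mul a \<phi>) = head_mul a (\<lambda>u. cob u \<phi>) w"
proof (cases w)
  case Nil
  then show ?thesis by (simp add: head_mul_def)
next
  case (Cons b w')
  have 1: "(\<lambda>u. head_mul a \<phi> (b # u)) = (case mul a b of None \<Rightarrow> (\<lambda>u. 0) | Some c \<Rightarrow> (\<lambda>u. \<phi> (c # u)))"
    by (auto simp: head_mul_def split: option.split)
  have 2: "head_mul b (head_mul a \<phi>) w' = (case mul a b of None \<Rightarrow> 0 | Some c \<Rightarrow> head_mul c \<phi> w')"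
  proof (cases w')
    case (Cons d w'')
    then show ?thesis using assoc[of a b d]
      by (auto simp: head_mul_def split: option.splits)
  qed (auto simp: head_mul_def split: option.split)
  show ?thesis
    unfolding Cons cob.simps 1 2 by (auto simp: head_mul_def cob_zero split: option.split)
qed

text \<open>The boundary of \<open>a # w\<close> is minus \<open>a\<close> multiplied into
  \<open>w\<close>, minus \<open>a\<close> put before the boundary of \<open>w\<close>. Applying it
  twice leaves two cross terms, which cancel by \<open>cob_head_mul\<close>, and a term covered by
  induction.\<close>

lemma cob_cob: "cob w (\<lambda>u. cob u \<phi>) = 0"
proof (induction w arbitrary: \<phi>)
  case (Cons a w)
  have "(\<lambda>u. cob (a # u) \<phi>) = (\<lambda>u. (-1) * head_mul a \<phi> u + (-1) * cob u (\<lambda>v. \<phi> (a # v)))"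
    by simp
  then have "cob w (\<lambda>u. cob (a # u) \<phi>) = - cob w (head_mul a \<phi>) - cob w (\<lambda>u. cob u (\<lambda>v. \<phi> (a # v)))"
    by (simp only: cob_add cob_scale) simp
  then show ?case using Cons by (simp add: cob_head_mul)
qed simp

lemma mergesI: "mul a b = Some c \<Longrightarrow> merges (l @ a # b # r) (l @ c # r)"
  unfolding merges_def by blast

lemma merges_Cons: "merges w u \<Longrightarrow> merges (a # w) (a # u)"
  unfolding merges_def by (elim exE conjE, rule_tac x = "a # l" in exI) auto

lemma merges_head: "mul a b = Some c \<Longrightarrow> merges (a # b # w) (c # w)"
  using mergesI[of a b c "[]"] by simp

lemma cob_cong: "(\<And>u. merges w u \<Longrightarrow> \<phi> u = \<psi> u) \<Longrightarrow> cob w \<phi> = cob w \<psi>"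
proof (induction w arbitrary: \<phi> \<psi>)
  case (Cons a w)
  have "head_mul a \<phi> w = head_mul a \<psi> w"
    using Cons.prems merges_head by (auto simp: head_mul_def split: list.split option.split)
  moreover have "cob w (\<lambda>u. \<phi> (a # u)) = cob w (\<lambda>u. \<psi> (a # u))"
    by (rule Cons.IH) (simp add: Cons.prems merges_Cons)
  ultimately show ?case by simp
qed simp

lemma merges_length: "merges w u \<Longrightarrow> length w = Suc (length u)"
  by (auto simp: merges_def)

lemma merges_A: "merges w u \<Longrightarrow> set w \<subseteq> A \<Longrightarrow> set u \<subseteq> A"
  by (auto simp: merges_def intro: mul_A)

lemma bd_coeff_zero: "\<not> merges w u \<Longrightarrow> (bd_coeff w u :: 'k::field) = 0"
proof -
  assume "\<not> merges w u"
  then have "cob w (\<lambda>v. if v = u then 1 else 0 :: 'k) = cob w (\<lambda>v. 0)"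
    by (intro cob_cong) auto
  then show ?thesis by (simp add: bd_coeff_def cob_zero)
qed

lemma bd_coeff_nonzero_merges: "(bd_coeff w u :: 'k::field) \<noteq> 0 \<Longrightarrow> merges w u"
  using bd_coeff_zero by blast

lemma finite_U: "finite (U k)"
  unfolding U_def using finite_lists_length_eq[OF finite_A, of k] by (simp add: conj_commute)

lemma gr_subset_U: "Q \<subseteq> lists A \<Longrightarrow> gr Q q \<subseteq> U q"
  by (auto simp: gr_def U_def)

lemma finite_gr: "Q \<subseteq> lists A \<Longrightarrow> finite (gr Q q)"
  by (rule finite_subset[OF gr_subset_U finite_U])

lemma cob_expand:
  assumes "w \<in> U (Suc k)"
  shows "cob w \<phi> = (\<Sum>u\<in>U k. \<phi> u * bd_coeff w u)"
proof -
  have "cob w \<phi> = cob w (\<lambda>v. \<Sum>u\<in>U k. \<phi> u * (if v = u then 1 else 0))"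
  proof (rule cob_cong)
    fix v assume "merges w v"
    then have "v \<in> U k" using assms merges_length merges_A by (auto simp: U_def)
    then show "\<phi> v = (\<Sum>u\<in>U k. \<phi> u * (if v = u then 1 else 0))"
      using finite_U[of k] by (simp add: if_distrib[of "\<lambda>t. _ * t"] sum.delta' cong: if_cong)
  qed
  also have "\<dots> = (\<Sum>u\<in>U k. \<phi> u * bd_coeff w u)"
    by (simp only: cob_sum cob_scale bd_coeff_def)
  finally show ?thesis .
qed

lemma bd_bd: "bd (bd x) = 0"
proof
  fix u :: "'a list"
  let ?k = "length u"
  have "bd (bd x) u = (\<Sum>v\<in>U (Suc ?k). (\<Sum>w\<in>U (Suc (Suc ?k)). x w * bd_coeff w v) * bd_coeff v u)"
    unfolding bd_def by (rule sum.cong) (auto simp: U_def)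
  also have "\<dots> = (\<Sum>w\<in>U (Suc (Suc ?k)). x w * (\<Sum>v\<in>U (Suc ?k). bd_coeff v u * bd_coeff w v))"
    unfolding sum_distrib_right sum_distrib_left by (subst sum.swap) (simp add: mult_ac)
  also have "\<dots> = (\<Sum>w\<in>U (Suc (Suc ?k)). x w * cob w (\<lambda>v. bd_coeff v u))"
    by (rule sum.cong) (simp_all add: cob_expand)
  also have "\<dots> = 0" unfolding bd_coeff_def by (simp add: cob_cob)
  finally show "bd (bd x) u = 0 u" by simp
qed

lemma flinear_bd: "flinear (bd :: ('a list \<Rightarrow> 'k::field) \<Rightarrow> _)"
  by (rule flinearI) (auto simp: bd_def fun_eq_iff sum.distrib sum_distrib_left algebra_simps)

lemma flinear_restr_bd: "flinear (\<lambda>x. restr Q (bd x :: 'a list \<Rightarrow> 'k::field))"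
  by (rule flinear_comp[OF flinear_bd flinear_restr])

lemma bd_supp:
  assumes "x \<in> supp_on (gr Q q)" "Q \<subseteq> lists A"
  shows "bd x u = (\<Sum>w\<in>gr Q q. x w * bd_coeff w u)"
proof (cases "q = Suc (length u)")
  case True
  have "(\<Sum>w\<in>gr Q q. x w * bd_coeff w u) = (\<Sum>w\<in>U q. x w * bd_coeff w u)"
    by (rule sum.mono_neutral_left) (use assms gr_subset_U finite_U in \<open>auto simp: supp_on_def\<close>)
  then show ?thesis by (simp add: bd_def True)
next
  case False
  have "x w * bd_coeff w u = 0" if "w \<in> gr Q q" for w
    using that False merges_length[of w u] by (auto simp: gr_def intro!: bd_coeff_zero)
  then have "(\<Sum>w\<in>gr Q q. x w * bd_coeff w u) = 0" by (intro sum.neutral ballI)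
  moreover have "x w = 0" if "w \<in> U (Suc (length u))" for w
    using that assms False by (auto simp: supp_on_def gr_def U_def)
  ultimately show ?thesis by (simp add: bd_def)
qed

lemma restr_in_supp: "restr Q x \<in> supp_on Q"
  by (auto simp: supp_on_def restr_def)

lemma bd_in_gr:
  assumes "x \<in> supp_on (gr Q (Suc q))" "closed Q"
  shows "bd x \<in> supp_on (gr Q q)"
proof -
  have "bd x u = 0" if u: "u \<notin> gr Q q" for u
  proof -
    have "x w * bd_coeff w u = 0" if "w \<in> gr Q (Suc q)" for w
      using u that assms(2) merges_length[of w u]
      by (auto simp: gr_def closed_def intro!: bd_coeff_zero)
    then have "(\<Sum>w\<in>gr Q (Suc q). x w * bd_coeff w u) = 0" by (intro sum.neutral ballI)
    then show ?thesis using bd_supp[OF assms(1)] assms(2) by (simp add: closed_def)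
  qed
  then show ?thesis by (auto simp: supp_on_def)
qed

lemma restr_bd_in_gr:
  assumes "x \<in> supp_on (gr Q (Suc q))" "Q \<subseteq> lists A"
  shows "restr P (bd x) \<in> supp_on (gr P q)"
proof -
  have "bd x u = 0" if u: "length u \<noteq> q" for u
  proof -
    have "x w * bd_coeff w u = 0" if "w \<in> gr Q (Suc q)" for w
      using u that merges_length[of w u] by (auto simp: gr_def intro!: bd_coeff_zero)
    then have "(\<Sum>w\<in>gr Q (Suc q). x w * bd_coeff w u) = 0" by (intro sum.neutral ballI)
    then show ?thesis using bd_supp[OF assms] by simp
  qed
  then show ?thesis by (auto simp: supp_on_def restr_def gr_def)
qed

lemma restr_bd_closed: "x \<in> supp_on (gr Q (Suc q)) \<Longrightarrow> closed Q \<Longrightarrow> restr Q (bd x) = bd x"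
  using bd_in_gr[of x Q q] by (auto simp: restr_def supp_on_def gr_def)

lemma bd_gr_0: "x \<in> supp_on (gr Q 0) \<Longrightarrow> bd x = 0"
proof
  fix u :: "'a list" assume x: "x \<in> supp_on (gr Q 0)"
  have "x w = 0" if "w \<in> U (Suc (length u))" for w
  proof -
    have "w \<notin> gr Q 0" using that by (auto simp: gr_def U_def)
    then show ?thesis using x by (simp add: supp_on_def)
  qed
  then show "bd x u = 0 u" by (simp add: bd_def)
qed

section \<open>Ranks of the boundary and series of homology dimensions\<close>

lemma subspace_img: "fvs.subspace (img Q q)"
proof -
  interpret f: Vector_Spaces.linear fscale fscale "\<lambda>x. restr Q (bd x)"
    by (rule flinear_restr_bd)
  show ?thesis unfolding img_def by (rule f.subspace_image[OF subspace_supp_on])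
qed

lemma img_Suc_subset: "Q \<subseteq> lists A \<Longrightarrow> img Q (Suc q) \<subseteq> supp_on (gr Q q)"
  using restr_bd_in_gr by (auto simp: img_def)

lemma img_0: "img Q 0 = {0}"
proof -
  have "restr Q 0 = 0" by (auto simp: restr_def)
  then have "restr Q (bd x) = 0" if "x \<in> supp_on (gr Q 0)" for x using bd_gr_0[OF that] by simp
  moreover have "0 \<in> supp_on (gr Q 0)" by (rule fvs.subspace_0[OF subspace_supp_on])
  ultimately show ?thesis unfolding img_def by (auto simp: image_iff intro!: bexI[of _ 0])
qed

lemma bd_rank_0: "bd_rank K Q 0 = 0"
  unfolding bd_rank_def img_0 using fvs.dim_le_card[of "{0}" "{}"] by simp

lemma bd_rank_nullity:
  assumes "Q \<subseteq> lists A"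
  shows "card (gr Q q) = fvs.dim {x\<in>supp_on (gr Q q). restr Q (bd x :: 'a list \<Rightarrow> 'k::field) = 0} + bd_rank TYPE('k) Q q"
  using rank_nullity[OF flinear_restr_bd subspace_supp_on order_refl finite_gr[OF assms]]
  by (simp add: bd_rank_def img_def dim_supp_on[OF finite_gr[OF assms]])

text \<open>The boundary matrices agree up to the relabelling \<open>g\<close>, with all degrees
  raised by \<open>s\<close>. Coefficients are compared only inside \<open>Q\<close>, because
  \<open>img\<close> cuts off everything else; so \<open>Q\<close> may be a subquotient that is not
  closed under merging.\<close>

lemma H_iso:
  fixes K :: "'k::field itself"
  assumes g: "bij_betw g Q Q'" and len: "\<And>w. w \<in> Q \<Longrightarrow> length (g w) = length w + s"
    and bd_coeff: "\<And>w u. w \<in> Q \<Longrightarrow> u \<in> Q \<Longrightarrow> (bd_coeff (g w) (g u) :: 'k) = bd_coeff w u"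
    and QA: "Q \<subseteq> lists A" "Q' \<subseteq> lists A"
  shows "H K Q' = fps_X ^ s * H K Q"
proof -
  have grb: "bij_betw g (gr Q q) (gr Q' (q + s))" for q
    using g len by (force simp: bij_betw_def gr_def inj_on_def)
  have gr_small: "gr Q' q = {}" if "q < s" for q
    using g len that by (force simp: bij_betw_def gr_def)
  define G where "G = (\<lambda>x' :: 'a list \<Rightarrow> 'k. restr Q (\<lambda>w. x' (g w)))"
  have linG: "flinear G" by (rule flinearI) (auto simp: G_def restr_def fun_eq_iff)
  have bd_rank: "bd_rank K Q' (q + s) = bd_rank K Q q" for q
  proof -
    have comm: "G (restr Q' (bd x')) = restr Q (bd (G x'))" and suppG: "G x' \<in> supp_on (gr Q q)"
      if x': "x' \<in> supp_on (gr Q' (q + s))" for x'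
    proof -
      show Gx: "G x' \<in> supp_on (gr Q q)"
        using x' g len by (auto simp: G_def restr_def supp_on_def gr_def bij_betw_def)
      show "G (restr Q' (bd x')) = restr Q (bd (G x'))"
      proof
        fix u
        show "G (restr Q' (bd x')) u = restr Q (bd (G x')) u"
        proof (cases "u \<in> Q")
          case True
          then have gu: "g u \<in> Q'" using g by (auto simp: bij_betw_def)
          have "bd x' (g u) = (\<Sum>w'\<in>gr Q' (q + s). x' w' * bd_coeff w' (g u))"
            by (rule bd_supp[OF x' QA(2)])
          also have "\<dots> = (\<Sum>w\<in>gr Q q. x' (g w) * bd_coeff (g w) (g u))"
            by (rule sum.reindex_bij_betw[OF grb, symmetric])
          also have "\<dots> = (\<Sum>w\<in>gr Q q. G x' w * bd_coeff w u)"
            by (rule sum.cong) (auto simp: G_def restr_def gr_def bd_coeff True)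
          also have "\<dots> = bd (G x') u" by (rule bd_supp[OF Gx QA(1), symmetric])
          finally show ?thesis using True gu by (simp add: G_def restr_def)
        qed (simp add: G_def restr_def)
      qed
    qed
    have surj: "\<exists>x'\<in>supp_on (gr Q' (q + s)). G x' = x" if x: "x \<in> supp_on (gr Q q)" for x
    proof
      let ?x = "restr (gr Q' (q + s)) (\<lambda>w'. x (inv_into Q g w'))"
      show "?x \<in> supp_on (gr Q' (q + s))" by (rule restr_in_supp)
      show "G ?x = x"
      proof
        fix w
        show "G ?x w = x w"
        proof (cases "w \<in> Q")
          case True
          then have "inv_into Q g (g w) = w" using g by (simp add: bij_betw_def)
          moreover have "g w \<in> gr Q' (q + s) \<longleftrightarrow> w \<in> gr Q q"
            using True g len by (auto simp: gr_def bij_betw_def)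
          ultimately show ?thesis using True x by (auto simp: G_def restr_def supp_on_def)
        qed (use x in \<open>auto simp: G_def restr_def supp_on_def gr_def\<close>)
      qed
    qed
    have "G ` img Q' (q + s) = img Q q"
    proof
      show "G ` img Q' (q + s) \<subseteq> img Q q" using comm suppG by (auto simp: img_def)
      show "img Q q \<subseteq> G ` img Q' (q + s)"
      proof
        fix y assume "y \<in> (img Q q :: ('a list \<Rightarrow> 'k) set)"
        then obtain x where x: "x \<in> supp_on (gr Q q)" "y = restr Q (bd x)" by (auto simp: img_def)
        then obtain x' where x': "x' \<in> supp_on (gr Q' (q + s))" "G x' = x" using surj by blast
        then show "y \<in> G ` img Q' (q + s)" using comm[OF x'(1)] x(2) unfolding img_def image_image
            by (intro image_eqI[of _ _ x']) simp_all
      qed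
    qed
    moreover have "fvs.dim (G ` img Q' (q + s)) = fvs.dim (img Q' (q + s) :: ('a list \<Rightarrow> 'k) set)"
    proof (cases "q + s")
      case 0
      interpret f: Vector_Spaces.linear fscale fscale G by (rule linG)
      have "G ` {0} = {0}" using f.zero by simp
      then show ?thesis using 0 by (simp only: img_0)
    next
      case (Suc k)
      show ?thesis
        unfolding Suc
      proof (rule dim_image_inj_on[OF linG subspace_img img_Suc_subset[OF QA(2)] finite_gr[OF QA(2)]])
        fix x :: "'a list \<Rightarrow> 'k" assume "x \<in> img Q' (Suc k)" and G0: "G x = 0"
        then have x: "x \<in> supp_on (gr Q' k)" using img_Suc_subset[OF QA(2)] by blast
        show "x = 0"
        proof
          fix w' show "x w' = 0 w'"
          proof (cases "w' \<in> Q'")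
            case True
            then obtain w where "w \<in> Q" "w' = g w" using g by (auto simp: bij_betw_def)
            then show ?thesis using fun_cong[OF G0, of w] by (simp add: G_def restr_def)
          qed (use x in \<open>auto simp: supp_on_def gr_def\<close>)
        qed
      qed
    qed
    ultimately show ?thesis by (simp add: bd_rank_def)
  qed
  have bd_rank_small: "bd_rank K Q' q = 0" if "q < s" for q
  proof -
    have "supp_on (gr Q' q) = {0 :: 'a list \<Rightarrow> 'k}" using gr_small[OF that] by (auto simp: supp_on_def)
    moreover have "restr Q' (bd (0 :: 'a list \<Rightarrow> 'k)) = 0" by (auto simp: bd_def restr_def)
    ultimately have "img Q' q = {0 :: 'a list \<Rightarrow> 'k}" by (simp add: img_def)
    then show ?thesis unfolding bd_rank_def using fvs.dim_le_card[of "{0}" "{}"] by simp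
  qed
  have "hom_dim K Q' (q + s) = hom_dim K Q q" for q
    using bij_betw_same_card[OF grb[of q]] bd_rank[of q] bd_rank[of "Suc q"] by (simp add: hom_dim_def)
  moreover have "hom_dim K Q' q = 0" if "q < s" for q
  proof -
    \<comment> \<open>The borderline degree is \<open>s - 1\<close>: the differential arriving there
      starts in degree \<open>s\<close> of \<open>Q'\<close>, that is, in degree 0 of
      \<open>Q\<close>, where it vanishes.\<close>
    have "bd_rank K Q' (Suc q) = 0"
    proof (cases "Suc q < s")
      case False
      then have "Suc q = s" using that by simp
      then show ?thesis using bd_rank[of 0] bd_rank_0[of K Q] by simp
    qed (rule bd_rank_small)
    then show ?thesis using bd_rank_small[OF that] gr_small[OF that] by (simp add: hom_dim_def)
  qed
  ultimately show ?thesis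
  proof (intro fps_ext)
    fix q
    show "fps_nth (H K Q') q = fps_nth (fps_X ^ s * H K Q) q"
    proof (cases "q < s")
      case False
      then have "hom_dim K Q' q = hom_dim K Q (q - s)"
        using \<open>\<And>q. hom_dim K Q' (q + s) = hom_dim K Q q\<close>[of "q - s"] by simp
      then show ?thesis using False by (simp add: H_def fps_X_power_mult_nth)
    qed (use \<open>\<And>q. q < s \<Longrightarrow> hom_dim K Q' q = 0\<close> in \<open>simp add: H_def fps_X_power_mult_nth\<close>)
  qed
qed

text \<open>The boundary matrix is block diagonal. Ranks add up because projecting the image for the
  union to \<open>Y\<close> yields the image for \<open>Y\<close>, with kernel the image for
  \<open>Z\<close>.\<close>

lemma H_disjoint:
  fixes K :: "'k::field itself"
  assumes YZ: "Y \<inter> Z = {}" "Y \<subseteq> lists A" "Z \<subseteq> lists A"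
    and yz: "\<And>y z. y \<in> Y \<Longrightarrow> z \<in> Z \<Longrightarrow> \<not> merges y z" "\<And>y z. y \<in> Y \<Longrightarrow> z \<in> Z \<Longrightarrow> \<not> merges z y"
  shows "H K (Y \<union> Z) = H K Y + H K Z"
proof -
  let ?Q = "Y \<union> Z"
  have QA: "?Q \<subseteq> lists A" using YZ by auto
  have one: "restr W (restr ?Q (bd x)) = restr W (bd (restr W x))"
    if x: "x \<in> supp_on (gr ?Q q)" and W: "W \<subseteq> ?Q" "\<And>y z. y \<in> ?Q - W \<Longrightarrow> z \<in> W \<Longrightarrow> \<not> merges y z"
    for x :: "'a list \<Rightarrow> 'k" and W q
  proof
    fix u
    have s: "restr W x \<in> supp_on (gr ?Q q)"
      using x by (auto simp: restr_def supp_on_def)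
    have "bd x u = bd (restr W x) u" if "u \<in> W"
      unfolding bd_supp[OF s QA] bd_supp[OF x QA]
    proof (rule sum.cong[OF refl])
      fix w assume "w \<in> gr ?Q q"
      then show "x w * bd_coeff w u = restr W x w * bd_coeff w u"
        using W that by (auto simp: restr_def gr_def intro!: bd_coeff_zero)
    qed
    then show "restr W (restr ?Q (bd x)) u = restr W (bd (restr W x)) u"
      using W by (auto simp: restr_def)
  qed
  have inY: "restr Y (restr ?Q (bd x)) = restr Y (bd (restr Y x))"
    and inZ: "restr Z (restr ?Q (bd x)) = restr Z (bd (restr Z x))"
    if x: "x \<in> supp_on (gr ?Q q)" for x :: "'a list \<Rightarrow> 'k" and q
    using one[OF x, of Y] one[OF x, of Z] yz by blast+
  have bd_rank: "bd_rank K ?Q q = bd_rank K Y q + bd_rank K Z q" for q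
  proof -
    have i1: "restr Y ` img ?Q q = (img Y q :: ('a list \<Rightarrow> 'k) set)"
    proof safe
      fix y :: "'a list \<Rightarrow> 'k" assume "y \<in> img ?Q q"
      then obtain x where x: "x \<in> supp_on (gr ?Q q)" "y = restr ?Q (bd x)" by (auto simp: img_def)
      have "restr Y x \<in> supp_on (gr Y q)" using x by (auto simp: supp_on_def restr_def gr_def)
      then show "restr Y y \<in> img Y q" using inY[OF x(1)] x(2) by (auto simp: img_def)
    next
      fix y :: "'a list \<Rightarrow> 'k" assume "y \<in> img Y q"
      then obtain x where x: "x \<in> supp_on (gr Y q)" "y = restr Y (bd x)" by (auto simp: img_def)
      have x2: "x \<in> supp_on (gr ?Q q)" using x by (auto simp: supp_on_def gr_def)
      have "restr Y x = x" using x by (auto simp: supp_on_def restr_def gr_def)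
      then show "y \<in> restr Y ` img ?Q q" using inY[OF x2] x(2) x2 unfolding img_def image_image
        by (intro image_eqI[of _ _ x]) simp_all
    qed
    have i2: "{y\<in>img ?Q q. restr Y y = 0} = (img Z q :: ('a list \<Rightarrow> 'k) set)"
    proof safe
      fix y :: "'a list \<Rightarrow> 'k" assume "y \<in> img ?Q q" and y0: "restr Y y = 0"
      then obtain x where x: "x \<in> supp_on (gr ?Q q)" "y = restr ?Q (bd x)" by (auto simp: img_def)
      have "y = restr Z y"
      proof
        fix w show "y w = restr Z y w"
          using fun_cong[OF y0, of w] x(2) by (auto simp: restr_def split: if_splits)
      qed
      then have "y = restr Z (bd (restr Z x))" using inZ[OF x(1)] x(2) by simp
      moreover have "restr Z x \<in> supp_on (gr Z q)" using x by (auto simp: supp_on_def restr_def gr_def)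
      ultimately show "y \<in> img Z q" by (auto simp: img_def)
    next
      fix y :: "'a list \<Rightarrow> 'k" assume "y \<in> img Z q"
      then obtain x where x: "x \<in> supp_on (gr Z q)" "y = restr Z (bd x)" by (auto simp: img_def)
      have x2: "x \<in> supp_on (gr ?Q q)" using x by (auto simp: supp_on_def gr_def)
      have Zx: "restr Z x = x" using x by (auto simp: supp_on_def restr_def gr_def)
      have "restr Y x = 0" using x YZ(1) by (auto simp: supp_on_def restr_def gr_def fun_eq_iff)
      then have Y0: "restr Y (restr ?Q (bd x)) = 0" using inY[OF x2] by (auto simp: bd_def restr_def)
      have "y = restr ?Q (bd x)"
      proof
        fix w show "y w = restr ?Q (bd x) w"
          using fun_cong[OF Y0, of w] fun_cong[OF inZ[OF x2], of w] x(2) Zx YZ(1)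
          by (auto simp: restr_def split: if_splits)
      qed
      then show "y \<in> img ?Q q" using x2 by (auto simp: img_def)
      show "restr Y y = 0" using x(2) YZ(1) by (auto simp: restr_def fun_eq_iff)
    qed
    show ?thesis
    proof (cases q)
      case (Suc k)
      have "fvs.dim (img ?Q (Suc k) :: ('a list \<Rightarrow> 'k) set)
          = fvs.dim {y\<in>img ?Q (Suc k). restr Y y = (0 :: 'a list \<Rightarrow> 'k)} + fvs.dim (restr Y ` img ?Q (Suc k) :: ('a list \<Rightarrow> 'k) set)"
        by (rule rank_nullity[OF flinear_restr subspace_img img_Suc_subset[OF QA] finite_gr[OF QA]])
      then show ?thesis using i1 i2 Suc by (simp add: bd_rank_def)
    qed (simp add: bd_rank_0)
  qed
  have "card (gr ?Q q) = card (gr Y q) + card (gr Z q)" for q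
  proof -
    have "gr ?Q q = gr Y q \<union> gr Z q" "gr Y q \<inter> gr Z q = {}" using YZ by (auto simp: gr_def)
    then show ?thesis using finite_gr YZ by (metis card_Un_disjoint)
  qed
  then show ?thesis by (intro fps_ext) (simp add: H_def hom_dim_def bd_rank)
qed

text \<open>The long exact sequence of a subcomplex all of whose cycles bound in the ambient complex
  splits into short exact sequences.\<close>
lemma H_quotient:
  fixes K :: "'k::field itself"
  assumes cl: "closed D" "closed S" "S \<subseteq> D"
    and bound: "\<And>q z. z \<in> supp_on (gr S q) \<Longrightarrow> bd z = (0 :: 'a list \<Rightarrow> 'k) \<Longrightarrow> \<exists>y\<in>supp_on (gr D (Suc q)). bd y = z"
  shows "H K (D - S) = H K D + fps_X * H K S"
proof -
  let ?T = "D - S"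
  have DA: "D \<subseteq> lists A" and SA: "S \<subseteq> lists A" and TA: "?T \<subseteq> lists A" using cl by (auto simp: closed_def)
  have cardT: "card (gr D q) = card (gr ?T q) + card (gr S q)" for q
  proof -
    have "gr D q = gr ?T q \<union> gr S q" "gr ?T q \<inter> gr S q = {}" using cl(3) by (auto simp: gr_def)
    then show ?thesis using finite_gr SA TA by (metis card_Un_disjoint)
  qed
  \<comment> \<open>Projecting the boundaries of \<open>D\<close> to \<open>?T\<close> yields the
    boundaries of \<open>?T\<close>. The kernel consists of the boundaries of \<open>D\<close> that
    lie in \<open>S\<close>, and by \<open>bound\<close> these are all cycles of \<open>S\<close>.
    Rank-nullity for this projection and for the boundary of \<open>S\<close> gives the equation,
    with the dimension of the cycles eliminated.\<close>
  have bd_rank: "bd_rank K ?T (Suc q) + card (gr S q) = bd_rank K D (Suc q) + bd_rank K S q" for q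
  proof -
    have i1: "restr ?T ` img D (Suc q) = (img ?T (Suc q) :: ('a list \<Rightarrow> 'k) set)"
    proof -
      have key: "restr ?T (restr D (bd x)) = restr ?T (bd (restr ?T x))"
        if x: "x \<in> supp_on (gr D (Suc q))" for x :: "'a list \<Rightarrow> 'k"
      proof
        fix u
        have s: "restr ?T x \<in> supp_on (gr D (Suc q))" using x by (auto simp: supp_on_def restr_def)
        have "bd x u = bd (restr ?T x) u" if "u \<in> ?T"
          unfolding bd_supp[OF s DA] bd_supp[OF x DA]
        proof (rule sum.cong[OF refl])
          fix w assume "w \<in> gr D (Suc q)"
          then show "x w * bd_coeff w u = restr ?T x w * bd_coeff w u"
            using cl that by (auto simp: restr_def gr_def closed_def intro!: bd_coeff_zero)
        qed
        then show "restr ?T (restr D (bd x)) u = restr ?T (bd (restr ?T x)) u"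
          by (auto simp: restr_def)
      qed
      show ?thesis
      proof safe
        fix y :: "'a list \<Rightarrow> 'k" assume "y \<in> img D (Suc q)"
        then obtain x where x: "x \<in> supp_on (gr D (Suc q))" "y = restr D (bd x)" by (auto simp: img_def)
        have "restr ?T x \<in> supp_on (gr ?T (Suc q))" using x by (auto simp: supp_on_def restr_def gr_def)
        then show "restr ?T y \<in> img ?T (Suc q)" using key[OF x(1)] x(2) by (auto simp: img_def)
      next
        fix y :: "'a list \<Rightarrow> 'k" assume "y \<in> img ?T (Suc q)"
        then obtain x where x: "x \<in> supp_on (gr ?T (Suc q))" "y = restr ?T (bd x)" by (auto simp: img_def)
        have x2: "x \<in> supp_on (gr D (Suc q))" using x by (auto simp: supp_on_def gr_def)
        have "restr ?T x = x" using x by (auto simp: supp_on_def restr_def gr_def)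
        then show "y \<in> restr ?T ` img D (Suc q)" using key[OF x2] x(2) x2 unfolding img_def image_image
          by (intro image_eqI[of _ _ x]) simp_all
      qed
    qed
    have i2: "{y\<in>img D (Suc q). restr ?T y = 0} = {z\<in>supp_on (gr S q). restr S (bd z) = (0 :: 'a list \<Rightarrow> 'k)}"
    proof safe
      fix y :: "'a list \<Rightarrow> 'k" assume y: "y \<in> img D (Suc q)" and y0: "restr ?T y = 0"
      then obtain x where x: "x \<in> supp_on (gr D (Suc q))" "y = bd x"
        using restr_bd_closed cl(1) by (auto simp: img_def)
      have "y \<in> supp_on (gr D q)" using img_Suc_subset[OF DA] y by blast
      moreover have "y w = 0" if "w \<notin> S" "w \<in> D" for w
        using fun_cong[OF y0, of w] that by (auto simp: restr_def)
      ultimately show "y \<in> supp_on (gr S q)" by (auto simp: supp_on_def gr_def)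
      show "restr S (bd y) = 0" using bd_bd[of x] unfolding x(2) by (simp add: restr_def fun_eq_iff)
    next
      fix z :: "'a list \<Rightarrow> 'k" assume z: "z \<in> supp_on (gr S q)" "restr S (bd z) = 0"
      have "bd z = 0"
      proof (cases q)
        case 0
        then show ?thesis using bd_gr_0 z by auto
      next
        case (Suc k)
        then show ?thesis using z restr_bd_closed[of z S k] cl by simp
      qed
      then obtain y where y: "y \<in> supp_on (gr D (Suc q))" "bd y = z" using bound z by blast
      then show "z \<in> img D (Suc q)" using restr_bd_closed[OF y(1) cl(1)] unfolding img_def
        by (intro image_eqI[of _ _ y]) simp_all
      show "restr ?T z = 0" using z(1) by (auto simp: restr_def supp_on_def gr_def)
    qed
    have "fvs.dim (img D (Suc q) :: ('a list \<Rightarrow> 'k) set)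
          = fvs.dim {y\<in>img D (Suc q). restr ?T y = (0 :: 'a list \<Rightarrow> 'k)} + fvs.dim (restr ?T ` img D (Suc q) :: ('a list \<Rightarrow> 'k) set)"
      by (rule rank_nullity[OF flinear_restr subspace_img img_Suc_subset[OF DA] finite_gr[OF DA]])
    then have "bd_rank K D (Suc q) = fvs.dim {z\<in>supp_on (gr S q). restr S (bd z) = (0 :: 'a list \<Rightarrow> 'k)} + bd_rank K ?T (Suc q)"
      by (simp only: i1 i2 bd_rank_def)
    moreover have "card (gr S q) = fvs.dim {x\<in>supp_on (gr S q). restr S (bd x :: 'a list \<Rightarrow> 'k) = 0} + bd_rank K S q"
      using bd_rank_nullity[OF SA, of q, where 'k='k] by (simp add: bd_rank_def)
    ultimately show ?thesis by simp
  qed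
  show ?thesis
  proof (rule fps_ext)
    fix q
    show "fps_nth (H K (D - S)) q = fps_nth (H K D + fps_X * H K S) q"
    proof (cases q)
      case 0
      have "hom_dim K ?T 0 = hom_dim K D 0"
        using bd_rank[of 0] cardT[of 0] by (simp add: hom_dim_def bd_rank_0)
      then show ?thesis by (simp add: H_def 0)
    next
      case (Suc k)
      have "hom_dim K ?T (Suc k) = hom_dim K D (Suc k) + hom_dim K S k"
        using bd_rank[of k] bd_rank[of "Suc k"] cardT[of "Suc k"] by (simp add: hom_dim_def)
      then show ?thesis by (simp add: H_def Suc)
    qed
  qed
qed

lemma H_empty: "H (K :: 'k::field itself) {} = 0"
proof -
  have "img {} q \<subseteq> {0 :: 'a list \<Rightarrow> 'k}" for q by (auto simp: img_def restr_def)
  then have "bd_rank K {} q = 0" for q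
    unfolding bd_rank_def using fvs.dim_le_card[of "img {} q :: ('a list \<Rightarrow> 'k) set" "{}"] by simp
  then show ?thesis by (intro fps_ext) (simp add: H_def hom_dim_def gr_def)
qed

text \<open>With \<open>D = S\<close> in \<open>H_quotient\<close> the quotient is empty, so
  \<open>(1 + fps_X) * H K S = 0\<close>, and power series have no zero divisors.\<close>

lemma H_acyclic:
  fixes K :: "'k::field itself"
  assumes cl: "closed S"
    and bound: "\<And>q z. z \<in> supp_on (gr S q) \<Longrightarrow> bd z = (0 :: 'a list \<Rightarrow> 'k) \<Longrightarrow> \<exists>y\<in>supp_on (gr S (Suc q)). bd y = z"
  shows "H K S = 0"
proof -
  have "H K (S - S) = H K S + fps_X * H K S"
    by (rule H_quotient[OF cl cl order_refl bound])
  then have "(1 + fps_X) * H K S = 0" by (simp add: algebra_simps H_empty)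
  moreover have "(1 + fps_X :: rat fps) \<noteq> 0"
  proof
    assume "(1 + fps_X :: rat fps) = 0"
    then have "fps_nth (1 + fps_X :: rat fps) 0 = 0" by simp
    then show False by simp
  qed
  ultimately show ?thesis by simp
qed

text \<open>The boundary from \<open>up ` P\<close> to \<open>P\<close> is triangular with respect to \<open>rho\<close>, hence invertible.\<close>
lemma acyclic_matching:
  fixes K :: "'k::field itself" and rho :: "'a list \<Rightarrow> nat"
  assumes cl: "closed S" and S: "S = P \<union> up ` P" "P \<inter> up ` P = {}" and inj: "inj_on up P"
    and len: "\<And>a. a \<in> P \<Longrightarrow> length (up a) = Suc (length a)"
    and diag: "\<And>a. a \<in> P \<Longrightarrow> (bd_coeff (up a) a :: 'k) \<noteq> 0"
    and tri: "\<And>a b. a \<in> P \<Longrightarrow> b \<in> P \<Longrightarrow> merges (up b) a \<Longrightarrow> a \<noteq> b \<Longrightarrow> rho a < rho b"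
    and z: "z \<in> supp_on (gr S q)" "bd z = (0 :: 'a list \<Rightarrow> 'k)"
  shows "\<exists>y\<in>supp_on (gr S (Suc q)). bd y = z"
proof -
  let ?N = "up ` P"
  have SA: "S \<subseteq> lists A" using cl by (simp add: closed_def)
  have PA: "P \<subseteq> lists A" and NA: "?N \<subseteq> lists A" using SA S by auto
  \<comment> \<open>Among the \<open>a\<close> with \<open>x (up a)\<close> nonzero one of largest
    \<open>rho\<close> is chosen. No other \<open>up b\<close> in the support merges to
    \<open>a\<close>, so the boundary of \<open>x\<close> has the nonzero coefficient
    \<open>x (up a) * bd_coeff (up a) a\<close> at \<open>a\<close>.\<close>
  have injT: "x = 0" if x: "x \<in> supp_on (gr ?N q)" and x0: "restr P (bd x) = 0" for q and x :: "'a list \<Rightarrow> 'k"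
  proof (rule ccontr)
    assume "x \<noteq> 0"
    define Z where "Z = {a\<in>P. x (up a) \<noteq> 0 \<and> up a \<in> gr ?N q}"
    have "finite Z"
    proof (rule finite_imageD[of up])
      show "finite (up ` Z)" by (rule finite_subset[OF _ finite_gr[OF NA, of q]]) (auto simp: Z_def)
      show "inj_on up Z" using inj by (auto simp: Z_def inj_on_def)
    qed
    moreover obtain w where w: "x w \<noteq> 0" using \<open>x \<noteq> 0\<close> by (auto simp: fun_eq_iff)
    then have "w \<in> gr ?N q" using x by (auto simp: supp_on_def)
    then have "Z \<noteq> {}" using w by (auto simp: Z_def gr_def)
    ultimately have "Max (rho ` Z) \<in> rho ` Z" and fin: "finite (rho ` Z)" by simp_all
    then obtain a where a: "a \<in> Z" and "rho a = Max (rho ` Z)" by auto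
    then have amax: "rho b \<le> rho a" if "b \<in> Z" for b using Max_ge[OF fin] that by simp
    have aP: "a \<in> P" using a by (simp add: Z_def)
    have "bd x a = (\<Sum>w\<in>gr ?N q. x w * bd_coeff w a)" by (rule bd_supp[OF x NA])
    also have "\<dots> = (\<Sum>w\<in>gr ?N q. if w = up a then x (up a) * bd_coeff (up a) a else 0)"
    proof (rule sum.cong[OF refl])
      fix w assume w: "w \<in> gr ?N q"
      then obtain b where b: "b \<in> P" "w = up b" by (auto simp: gr_def)
      have "x w * bd_coeff w a = 0" if "b \<noteq> a"
      proof (rule ccontr)
        assume nz: "x w * bd_coeff w a \<noteq> 0"
        then have "b \<in> Z" using b w by (auto simp: Z_def)
        moreover have "rho a < rho b"
          by (rule tri[OF aP b(1)]) (use nz b that bd_coeff_nonzero_merges in auto)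
        ultimately show False using amax by force
      qed
      then show "x w * bd_coeff w a = (if w = up a then x (up a) * bd_coeff (up a) a else 0)"
        using b inj aP by (auto simp: inj_on_def)
    qed
    also have "\<dots> = x (up a) * bd_coeff (up a) a"
      using a finite_gr[OF NA, of q] by (simp add: sum.delta Z_def)
    finally have "bd x a \<noteq> 0" using a diag[OF aP] by (simp add: Z_def)
    then show False using fun_cong[OF x0, of a] aP by (simp add: restr_def)
  qed
  define T where "T = (\<lambda>x :: 'a list \<Rightarrow> 'k. restr P (bd x))"
  \<comment> \<open>An injective map between spaces of equal finite dimension is onto; the
    dimensions agree because \<open>up\<close> is a bijection that raises length by one.\<close>
  have T: "T ` supp_on (gr ?N (Suc q)) = supp_on (gr P q)"
  proof (rule subspace_eq_of_dim_eq[OF _ _ order_refl finite_gr[OF PA]])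
    interpret f: Vector_Spaces.linear fscale fscale T
      unfolding T_def by (rule flinear_restr_bd)
    show "fvs.subspace (T ` supp_on (gr ?N (Suc q)))" by (rule f.subspace_image[OF subspace_supp_on])
    show "T ` supp_on (gr ?N (Suc q)) \<subseteq> supp_on (gr P q)"
      using restr_bd_in_gr[OF _ NA] by (auto simp: T_def)
    have "fvs.dim (T ` supp_on (gr ?N (Suc q))) = fvs.dim (supp_on (gr ?N (Suc q)) :: ('a list \<Rightarrow> 'k) set)"
      by (rule dim_image_inj_on[OF _ subspace_supp_on order_refl finite_gr[OF NA]])
        (use injT flinear_restr_bd in \<open>auto simp: T_def\<close>)
    moreover have "bij_betw up (gr P q) (gr ?N (Suc q))"
      using inj len by (auto simp: bij_betw_def gr_def inj_on_def)
    ultimately show "fvs.dim (T ` supp_on (gr ?N (Suc q))) = fvs.dim (supp_on (gr P q) :: ('a list \<Rightarrow> 'k) set)"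
      by (simp add: dim_supp_on finite_gr NA PA bij_betw_same_card)
  qed
  have "restr P z \<in> supp_on (gr P q)" using z(1) by (auto simp: supp_on_def restr_def gr_def)
  then obtain y where y: "y \<in> supp_on (gr ?N (Suc q))" "T y = restr P z" using T by (metis imageE)
  have yS: "y \<in> supp_on (gr S (Suc q))" using y(1) S by (auto simp: supp_on_def gr_def)
  \<comment> \<open>Subtracting the boundary of \<open>y\<close> clears the coordinates in
    \<open>P\<close>. What remains is a cycle supported on the partners of \<open>P\<close>, and
    \<open>injT\<close> makes it zero.\<close>
  define z' where "z' = z - bd y"
  have z'S: "z' \<in> supp_on (gr S q)" using z(1) bd_in_gr[OF yS cl] by (auto simp: z'_def supp_on_def)
  have "z' a = 0" if "a \<in> P" for a
    using fun_cong[OF y(2), of a] that by (simp add: T_def restr_def z'_def)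
  then have "z' \<in> supp_on (gr ?N q)" using z'S S by (auto simp: supp_on_def gr_def)
  moreover have "bd z' = 0"
  proof -
    interpret f: Vector_Spaces.linear fscale fscale "bd :: ('a list \<Rightarrow> 'k) \<Rightarrow> _"
      by (rule flinear_bd)
    show ?thesis unfolding z'_def f.diff using z(2) bd_bd[of y] by simp
  qed
  ultimately have "z' = 0" using injT[of z' q] by (auto simp: restr_def fun_eq_iff)
  then have "bd y = z" by (simp add: z'_def)
  then show ?thesis using yS by blast
qed

end

section \<open>Merges in concatenated words, and relabelling of letters\<close>

context partial_semigroup
begin

lemma pair_split:
  assumes "l @ a # b # r = x @ y"
  obtains (left) r' where "x = l @ a # b # r'" "r = r' @ y"
  | (mid) "x = l @ [a]" "y = b # r"
  | (right) l' where "l = x @ l'" "y = l' @ a # b # r"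
proof -
  from assms consider (1) us where "l @ us = x" "a # b # r = us @ y" | (2) us where "l = x @ us" "us @ a # b # r = y"
    by (auto simp: append_eq_append_conv2)
  then show thesis
  proof cases
    case 1
    show thesis
    proof (cases us)
      case Nil
      then show thesis using 1 right[of "[]"] by simp
    next
      case (Cons a' us')
      show thesis
      proof (cases us')
        case Nil
        then show thesis using 1 Cons mid by simp
      next
        case (Cons b' us'')
        then show thesis using 1 \<open>us = a' # us'\<close> left[of us''] by simp
      qed
    qed
  next
    case 2
    then show thesis using right[of us] by simp
  qed
qed

lemma merges_append:
  assumes "merges (x @ y) u"
  obtains (left) x' where "merges x x'" "u = x' @ y"
  | (mid) x0 a b y0 c where "x = x0 @ [a]" "y = b # y0" "mul a b = Some c" "u = x0 @ c # y0"
  | (right) y' where "merges y y'" "u = x @ y'"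
proof -
  from assms obtain l a b r c where *: "x @ y = l @ a # b # r" "mul a b = Some c" "u = l @ c # r"
    by (auto simp: merges_def)
  from *(1)[symmetric] show thesis
  proof (cases rule: pair_split)
    case (left r')
    then show thesis using that(1)[of "l @ c # r'"] * mergesI[of a b c l r'] by simp
  next
    case mid
    then show thesis using that(2)[of l a b r c] * by simp
  next
    case (right l')
    then show thesis using that(3)[of "l' @ c # r"] * mergesI[of a b c l' r] by simp
  qed
qed

lemma not_merges_Nil: "\<not> merges [] u" and not_merges_single: "\<not> merges [a] u"
  by (auto simp: merges_def Cons_eq_append_conv)

lemma merges_ConsE:
  assumes "merges (a # y) u"
  obtains (head) b y0 c where "y = b # y0" "mul a b = Some c" "u = c # y0"
  | (tail) y' where "merges y y'" "u = a # y'"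
proof -
  have "merges ([a] @ y) u" using assms by simp
  then show thesis
    by (cases rule: merges_append) (use that not_merges_single in auto)
qed

lemma merges_lists:
  assumes "w \<in> lists B" "merges w u" "\<And>a b c. a \<in> B \<Longrightarrow> b \<in> B \<Longrightarrow> mul a b = Some c \<Longrightarrow> c \<in> B"
  shows "u \<in> lists B"
proof -
  from assms(2) obtain l a b r c where "w = l @ a # b # r" "mul a b = Some c" "u = l @ c # r"
    by (auto simp: merges_def)
  then show ?thesis using assms(1) assms(3)[of a b c] by simp
qed

text \<open>\<open>\<phi>\<close> vanishes at the results of merging any pair further left or
  further right, so one term of the boundary survives. The pair starts at position
  \<open>length l\<close> counted from 0, while signs are counted from 1.\<close>

lemma cob_unique_merge:
  assumes "mul a b = Some c" "\<And>u. merges (l @ [a]) u \<Longrightarrow> \<phi> (u @ b # r) = 0"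
    "\<And>u. merges (b # r) u \<Longrightarrow> \<phi> (l @ a # u) = 0"
  shows "cob (l @ a # b # r) \<phi> = (-1) ^ Suc (length l) * \<phi> (l @ c # r)"
  using assms(2,3)
proof (induction l arbitrary: \<phi>)
  case Nil
  have "cob (b # r) (\<lambda>u. \<phi> (a # u)) = cob (b # r) (\<lambda>u. 0)"
    by (rule cob_cong) (use Nil in auto)
  then show ?case using assms(1) by (simp add: head_mul_def cob_zero del: cob.simps(2)) (simp add: head_mul_def)
next
  case (Cons x l)
  have "head_mul x \<phi> (l @ a # b # r) = 0"
  proof (cases l)
    case Nil
    then show ?thesis using Cons.prems(1)[of "[d]" for d] merges_head[of x a _ "[]"]
      by (auto simp: head_mul_def split: option.split)
  next
    case (Cons y l')
    have "\<phi> (d # l' @ a # b # r) = 0" if "mul x y = Some d" for d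
      using Cons.prems(1)[of "d # l' @ [a]"] merges_head[OF that, of "l' @ [a]"] Cons by simp
    then show ?thesis using Cons by (auto simp: head_mul_def split: option.split)
  qed
  moreover have "cob (l @ a # b # r) (\<lambda>u. \<phi> (x # u)) = (-1) ^ Suc (length l) * \<phi> (x # l @ c # r)"
  proof (rule Cons.IH)
    show "\<phi> (x # u @ b # r) = 0" if "merges (l @ [a]) u" for u
      using Cons.prems(1)[of "x # u"] merges_Cons[OF that] by simp
    show "\<phi> (x # l @ a # u) = 0" if "merges (b # r) u" for u
      using Cons.prems(2)[OF that] by simp
  qed
  ultimately show ?case by simp
qed

lemma cob_map:
  assumes "\<And>l a b r. w = l @ a # b # r \<Longrightarrow>
      (case mul a b of None \<Rightarrow> 0 | Some c \<Rightarrow> \<phi> (l @ c # r))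
    = (case mul (h a) (h b) of None \<Rightarrow> 0 | Some c \<Rightarrow> \<psi> (map h l @ c # map h r))"
  shows "cob w \<phi> = cob (map h w) \<psi>"
  using assms
proof (induction w arbitrary: \<phi> \<psi>)
  case (Cons x w)
  have "head_mul x \<phi> w = head_mul (h x) \<psi> (map h w)"
    using Cons.prems[of "[]" x] by (cases w) (auto simp: head_mul_def cong: option.case_cong)
  moreover have "cob w (\<lambda>u. \<phi> (x # u)) = cob (map h w) (\<lambda>u. \<psi> (h x # u))"
  proof (rule Cons.IH)
    fix l a b r assume "w = l @ a # b # r"
    then show "(case mul a b of None \<Rightarrow> 0 | Some c \<Rightarrow> \<phi> (x # l @ c # r))
      = (case mul (h a) (h b) of None \<Rightarrow> 0 | Some c \<Rightarrow> \<psi> (h x # map h l @ c # map h r))"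
      using Cons.prems[of "x # l" a b r] by (simp cong: option.case_cong)
  qed
  ultimately show ?case by simp
qed simp

text \<open>The second alternative in \<open>pairs\<close> is the quotient case: a merge that leaves
  \<open>Q\<close> counts as zero there, so the relabelled letters must have product zero.\<close>

lemma bd_coeff_map:
  assumes inj: "inj_on (map h) Q" and w: "w \<in> Q" "u \<in> Q"
    and pairs: "\<And>l a b r. w = l @ a # b # r \<Longrightarrow>
       (\<exists>c. mul a b = Some c \<and> l @ c # r \<in> Q \<and> mul (h a) (h b) = Some (h c))
     \<or> (\<forall>c. mul a b = Some c \<longrightarrow> l @ c # r \<notin> Q) \<and> mul (h a) (h b) = None"
  shows "(bd_coeff (map h w) (map h u) :: 'k::field) = bd_coeff w u"
  unfolding bd_coeff_def
proof (rule cob_map[symmetric])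
  fix l a b r assume "w = l @ a # b # r"
  from pairs[OF this] show "(case mul a b of None \<Rightarrow> 0 | Some c \<Rightarrow> (if l @ c # r = u then 1 else 0 :: 'k)) =
       (case mul (h a) (h b) of None \<Rightarrow> 0 | Some c \<Rightarrow> (if map h l @ c # map h r = map h u then 1 else 0))"
  proof (elim disjE exE conjE)
    fix c assume c: "mul a b = Some c" "l @ c # r \<in> Q" "mul (h a) (h b) = Some (h c)"
    have "map h (l @ c # r) = map h u \<longleftrightarrow> l @ c # r = u" by (rule inj_on_eq_iff[OF inj c(2) w(2)])
    then show ?thesis using c by simp
  qed (use w in \<open>auto split: option.split\<close>)
qed

end

text \<open>The last letter with property \<open>Pr\<close> fixes the decomposition. It is applied
  to the last separator and to the last letter divisible by the prime.\<close>

lemma append_Cons_right_unique: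
  assumes "e @ x # v = e' @ x' # v'" "Pr x" "Pr x'" "\<forall>y\<in>set v. \<not> Pr y" "\<forall>y\<in>set v'. \<not> Pr y"
  shows "e = e' \<and> x = x' \<and> v = v'"
  using assms by (auto simp: append_eq_append_conv2 Cons_eq_append_conv append_eq_Cons_conv)

lemma append_Cons_left_unique:
  assumes "e @ x # v = e' @ x' # v'" "Pr x" "Pr x'" "\<forall>y\<in>set e. \<not> Pr y" "\<forall>y\<in>set e'. \<not> Pr y"
  shows "e = e' \<and> x = x' \<and> v = v'"
  using assms by (auto simp: append_eq_append_conv2 Cons_eq_append_conv append_eq_Cons_conv)

section \<open>Words with separators and a middle letter\<close>

text \<open>A separator never multiplies with its neighbours, so words with separators span tensor products of
  complexes. A middle letter is an element of the coefficient module \<open>R\<close> in \<open>B \<otimes> R \<otimes> B'\<close>; it may be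
  \<open>1\<close>, and it multiplies on both sides.\<close>
datatype letter = Lit nat | Mid nat | Sep nat

definition letters :: "nat \<Rightarrow> letter set" where
  "letters n = Lit ` {1..n} \<union> Mid ` {1..n} \<union> Sep ` {1..n}"

text \<open>The guard \<open>0 < a * b\<close> keeps associativity valid for labels 0, which lie
  outside \<open>letters n\<close>: otherwise \<open>a * b\<close> could exceed \<open>n\<close>
  although \<open>a * (b * 0)\<close> does not. Two middle letters have product zero, as the
  complexes used contain at most one per word.\<close>

fun lmul :: "nat \<Rightarrow> letter \<Rightarrow> letter \<Rightarrow> letter option" where
  "lmul n (Lit a) (Lit b) = (if 0 < a * b \<and> a * b \<le> n then Some (Lit (a * b)) else None)"
| "lmul n (Lit a) (Mid b) = (if 0 < a * b \<and> a * b \<le> n then Some (Mid (a * b)) else None)"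
| "lmul n (Mid a) (Lit b) = (if 0 < a * b \<and> a * b \<le> n then Some (Mid (a * b)) else None)"
| "lmul n _ _ = None"

lemma mult_le_dest:
  fixes a b d n :: nat
  assumes "0 < a" "0 < b" "0 < d" "a * b * d \<le> n"
  shows "a * b \<le> n" "b * d \<le> n" "a * (b * d) \<le> n"
proof -
  have "a * b \<le> a * b * d" using assms(3) by simp
  from order_trans[OF this assms(4)] show "a * b \<le> n" .
  show *: "a * (b * d) \<le> n" using assms(4) by (simp add: mult.assoc)
  have "b * d \<le> a * (b * d)" using assms(1) by simp
  from order_trans[OF this *] show "b * d \<le> n" .
qed

interpretation wc: partial_semigroup "lmul n" "letters n" for n
proof
  fix a b d
  show "Option.bind (lmul n a b) (\<lambda>c. lmul n c d) = Option.bind (lmul n b d) (lmul n a)"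
  proof -
    have b: "Option.bind (if P then Some x else None) f = (if P then f x else None)"
      for P and x :: letter and f :: "letter \<Rightarrow> letter option" by simp
    have k: "(if 0 < x * y \<and> x * y \<le> n then if 0 < x * y * z \<and> x * y * z \<le> n then Some (F (x * y * z)) else None else None)
       = (if 0 < y * z \<and> y * z \<le> n then if 0 < x * (y * z) \<and> x * (y * z) \<le> n then Some (F (x * (y * z))) else None else None)"
      for x y z :: nat and F :: "nat \<Rightarrow> letter"
    proof (cases "0 < x \<and> 0 < y \<and> 0 < z \<and> x * y * z \<le> n")
      case True
      then show ?thesis using mult_le_dest[of x y z n] by (simp add: mult.assoc)
    next
      case False
      then have "\<not> (0 < x * y * z \<and> x * y * z \<le> n)" "\<not> (0 < x * (y * z) \<and> x * (y * z) \<le> n)"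
        by (auto simp: mult.assoc)
      then show ?thesis by presburger
    qed
    show ?thesis
      by (cases a; cases b; cases d)
        (simp_all only: lmul.simps b k Option.bind.simps if_cancel)
  qed
next
  show "finite (letters n)" by (auto simp: letters_def)
next
  fix a b c assume "a \<in> letters n" "b \<in> letters n" "lmul n a b = Some c"
  then show "c \<in> letters n"
    by (cases a; cases b) (auto simp: letters_def split: if_splits)
qed

lemma lmul_Sep [simp]: "lmul n (Sep f) x = None" "lmul n x (Sep f) = None"
  by (cases x; simp)+

definition no_mid :: "letter list \<Rightarrow> bool" where
  "no_mid w \<longleftrightarrow> (\<forall>f. Mid f \<notin> set w)"

definition good :: "nat \<Rightarrow> letter list set \<Rightarrow> bool" where
  "good n X \<longleftrightarrow> wc.closed n X \<and> (\<forall>c\<in>X. no_mid c \<and> (c = [] \<or> (\<exists>c0 f. c = c0 @ [Sep f])))"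

text \<open>For good \<open>X\<close> this is the tensor product of \<open>X\<close> with the bar
  complex on the letters \<open>B\<close>.\<close>

definition cat :: "letter list set \<Rightarrow> nat set \<Rightarrow> letter list set" where
  "cat X B = {c @ w | c w. c \<in> X \<and> w \<in> lists (Lit ` B)}"

text \<open>\<open>E\<close> tensored with a coefficient module with basis \<open>F\<close> and with
  the bar complex on \<open>B\<close>. The parameter \<open>k\<close> chooses the letter that
  records the coefficient: \<open>Mid\<close>, a separator, or \<open>Lit (p * f)\<close>. Changing
  \<open>k\<close> is how the complexes of the recursion are identified.\<close>

definition mid :: "(nat \<Rightarrow> letter) \<Rightarrow> letter list set \<Rightarrow> nat set \<Rightarrow> nat set \<Rightarrow> letter list set" where
  "mid k E F B = {e @ k f # v | e f v. e \<in> E \<and> f \<in> F \<and> v \<in> lists (Lit ` B)}"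

definition mult_closed :: "nat \<Rightarrow> nat set \<Rightarrow> bool" where
  "mult_closed n B \<longleftrightarrow> B \<subseteq> {1..n} \<and> (\<forall>a\<in>B. \<forall>b\<in>B. a * b \<le> n \<longrightarrow> a * b \<in> B)"

lemma lists_Lit_no_mid: "v \<in> lists (Lit ` B) \<Longrightarrow> no_mid v"
  by (auto simp: no_mid_def)

lemma lists_Lit_merges:
  assumes "mult_closed n B" "v \<in> lists (Lit ` B)" "wc.merges n v u"
  shows "u \<in> lists (Lit ` B)"
  by (rule wc.merges_lists[OF assms(2,3)]) (use assms(1) in \<open>auto simp: mult_closed_def split: if_splits\<close>)

lemma lists_Lit_letters: "mult_closed n B \<Longrightarrow> v \<in> lists (Lit ` B) \<Longrightarrow> v \<in> lists (letters n)"
proof -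
  assume "mult_closed n B" and v: "v \<in> lists (Lit ` B)"
  then have "Lit ` B \<subseteq> letters n" unfolding mult_closed_def letters_def by blast
  from subsetD[OF lists_mono[OF this] v] show ?thesis .
qed

lemma catI: "c \<in> X \<Longrightarrow> w \<in> lists (Lit ` B) \<Longrightarrow> c @ w \<in> cat X B"
  by (auto simp: cat_def)

lemma midI: "e \<in> E \<Longrightarrow> f \<in> F \<Longrightarrow> v \<in> lists (Lit ` B) \<Longrightarrow> e @ k f # v \<in> mid k E F B"
  by (auto simp: mid_def)

lemma midE:
  assumes "w \<in> mid k E F B"
  obtains e f v where "w = e @ k f # v" "e \<in> E" "f \<in> F" "v \<in> lists (Lit ` B)"
  using assms by (auto simp: mid_def)

lemma good_snoc_Sep: "good n X \<Longrightarrow> c @ [a] \<in> X \<Longrightarrow> \<exists>f. a = Sep f"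
  by (auto simp: good_def)

lemma closed_cat:
  assumes X: "good n X" and B: "mult_closed n B"
  shows "wc.closed n (cat X B)"
  unfolding wc.closed_def
proof (intro conjI ballI allI impI)
  show "cat X B \<subseteq> lists (letters n)"
  proof
    fix w assume "w \<in> cat X B"
    then obtain c v where cv: "w = c @ v" "c \<in> X" "v \<in> lists (Lit ` B)" by (auto simp: cat_def)
    have "c \<in> lists (letters n)" using X cv(2) unfolding good_def wc.closed_def by blast
    then show "w \<in> lists (letters n)" using lists_Lit_letters[OF B cv(3)] cv(1) by simp
  qed
  fix w u assume "w \<in> cat X B" "wc.merges n w u"
  then obtain c v where cv: "c \<in> X" "v \<in> lists (Lit ` B)" "wc.merges n (c @ v) u" by (auto simp: cat_def)
  from cv(3) show "u \<in> cat X B"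
  proof (cases rule: wc.merges_append)
    case (left x')
    then show ?thesis using X cv by (auto simp: good_def wc.closed_def intro: catI)
  next
    case (mid x0 a b y0 c')
    then obtain f where "a = Sep f" using good_snoc_Sep[OF X] cv(1) by blast
    then show ?thesis using mid by simp
  next
    case (right y')
    then show ?thesis using catI[OF cv(1) lists_Lit_merges[OF B cv(2)]] by simp
  qed
qed

lemma cat_no_mid: "good n X \<Longrightarrow> e \<in> cat X B \<Longrightarrow> no_mid e"
  by (auto simp: cat_def good_def no_mid_def)

lemma cat_snoc:
  assumes X: "good n X" and e: "e @ [a] \<in> cat X B"
  shows "(\<exists>f. a = Sep f) \<or> (\<exists>b\<in>B. a = Lit b \<and> e \<in> cat X B)"
proof -
  obtain c v where cv: "c \<in> X" "v \<in> lists (Lit ` B)" "e @ [a] = c @ v" using e by (auto simp: cat_def)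
  show ?thesis
  proof (cases v rule: rev_cases)
    case Nil
    then show ?thesis using good_snoc_Sep[OF X, of e a] cv by simp
  next
    case (snoc v' b)
    then show ?thesis using cv by (auto intro: catI)
  qed
qed

lemma cat_snocI: "e \<in> cat X B \<Longrightarrow> b \<in> B \<Longrightarrow> e @ [Lit b] \<in> cat X B"
proof -
  assume "e \<in> cat X B" "b \<in> B"
  then obtain c w where "e = c @ w" "c \<in> X" "w \<in> lists (Lit ` B)" by (auto simp: cat_def)
  then show ?thesis using \<open>b \<in> B\<close> catI[of c X "w @ [Lit b]" B] by simp
qed

lemma mid_letters:
  assumes "wc.closed n E" "mult_closed n B" "\<And>f. f \<in> F \<Longrightarrow> k f \<in> letters n"
  shows "mid k E F B \<subseteq> lists (letters n)"
proof
  fix w assume "w \<in> mid k E F B"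
  then obtain e f v where w: "w = e @ k f # v" "e \<in> E" "f \<in> F" "v \<in> lists (Lit ` B)" by (rule midE)
  have "e \<in> lists (letters n)" using assms(1) w(2) unfolding wc.closed_def by blast
  then show "w \<in> lists (letters n)" using lists_Lit_letters[OF assms(2) w(4)] assms(3)[OF w(3)] w(1) by simp
qed

text \<open>Rewriting \<open>Mid f\<close> as \<open>k f\<close> keeps the boundary matrix.
  \<open>J1\<close> and \<open>J2\<close> treat the products with the left and the right neighbour:
  either both products stay among the coefficients \<open>F\<close> and correspond, or the product
  leaves \<open>F\<close>, hence is zero in the subquotient, and \<open>k f\<close> gives zero as
  well. Pairs away from the middle letter are unchanged.\<close>

lemma H_mid:
  fixes K :: "'k::field itself"
  assumes E: "wc.closed n E" "\<And>e. e \<in> E \<Longrightarrow> no_mid e" and B: "mult_closed n B"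
    and F: "F \<subseteq> {1..n}" and k: "\<And>f. f \<in> F \<Longrightarrow> k f \<in> letters n"
    and inj: "\<And>e f v e' f' v'. e @ k f # v = e' @ k f' # v' \<Longrightarrow> f \<in> F \<Longrightarrow> f' \<in> F \<Longrightarrow>
       v \<in> lists (Lit ` B) \<Longrightarrow> v' \<in> lists (Lit ` B) \<Longrightarrow> e = e' \<and> f = f' \<and> v = v'"
    and J1: "\<And>e a f. e @ [a] \<in> E \<Longrightarrow> f \<in> F \<Longrightarrow>
       (\<exists>f'\<in>F. e \<in> E \<and> lmul n a (Mid f) = Some (Mid f') \<and> lmul n a (k f) = Some (k f'))
     \<or> (\<forall>f'. lmul n a (Mid f) = Some (Mid f') \<longrightarrow> f' \<notin> F) \<and> lmul n a (k f) = None"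
    and J2: "\<And>b f. b \<in> B \<Longrightarrow> f \<in> F \<Longrightarrow>
       (\<exists>f'\<in>F. lmul n (Mid f) (Lit b) = Some (Mid f') \<and> lmul n (k f) (Lit b) = Some (k f'))
     \<or> (\<forall>f'. lmul n (Mid f) (Lit b) = Some (Mid f') \<longrightarrow> f' \<notin> F) \<and> lmul n (k f) (Lit b) = None"
  shows "wc.H n K (mid k E F B) = wc.H n K (mid Mid E F B)"
proof -
  define h where "h = (\<lambda>x. case x of Mid f \<Rightarrow> k f | _ \<Rightarrow> x)"
  have h_simps: "h (Mid f) = k f" "h (Lit a) = Lit a" "h (Sep a) = Sep a" for f a
    by (simp_all add: h_def)
  have h_id: "map h e = e" if "no_mid e" for e
    using that by (induction e) (auto simp: no_mid_def h_def split: letter.split)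
  have hw: "map h (e @ Mid f # v) = e @ k f # v" if "e \<in> E" "v \<in> lists (Lit ` B)" for e f v
    using h_id[OF E(2)[OF that(1)]] h_id[OF lists_Lit_no_mid[OF that(2)]] by (simp add: h_simps)
  have mid_unique: "f \<in> F" if "e @ Mid f # v \<in> mid Mid E F B" "no_mid e" for e f v
  proof -
    from that(1) obtain e' f' v' where *: "e @ Mid f # v = e' @ Mid f' # v'" "e' \<in> E" "f' \<in> F"
      by (auto simp: mid_def)
    have "e = e' \<and> Mid f = Mid f' \<and> v = v'"
      by (rule append_Cons_left_unique[OF *(1), of "\<lambda>x. \<exists>g. x = Mid g"])
        (use that(2) E(2)[OF *(2)] in \<open>auto simp: no_mid_def\<close>)
    then show ?thesis using * by simp
  qed
  have QA: "mid Mid E F B \<subseteq> lists (letters n)" "mid k E F B \<subseteq> lists (letters n)"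
  proof -
    have "Mid f \<in> letters n" if "f \<in> F" for f using F that unfolding letters_def by blast
    then show "mid Mid E F B \<subseteq> lists (letters n)" by (rule mid_letters[OF E(1) B])
    show "mid k E F B \<subseteq> lists (letters n)" by (rule mid_letters[OF E(1) B k])
  qed
  have injQ: "inj_on (map h) (mid Mid E F B)"
  proof (rule inj_onI)
    fix x y assume xy: "x \<in> mid Mid E F B" "y \<in> mid Mid E F B" "map h x = map h y"
    from xy(1) obtain e f v where x: "x = e @ Mid f # v" "e \<in> E" "f \<in> F" "v \<in> lists (Lit ` B)" by (rule midE)
    from xy(2) obtain e' f' v' where y: "y = e' @ Mid f' # v'" "e' \<in> E" "f' \<in> F" "v' \<in> lists (Lit ` B)" by (rule midE)
    have "e @ k f # v = e' @ k f' # v'" using xy(3) x y hw by metis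
    then show "x = y" using inj x y by blast
  qed
  have "map h ` mid Mid E F B = mid k E F B"
  proof (intro equalityI subsetI)
    fix w assume "w \<in> map h ` mid Mid E F B"
    then obtain x where "x \<in> mid Mid E F B" "w = map h x" by blast
    from this(1) obtain e f v where "x = e @ Mid f # v" "e \<in> E" "f \<in> F" "v \<in> lists (Lit ` B)" by (rule midE)
    then show "w \<in> mid k E F B" using hw[of e v f] \<open>w = map h x\<close> midI by simp
  next
    fix w assume "w \<in> mid k E F B"
    then obtain e f v where "w = e @ k f # v" "e \<in> E" "f \<in> F" "v \<in> lists (Lit ` B)" by (rule midE)
    then show "w \<in> map h ` mid Mid E F B"
      using hw[of e v f] midI[of e E f F v B Mid] by (metis imageI)
  qed
  then have bij: "bij_betw (map h) (mid Mid E F B) (mid k E F B)" using injQ by (simp add: bij_betw_def)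
  have "wc.H n K (mid k E F B) = fps_X ^ 0 * wc.H n K (mid Mid E F B)"
  proof (rule wc.H_iso[OF bij _ _ QA])
    fix w u assume wQ: "w \<in> mid Mid E F B" and uQ: "u \<in> mid Mid E F B"
    from wQ obtain e f v where w: "w = e @ Mid f # v" "e \<in> E" "f \<in> F" "v \<in> lists (Lit ` B)" by (rule midE)
    have nme: "no_mid e" and nmv: "no_mid v" using E(2)[OF w(2)] lists_Lit_no_mid[OF w(4)] by auto
    show "(wc.bd_coeff n (map h w) (map h u) :: 'k) = wc.bd_coeff n w u"
    proof (rule wc.bd_coeff_map[OF injQ wQ uQ])
      fix l a b r assume lr: "w = l @ a # b # r"
      have same: "lmul n a b = lmul n (h a) (h b)" "\<And>c. lmul n a b = Some c \<Longrightarrow> h c = c"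
        if "\<forall>g. a \<noteq> Mid g" "\<forall>g. b \<noteq> Mid g"
      proof -
        show "lmul n a b = lmul n (h a) (h b)" using that by (cases a; cases b) (simp_all add: h_simps)
        show "h c = c" if "lmul n a b = Some c" for c
          using that \<open>\<forall>g. a \<noteq> Mid g\<close> \<open>\<forall>g. b \<noteq> Mid g\<close>
          by (cases a; cases b) (auto simp: h_simps split: if_splits)
      qed
      have "l @ a # b # r = e @ Mid f # v" using lr w(1) by simp
      then show "(\<exists>c. lmul n a b = Some c \<and> l @ c # r \<in> mid Mid E F B \<and> lmul n (h a) (h b) = Some (h c))
        \<or> (\<forall>c. lmul n a b = Some c \<longrightarrow> l @ c # r \<notin> mid Mid E F B) \<and> lmul n (h a) (h b) = None"
      proof (cases rule: wc.pair_split)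
        case (left r')
        have nm: "\<forall>g. a \<noteq> Mid g" "\<forall>g. b \<noteq> Mid g" using nme left by (auto simp: no_mid_def)
        show ?thesis
        proof (cases "lmul n a b")
          case None
          then show ?thesis using same(1)[OF nm] by simp
        next
          case (Some c)
          have "l @ c # r' \<in> E" using E(1) w(2) wc.mergesI[OF Some, of l r'] left unfolding wc.closed_def by metis
          then have "l @ c # r \<in> mid Mid E F B" using midI[OF _ w(3,4), of "l @ c # r'" E Mid] left(2) by simp
          then show ?thesis using Some same(1)[OF nm] same(2)[OF nm Some] by simp
        qed
      next
        case mid
        then have b: "b = Mid f" "r = v" and ea: "l @ [a] \<in> E" "no_mid l"
          using w(2) nme by (auto simp: no_mid_def)
        have "h a = a" using nme mid(1) by (cases a) (auto simp: no_mid_def h_simps)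
        from J1[OF ea(1) w(3)] show ?thesis
        proof
          assume "\<exists>f'\<in>F. l \<in> E \<and> lmul n a (Mid f) = Some (Mid f') \<and> lmul n a (k f) = Some (k f')"
          then obtain f' where f': "f' \<in> F" "l \<in> E" "lmul n a (Mid f) = Some (Mid f')" "lmul n a (k f) = Some (k f')"
            by blast
          then have "l @ Mid f' # r \<in> mid Mid E F B" using midI w(4) b by simp
          then show ?thesis using f' b \<open>h a = a\<close> by (simp add: h_simps)
        next
          assume *: "(\<forall>f'. lmul n a (Mid f) = Some (Mid f') \<longrightarrow> f' \<notin> F) \<and> lmul n a (k f) = None"
          have "l @ c # r \<notin> mid Mid E F B" if c: "lmul n a b = Some c" for c
          proof -
            obtain g where "c = Mid g" using c b by (cases a) (auto split: if_splits)
            then show ?thesis using * c b mid_unique[OF _ ea(2)] by auto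
          qed
          then show ?thesis using * b \<open>h a = a\<close> by (simp add: h_simps)
        qed
      next
        case (right l')
        show ?thesis
        proof (cases l')
          case Nil
          then have a: "a = Mid f" "v = b # r" "l = e" using right by auto
          then obtain b' where b': "b = Lit b'" "b' \<in> B" using w(4) by auto
          have rB: "r \<in> lists (Lit ` B)" using w(4) a by simp
          from J2[OF b'(2) w(3)] show ?thesis
          proof
            assume "\<exists>f'\<in>F. lmul n (Mid f) (Lit b') = Some (Mid f') \<and> lmul n (k f) (Lit b') = Some (k f')"
            then obtain f' where f': "f' \<in> F" "lmul n (Mid f) (Lit b') = Some (Mid f')" "lmul n (k f) (Lit b') = Some (k f')"
              by blast
            then have "l @ Mid f' # r \<in> mid Mid E F B" using midI w(2) a rB by simp
            then show ?thesis using f' b' a by (simp add: h_simps del: lmul.simps)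
          next
            assume *: "(\<forall>f'. lmul n (Mid f) (Lit b') = Some (Mid f') \<longrightarrow> f' \<notin> F) \<and> lmul n (k f) (Lit b') = None"
            have "l @ c # r \<notin> mid Mid E F B" if c: "lmul n a b = Some c" for c
            proof -
              obtain g where "c = Mid g" using c b' a by (auto split: if_splits)
              then show ?thesis using * c b' a mid_unique[OF _ nme] by (auto simp del: lmul.simps)
            qed
            then show ?thesis using * b' a by (simp add: h_simps del: lmul.simps)
          qed
        next
          case (Cons m l'')
          then have v: "l = e @ Mid f # l''" "v = l'' @ a # b # r" using right by auto
          have nm: "\<forall>g. a \<noteq> Mid g" "\<forall>g. b \<noteq> Mid g" using nmv v by (auto simp: no_mid_def)
          show ?thesis
          proof (cases "lmul n a b")
            case None
            then show ?thesis using same(1)[OF nm] by simp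
          next
            case (Some c)
            have "l'' @ c # r \<in> lists (Lit ` B)"
              by (rule lists_Lit_merges[OF B w(4)]) (use wc.mergesI[OF Some, of l'' r] v(2) in simp)
            then have "l @ c # r \<in> mid Mid E F B" using midI[OF w(2,3), of "l'' @ c # r" B Mid] v by simp
            then show ?thesis using Some same(1)[OF nm] same(2)[OF nm Some] by simp
          qed
        qed
      qed
    qed
  qed simp
  then show ?thesis by simp
qed

lemma cob_snoc_Sep: "wc.cob n (c @ [Sep f]) \<phi> = wc.cob n c (\<lambda>u. \<phi> (u @ [Sep f]))"
proof (induction c arbitrary: \<phi>)
  case Nil
  then show ?case by (simp add: wc.head_mul_def)
next
  case (Cons a c)
  have "wc.head_mul n a \<phi> (c @ [Sep f]) = wc.head_mul n a (\<lambda>u. \<phi> (u @ [Sep f])) c"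
    by (cases c) (auto simp: wc.head_mul_def split: option.split)
  then show ?case using Cons by simp
qed

lemma H_snoc_Sep:
  fixes K :: "'k::field itself"
  assumes "X \<subseteq> lists (letters n)" "Sep f \<in> letters n"
  shows "wc.H n K ((\<lambda>c. c @ [Sep f]) ` X) = fps_X * wc.H n K X"
proof -
  have "wc.H n K ((\<lambda>c. c @ [Sep f]) ` X) = fps_X ^ 1 * wc.H n K X"
  proof (rule wc.H_iso)
    show "bij_betw (\<lambda>c. c @ [Sep f]) X ((\<lambda>c. c @ [Sep f]) ` X)" by (auto simp: bij_betw_def inj_on_def)
    show "(wc.bd_coeff n (w @ [Sep f]) (u @ [Sep f]) :: 'k) = wc.bd_coeff n w u" for w u
      by (simp add: wc.bd_coeff_def cob_snoc_Sep)
  qed (use subsetD[OF assms(1)] assms(2) in \<open>fastforce+\<close>)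
  then show ?thesis by simp
qed

lemma merges_snoc_Sep:
  assumes "wc.merges n (c @ [Sep f]) u"
  obtains c' where "wc.merges n c c'" "u = c' @ [Sep f]"
  using assms by (cases rule: wc.merges_append) (use that wc.not_merges_single in auto)

definition seps :: "letter list set \<Rightarrow> nat set \<Rightarrow> letter list set" where
  "seps E F = {e @ [Sep f] | e f. e \<in> E \<and> f \<in> F}"

text \<open>Each label in \<open>F\<close> contributes one copy of \<open>X\<close>, raised by one
  degree. No merge touches the final separator, so the copies do not interact.\<close>

lemma H_seps:
  fixes K :: "'k::field itself"
  assumes "X \<subseteq> lists (letters n)" "finite F" "F \<subseteq> {1..n}"
  shows "wc.H n K (seps X F) = of_nat (card F) * fps_X * wc.H n K X"
  using assms(2,3)
proof (induction F rule: finite_induct)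
  case empty
  then show ?case by (simp add: seps_def wc.H_empty)
next
  case (insert f F)
  have Sf: "Sep g \<in> letters n" if "g \<in> insert f F" for g
    using insert.prems that unfolding letters_def by blast
  have s: "seps X (insert f F) = (\<lambda>c. c @ [Sep f]) ` X \<union> seps X F" by (auto simp: seps_def)
  have "wc.H n K (seps X (insert f F)) = wc.H n K ((\<lambda>c. c @ [Sep f]) ` X) + wc.H n K (seps X F)"
    unfolding s
  proof (rule wc.H_disjoint)
    show "(\<lambda>c. c @ [Sep f]) ` X \<inter> seps X F = {}" using insert by (auto simp: seps_def)
    show "(\<lambda>c. c @ [Sep f]) ` X \<subseteq> lists (letters n)"
    proof
      fix w assume "w \<in> (\<lambda>c. c @ [Sep f]) ` X"
      then obtain e where "w = e @ [Sep f]" "e \<in> X" by auto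
      then show "w \<in> lists (letters n)" using subsetD[OF assms(1), of e] Sf[of f] by simp
    qed
    show "seps X F \<subseteq> lists (letters n)"
    proof
      fix w assume "w \<in> seps X F"
      then obtain e g where "w = e @ [Sep g]" "e \<in> X" "g \<in> F" by (auto simp: seps_def)
      then show "w \<in> lists (letters n)" using subsetD[OF assms(1), of e] Sf[of g] by simp
    qed
    fix y z assume y: "y \<in> (\<lambda>c. c @ [Sep f]) ` X" and z: "z \<in> seps X F"
    obtain z0 g where zg: "z = z0 @ [Sep g]" "g \<in> F" using z by (auto simp: seps_def)
    obtain y0 where y0: "y = y0 @ [Sep f]" using y by auto
    show "\<not> wc.merges n y z" using insert zg y0 by (auto elim!: merges_snoc_Sep)
    show "\<not> wc.merges n z y" using insert zg y0 by (auto elim!: merges_snoc_Sep)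
  qed
  then show ?case
    using insert H_snoc_Sep[OF assms(1) Sf[of f], of K] by (simp add: algebra_simps)
qed

text \<open>Any complex without middle letters becomes an admissible left factor once a separator is
  appended. This is what allows the induction hypothesis to be applied with a bar complex on the
  left.\<close>

lemma good_seps:
  assumes "wc.closed n E" "\<And>e. e \<in> E \<Longrightarrow> no_mid e" "F \<subseteq> {1..n}"
  shows "good n (seps E F)"
  unfolding good_def wc.closed_def
proof (intro conjI ballI allI impI)
  show "seps E F \<subseteq> lists (letters n)"
  proof
    fix w assume "w \<in> seps E F"
    then obtain e f where w: "w = e @ [Sep f]" "e \<in> E" "f \<in> F" by (auto simp: seps_def)
    have "e \<in> lists (letters n)" using assms(1) w(2) unfolding wc.closed_def by blast
    moreover have "Sep f \<in> letters n" using assms(3) w(3) unfolding letters_def by blast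
    ultimately show "w \<in> lists (letters n)" using w(1) by simp
  qed
  fix w assume w: "w \<in> seps E F"
  then show "no_mid w" using assms(2) by (auto simp: seps_def no_mid_def)
  show "w = [] \<or> (\<exists>c0 f. w = c0 @ [Sep f])" using w by (auto simp: seps_def)
  fix u assume "wc.merges n w u"
  then show "u \<in> seps E F"
    using w assms(1) by (auto simp: seps_def wc.closed_def elim!: merges_snoc_Sep)
qed

lemma cat_seps: "cat (seps E F) B = mid Sep E F B"
proof (intro equalityI subsetI)
  fix w assume "w \<in> cat (seps E F) B"
  then obtain e f v where "w = (e @ [Sep f]) @ v" "e \<in> E" "f \<in> F" "v \<in> lists (Lit ` B)"
    unfolding cat_def seps_def by blast
  then show "w \<in> mid Sep E F B" using midI[of e E f F v B Sep] by simp
next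
  fix w assume "w \<in> mid Sep E F B"
  then obtain e f v where w: "w = e @ Sep f # v" "e \<in> E" "f \<in> F" "v \<in> lists (Lit ` B)" by (rule midE)
  then have "e @ [Sep f] \<in> seps E F" unfolding seps_def by blast
  from catI[OF this w(4)] show "w \<in> cat (seps E F) B" using w(1) by simp
qed

section \<open>The recursion over the primes\<close>

text \<open>The basis of the augmentation ideal of the subring for the primes from \<open>p\<close>
  on. The unit 1 is excluded because bar words use the augmentation ideal only.\<close>

definition rough :: "nat \<Rightarrow> nat \<Rightarrow> nat set" where
  "rough n p = {a\<in>{2..n}. \<forall>q. prime q \<longrightarrow> q dvd a \<longrightarrow> p \<le> q}"

lemma rough_ge: "a \<in> rough n p \<Longrightarrow> p \<le> a"
proof -
  assume a: "a \<in> rough n p"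
  then obtain q where q: "prime q" "q dvd a" using prime_factor_nat[of a] by (auto simp: rough_def)
  have "q \<le> a" by (rule dvd_imp_le) (use a q in \<open>auto simp: rough_def\<close>)
  moreover have "p \<le> q" using a q by (simp add: rough_def)
  ultimately show ?thesis by linarith
qed

lemma rough_mult:
  assumes "a \<in> rough n p" "b \<in> insert 1 (rough n p)" "a * b \<le> n"
  shows "a * b \<in> rough n p"
proof -
  have b: "b \<ge> 1" "\<forall>q. prime q \<longrightarrow> q dvd b \<longrightarrow> p \<le> q" using assms(2) by (auto simp: rough_def)
  have "2 * 1 \<le> a * b" by (rule mult_le_mono) (use assms(1) b in \<open>auto simp: rough_def\<close>)
  then show ?thesis using assms(1,3) b(2) by (auto simp: rough_def prime_dvd_mult_nat)
qed

lemma mult_closed_rough: "mult_closed n (rough n p)"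
  using rough_mult[of _ n p] by (auto simp: mult_closed_def) (auto simp: rough_def)

lemma mult_closed_rough_diff: "prime p \<Longrightarrow> mult_closed n {a\<in>rough n p. \<not> p dvd a}"
  using rough_mult[of _ n p] by (auto simp: mult_closed_def prime_dvd_mult_nat) (auto simp: rough_def)

lemma rough_prime_mult:
  assumes "prime p" "f \<in> insert 1 (rough n p)" "p * f \<le> n"
  shows "p * f \<in> rough n p"
proof (rule rough_mult[OF _ assms(2,3)])
  have "1 \<le> f" using assms(2) by (auto simp: rough_def)
  then have "p \<le> n" using assms(3) by (metis le_trans mult.right_neutral mult_le_mono2)
  then show "p \<in> rough n p" unfolding rough_def
    using assms(1) by (auto simp: prime_ge_2_nat dest: primes_dvd_imp_eq)
qed

lemma rough_prime_dvdE:
  assumes "prime p" "a \<in> rough n p" "p dvd a"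
  obtains f where "f \<in> insert 1 (rough n p)" "a = p * f" "p * f \<le> n"
proof -
  obtain f where f: "a = p * f" using assms(3) by (auto simp: dvd_def)
  have "a > 0" using assms(2) by (auto simp: rough_def)
  then have "f > 0" using f by simp
  have "f \<le> a" using f prime_gt_0_nat[OF assms(1)] by simp
  have "f \<in> insert 1 (rough n p)"
  proof (cases "f = 1")
    case False
    have "f \<le> n" using \<open>f \<le> a\<close> assms(2) by (simp add: rough_def)
    then show ?thesis using assms(2) f \<open>f > 0\<close> False by (auto simp: rough_def)
  qed simp
  moreover have "p * f \<le> n" using assms(2) f by (simp add: rough_def)
  ultimately show thesis using that f by blast
qed

text \<open>\<open>Pbar\<close> is the Poincare series of R', and \<open>IH\<close> is the Kuenneth
  formula for the bar complex of R'. It is used for three left factors: \<open>X\<close>,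
  \<open>X\<close> followed by one separator, and the bar complex of R over \<open>X\<close>
  followed by a separator for each socle element.\<close>

theorem H_step:
  fixes K :: "'k::field itself" and Pbar :: "rat fps"
  assumes p: "prime p" "p \<le> n" and X: "good n X"
    and IH: "\<And>Y. good n Y \<Longrightarrow> wc.H n K (cat Y {a\<in>rough n p. \<not> p dvd a}) = wc.H n K Y * Pbar"
  shows "wc.H n K (cat X (rough n p)) = (1 + fps_X) * wc.H n K X * Pbar
    + fps_X ^ 2 * of_nat (card {f\<in>insert 1 (rough n p). n < p * f}) * wc.H n K (cat X (rough n p)) * Pbar"
proof -
  \<comment> \<open>\<open>W\<close> and \<open>B\<close> are the letters of the bar complexes of R
    and R', and \<open>E\<close> is \<open>X\<close> tensored with the bar complex of R.
    \<open>F\<close> is the basis of R including 1; \<open>F2\<close> spans the socle and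
    \<open>F1\<close> is a basis modulo the socle. The later \<open>B'\<close> is a set of words in
    \<open>E\<close>, not the bar complex of R'.\<close>
  define W where "W = rough n p"
  define B where "B = {a\<in>rough n p. \<not> p dvd a}"
  define E where "E = cat X W"
  define F where "F = insert 1 W"
  define F1 where "F1 = {f\<in>F. p * f \<le> n}"
  define F2 where "F2 = {f\<in>F. n < p * f}"
  have p2: "p \<ge> 2" using p(1) by (rule prime_ge_2_nat)
  have n1: "1 \<le> n" using p p2 by simp
  have mcW: "mult_closed n W" unfolding W_def by (rule mult_closed_rough)
  have mcB: "mult_closed n B" unfolding B_def by (rule mult_closed_rough_diff[OF p(1)])
  have BW: "B \<subseteq> W" by (auto simp: B_def W_def)
  have Wge: "p \<le> a" "2 \<le> a" "a \<le> n" if "a \<in> W" for a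
    using that rough_ge[of a n p] by (auto simp: W_def rough_def)
  have Fn: "F \<subseteq> {1..n}" using Wge n1 by (fastforce simp: F_def)
  have WF: "a * f \<in> W" if "a \<in> W" "f \<in> F" "a * f \<le> n" for a f
    using rough_mult[of a n p f] that by (simp add: W_def F_def)
  have clX: "wc.closed n X" using X by (simp add: good_def)
  have nmX: "no_mid c" if "c \<in> X" for c using X that by (simp add: good_def)
  have clE: "wc.closed n E" unfolding E_def by (rule closed_cat[OF X mcW])
  have nmE: "no_mid e" if "e \<in> E" for e using cat_no_mid[OF X] that by (simp add: E_def)
  have XE: "X \<subseteq> E" using catI[of _ X "[]" W] by (auto simp: E_def)
  have E_snoc: "(\<exists>f. a = Sep f) \<or> (\<exists>b\<in>W. a = Lit b \<and> e \<in> E)" if "e @ [a] \<in> E" for e a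
    using cat_snoc[OF X, of e a W] that by (simp add: E_def)
  have E_snocI: "e @ [Lit b] \<in> E" if "e \<in> E" "b \<in> W" for e b
    using cat_snocI that by (simp add: E_def)
  have Bl: "v \<in> lists (Lit ` W)" if "v \<in> lists (Lit ` B)" for v
    using lists_mono[of "Lit ` B" "Lit ` W"] BW that by blast
  txt \<open>\<open>D\<close> is \<open>B \<otimes> R \<otimes> B'\<close> and \<open>Sc\<close> its subcomplex with middle letter in the socle; \<open>Dp\<close> is the kernel
    of the augmentation, on which \<open>[\<dots> | f | \<dots>]\<close> with \<open>f \<noteq> 1\<close> is matched with \<open>[\<dots> | f | 1 | \<dots>]\<close>.\<close>
  define D where "D = mid Mid E F B"
  define Sc where "Sc = mid Mid E F2 B"
  define P where "P = mid Mid E W B"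
  define up where "up = (\<lambda>w. concat (map (\<lambda>x. case x of Mid f \<Rightarrow> [Lit f, Mid 1] | _ \<Rightarrow> [x]) w))"
  define Dp where "Dp = P \<union> up ` P"

  \<comment> \<open>Words with one middle letter, and the subcomplexes they form\<close>
  have uniq: "e = e' \<and> f = f' \<and> v = v'" if "e @ Mid f # v = e' @ Mid f' # v'" "no_mid e" "no_mid e'" for e e' f f' v v'
    using append_Cons_left_unique[OF that(1), of "\<lambda>x. \<exists>g. x = Mid g"] that(2,3) by (auto simp: no_mid_def)
  have memD: "e @ Mid f # v \<in> mid Mid E G B \<longleftrightarrow> e \<in> E \<and> f \<in> G \<and> v \<in> lists (Lit ` B)" if "no_mid e" for e f v G
  proof
    assume "e @ Mid f # v \<in> mid Mid E G B"
    then obtain e' f' v' where *: "e @ Mid f # v = e' @ Mid f' # v'" "e' \<in> E" "f' \<in> G" "v' \<in> lists (Lit ` B)"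
      by (rule midE)
    then show "e \<in> E \<and> f \<in> G \<and> v \<in> lists (Lit ` B)" using uniq[OF *(1) that nmE[OF *(2)]] by simp
  qed (auto intro: midI)
  have no_mid_snoc: "no_mid (e @ [Lit f]) \<longleftrightarrow> no_mid e" for e f by (auto simp: no_mid_def)
  have up_id: "concat (map (\<lambda>x. case x of Mid f \<Rightarrow> [Lit f, Mid 1] | _ \<Rightarrow> [x]) w) = w" if "no_mid w" for w
    using that by (induction w) (auto simp: no_mid_def split: letter.split)
  have up_eq: "up (e @ Mid f # v) = e @ Lit f # Mid 1 # v" if "e \<in> E" "v \<in> lists (Lit ` B)" for e f v
    using up_id[OF nmE[OF that(1)]] up_id[OF lists_Lit_no_mid[OF that(2)]] by (simp add: up_def)
  have upP: "\<exists>e f v. w = e @ Lit f # Mid 1 # v \<and> e \<in> E \<and> f \<in> W \<and> v \<in> lists (Lit ` B)" if "w \<in> up ` P" for w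
  proof -
    from that obtain y where y: "y \<in> P" "w = up y" by blast
    from y(1) obtain e f v where "y = e @ Mid f # v" "e \<in> E" "f \<in> W" "v \<in> lists (Lit ` B)"
      unfolding P_def by (rule midE)
    then show ?thesis using y(2) up_eq by blast
  qed
  have upPI: "e @ Lit f # Mid 1 # v \<in> up ` P" if "e \<in> E" "f \<in> W" "v \<in> lists (Lit ` B)" for e f v
  proof -
    have "e @ Mid f # v \<in> P" unfolding P_def by (rule midI[OF that])
    then show ?thesis using up_eq[OF that(1,3), of f] by (metis imageI)
  qed
  have A_D: "mid Mid E G B \<subseteq> lists (letters n)" if "G \<subseteq> F" for G
  proof (rule mid_letters[OF clE mcB])
    show "Mid f \<in> letters n" if "f \<in> G" for f using that \<open>G \<subseteq> F\<close> Fn unfolding letters_def by blast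
  qed
  have mid_merges: "\<exists>e' f' v'. u = e' @ Mid f' # v' \<and> e' \<in> E \<and> v' \<in> lists (Lit ` B) \<and>
      (f' = f \<or> (\<exists>a\<in>W. f' = a * f \<and> a * f \<le> n))"
    if m: "wc.merges n (e @ Mid f # v) u" and e: "e \<in> E" and f: "f \<in> F" and v: "v \<in> lists (Lit ` B)" for e f v u
    using m
  proof (cases rule: wc.merges_append)
    case (left x')
    then have "x' \<in> E" using clE e unfolding wc.closed_def by blast
    then show ?thesis using left v by blast
  next
    case (mid x0 a b y0 c)
    then consider g where "a = Sep g" | a' where "a' \<in> W" "a = Lit a'" "x0 \<in> E" using E_snoc e by blast
    then show ?thesis
    proof cases
      case 1
      then show ?thesis using mid by simp
    next
      case 2
      then have "c = Mid (a' * f)" "a' * f \<le> n" using mid by (auto split: if_splits)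
      moreover have "u = x0 @ c # v" using mid by simp
      ultimately show ?thesis using 2 v by blast
    qed
  next
    case (right y')
    from right(1) show ?thesis
    proof (cases rule: wc.merges_ConsE)
      case (head b y0 c)
      then obtain b' where b': "b = Lit b'" "b' \<in> B" "y0 \<in> lists (Lit ` B)" using v by auto
      then have "c = Mid (b' * f)" "b' * f \<le> n" using head by (auto simp: mult.commute split: if_splits)
      then show ?thesis using head right e b' BW by blast
    next
      case (tail y'')
      then have "y'' \<in> lists (Lit ` B)" using lists_Lit_merges[OF mcB v] by blast
      then show ?thesis using tail right e by blast
    qed
  qed
  \<comment> \<open>A set \<open>G\<close> of basis integers stable under multiplication by
    \<open>W\<close> spans an ideal of R, and coefficients in an ideal give a subcomplex. It is used
    for \<open>F\<close>, \<open>W\<close> and \<open>F2\<close>.\<close>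
  have closed_mid: "wc.closed n (mid Mid E G B)"
    if "G \<subseteq> F" "\<And>a f. a \<in> W \<Longrightarrow> f \<in> G \<Longrightarrow> a * f \<le> n \<Longrightarrow> a * f \<in> G" for G
    unfolding wc.closed_def
  proof (intro conjI ballI allI impI)
    show "mid Mid E G B \<subseteq> lists (letters n)" by (rule A_D[OF that(1)])
    fix w u assume "w \<in> mid Mid E G B" and m: "wc.merges n w u"
    then obtain e f v where w: "w = e @ Mid f # v" "e \<in> E" "f \<in> G" "v \<in> lists (Lit ` B)" by (metis midE)
    have fF: "f \<in> F" using w(3) that(1) by blast
    obtain e' f' v' where u: "u = e' @ Mid f' # v'" "e' \<in> E" "v' \<in> lists (Lit ` B)"
      and f': "f' = f \<or> (\<exists>a\<in>W. f' = a * f \<and> a * f \<le> n)"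
      using mid_merges[OF m[unfolded w(1)] w(2) fF w(4)] by blast
    have "f' \<in> G" using f' that(2) w(3) by blast
    then show "u \<in> mid Mid E G B" unfolding u(1) by (rule midI[OF u(2) _ u(3)])
  qed
  have clD: "wc.closed n D" unfolding D_def
    by (rule closed_mid) (use WF in \<open>auto simp: F_def\<close>)
  have clP: "wc.closed n P" unfolding P_def
    by (rule closed_mid) (use WF in \<open>auto simp: F_def\<close>)
  have clSc: "wc.closed n Sc" unfolding Sc_def
  proof (rule closed_mid)
    fix a f assume af: "a \<in> W" "f \<in> F2" "a * f \<le> n"
    have "p * f \<le> a * f" using Wge(1)[OF af(1)] by simp
    then have "p * f \<le> n" using af(3) by linarith
    then show "a * f \<in> F2" using af(2) by (simp add: F2_def)
  qed (auto simp: F2_def)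
  \<comment> \<open>The socle lies in the augmentation ideal: 1 is not in \<open>F2\<close> because
    \<open>p \<le> n\<close>.\<close>
  have ScP: "Sc \<subseteq> P"
  proof
    fix w assume "w \<in> Sc"
    then obtain e f v where w: "w = e @ Mid f # v" "e \<in> E" "f \<in> F2" "v \<in> lists (Lit ` B)"
      unfolding Sc_def by (rule midE)
    have "f \<in> W" using w(3) p(2) by (auto simp: F2_def F_def)
    then show "w \<in> P" unfolding w(1) P_def by (rule midI[OF w(2) _ w(4)])
  qed
  have DpD: "Dp \<subseteq> D"
  proof
    fix w assume "w \<in> Dp"
    then consider "w \<in> P" | "w \<in> up ` P" by (auto simp: Dp_def)
    then show "w \<in> D"
    proof cases
      case 1
      then obtain e f v where w: "w = e @ Mid f # v" "e \<in> E" "f \<in> W" "v \<in> lists (Lit ` B)"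
        unfolding P_def by (rule midE)
      then show ?thesis unfolding D_def by (auto intro!: midI simp: F_def)
    next
      case 2
      then obtain e f v where w: "w = e @ Lit f # Mid 1 # v" "e \<in> E" "f \<in> W" "v \<in> lists (Lit ` B)"
        using upP by blast
      have "(e @ [Lit f]) @ Mid 1 # v \<in> D" unfolding D_def
        by (rule midI[OF E_snocI[OF w(2,3)] _ w(4)]) (simp add: F_def)
      then show ?thesis using w(1) by simp
    qed
  qed
  have one_W: "1 \<notin> W" using Wge(2)[of 1] by auto
  \<comment> \<open>Merging f with 1 restores the matched word in \<open>P\<close>. Merging 1 with a
    letter b on its right gives the coefficient b, which differs from 1, so the result is in
    \<open>P\<close> too. All other merges keep the shape of a letter followed by the coefficient
    1.\<close>
  have clDp: "wc.closed n Dp"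
    unfolding wc.closed_def
  proof (intro conjI ballI allI impI)
    show "Dp \<subseteq> lists (letters n)" using DpD clD unfolding wc.closed_def by blast
    fix w u assume "w \<in> Dp" and m: "wc.merges n w u"
    then consider "w \<in> P" | "w \<in> up ` P" by (auto simp: Dp_def)
    then show "u \<in> Dp"
    proof cases
      case 1
      then have "u \<in> P" using clP m unfolding wc.closed_def by blast
      then show ?thesis by (simp add: Dp_def)
    next
      case 2
      then obtain e f v where w: "w = e @ Lit f # Mid 1 # v" "e \<in> E" "f \<in> W" "v \<in> lists (Lit ` B)"
        using upP by blast
      from m have "wc.merges n (e @ Lit f # Mid 1 # v) u" using w(1) by simp
      then show ?thesis
      proof (cases rule: wc.merges_append)
        case (left x')
        then have "x' \<in> E" using clE w(2) unfolding wc.closed_def by blast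
        from upPI[OF this w(3,4)] show ?thesis using left by (simp add: Dp_def)
      next
        case (mid x0 a b y0 c)
        then consider g where "a = Sep g" | a' where "a' \<in> W" "a = Lit a'" "x0 \<in> E" using E_snoc w(2) by blast
        then show ?thesis
        proof cases
          case 1
          then show ?thesis using mid by simp
        next
          case 2
          then have c: "c = Lit (a' * f)" "a' * f \<le> n" using mid by (auto split: if_splits)
          have "a' * f \<in> W" by (rule WF[OF 2(1) _ c(2)]) (use w(3) in \<open>simp add: F_def\<close>)
          from upPI[OF 2(3) this w(4)] show ?thesis using mid c by (simp add: Dp_def)
        qed
      next
        case (right y')
        from right(1) show ?thesis
        proof (cases rule: wc.merges_ConsE)
          case (head b y0 c)
          then have "c = Mid f" by (auto split: if_splits)
          then have "u = e @ Mid f # v" using head right by simp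
          moreover have "e @ Mid f # v \<in> P" unfolding P_def by (rule midI[OF w(2-4)])
          ultimately show ?thesis by (simp add: Dp_def)
        next
          case (tail y'')
          from tail(1) show ?thesis
          proof (cases rule: wc.merges_ConsE)
            case (head b y0 c)
            then obtain b' where b': "b = Lit b'" "b' \<in> B" "y0 \<in> lists (Lit ` B)" using w(4) by auto
            then have "c = Mid b'" using head by (auto split: if_splits)
            then have "u = (e @ [Lit f]) @ Mid b' # y0" using head tail right by simp
            moreover have "(e @ [Lit f]) @ Mid b' # y0 \<in> P" unfolding P_def
              by (rule midI[OF E_snocI[OF w(2,3)] _ b'(3)]) (use b' BW in blast)
            ultimately show ?thesis by (simp add: Dp_def)
          next
            case tl: (tail y''')
            have "y''' \<in> lists (Lit ` B)" by (rule lists_Lit_merges[OF mcB w(4) tl(1)])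
            from upPI[OF w(2,3) this] show ?thesis using tl tail right by (simp add: Dp_def)
          qed
        qed
      qed
    qed
  qed
  \<comment> \<open>The length of the word from its middle letter on. Besides its partner,
    \<open>up b\<close> can reach \<open>P\<close> only by letting the coefficient 1 absorb the
    letter behind it, which shortens this tail.\<close>
  define rho where "rho = (\<lambda>w. length (dropWhile (\<lambda>x. \<forall>g. x \<noteq> Mid g) w))"
  have rho_eq: "rho (e @ Mid f # v) = Suc (length v)" if "no_mid e" for e f v
  proof -
    have "dropWhile (\<lambda>x. \<forall>g. x \<noteq> Mid g) (e @ Mid f # v) = dropWhile (\<lambda>x. \<forall>g. x \<noteq> Mid g) (Mid f # v)"
      by (rule dropWhile_append2) (use that in \<open>auto simp: no_mid_def\<close>)
    then show ?thesis by (simp add: rho_def)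
  qed

  \<comment> \<open>Acyclicity of the kernel of the augmentation\<close>
  have disjP: "P \<inter> up ` P = {}"
  proof (rule ccontr)
    assume "P \<inter> up ` P \<noteq> {}"
    then obtain w where w: "w \<in> P" "w \<in> up ` P" by blast
    from upP[OF w(2)] obtain e f v where u: "w = e @ Lit f # Mid 1 # v" "e \<in> E" by blast
    have "(e @ [Lit f]) @ Mid 1 # v \<in> P" using w(1) u by simp
    then show False using memD[of "e @ [Lit f]" 1 v W] one_W nmE[OF u(2)] by (simp add: P_def no_mid_snoc)
  qed
  have acyc: "\<exists>y\<in>supp_on (wc.gr Dp (Suc q)). wc.bd n y = z"
    if "z \<in> supp_on (wc.gr Dp q)" "wc.bd n z = (0 :: letter list \<Rightarrow> 'k)" for q z
  proof (rule wc.acyclic_matching[OF clDp Dp_def disjP _ _ _ _ that])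
    show "inj_on up P"
    proof (rule inj_onI)
      fix x y assume xy: "x \<in> P" "y \<in> P" "up x = up y"
      from xy(1) obtain e f v where x: "x = e @ Mid f # v" "e \<in> E" "f \<in> W" "v \<in> lists (Lit ` B)"
        unfolding P_def by (rule midE)
      from xy(2) obtain e' f' v' where y: "y = e' @ Mid f' # v'" "e' \<in> E" "f' \<in> W" "v' \<in> lists (Lit ` B)"
        unfolding P_def by (rule midE)
      have "(e @ [Lit f]) @ Mid 1 # v = (e' @ [Lit f']) @ Mid 1 # v'"
        using xy(3) up_eq[OF x(2,4), of f] up_eq[OF y(2,4), of f'] x(1) y(1) by simp
      from uniq[OF this] show "x = y" using nmE[OF x(2)] nmE[OF y(2)] x y by (simp add: no_mid_snoc)
    qed
    fix a assume "a \<in> P"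
    then obtain e f v where a: "a = e @ Mid f # v" "e \<in> E" "f \<in> W" "v \<in> lists (Lit ` B)"
      unfolding P_def by (rule midE)
    show "length (up a) = Suc (length a)" using up_eq[OF a(2,4), of f] a(1) by simp
    \<comment> \<open>Only f times 1 leads back to \<open>a\<close>: merges further left keep the
      coefficient 1, and merges further right keep the letter \<open>Lit f\<close>. The coefficient
      is therefore a sign.\<close>
    show "(wc.bd_coeff n (up a) a :: 'k) \<noteq> 0"
    proof -
      have "(wc.bd_coeff n (up a) a :: 'k) = (-1) ^ Suc (length e) * (if e @ Mid f # v = a then 1 else 0)"
        unfolding a(1) up_eq[OF a(2,4)] wc.bd_coeff_def
      proof (rule wc.cob_unique_merge)
        show "lmul n (Lit f) (Mid 1) = Some (Mid f)" using Wge(2,3)[OF a(3)] by simp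
        show "(if u @ Mid 1 # v = e @ Mid f # v then 1 else 0 :: 'k) = 0" if "wc.merges n (e @ [Lit f]) u" for u
        proof -
          have "u \<in> E" using clE E_snocI[OF a(2,3)] that unfolding wc.closed_def by blast
          then show ?thesis using uniq[of u 1 v e f v] nmE a(2) one_W a(3) by auto
        qed
      qed simp
      then show ?thesis using a(1) by simp
    qed
  next
    fix a b assume aP: "a \<in> P" and bP: "b \<in> P" and m: "wc.merges n (up b) a" and ne: "a \<noteq> b"
    from aP obtain e' f' v' where a: "a = e' @ Mid f' # v'" "e' \<in> E" "f' \<in> W" "v' \<in> lists (Lit ` B)"
      unfolding P_def by (rule midE)
    from bP obtain e f v where b: "b = e @ Mid f # v" "e \<in> E" "f \<in> W" "v \<in> lists (Lit ` B)"
      unfolding P_def by (rule midE)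
    have not1: "a \<noteq> w @ Mid 1 # v''" if "no_mid w" for w v''
      using uniq[of e' f' v' w 1 v''] nmE[OF a(2)] that a(1,3) one_W by auto
    have eE: "e @ [Lit f] \<in> E" by (rule E_snocI[OF b(2,3)])
    have "wc.merges n ((e @ [Lit f]) @ Mid 1 # v) a" using m up_eq[OF b(2,4), of f] b(1) by simp
    then show "rho a < rho b"
    proof (cases rule: wc.merges_append)
      case (left x')
      then have "x' \<in> E" using clE eE unfolding wc.closed_def by blast
      then show ?thesis using not1[OF nmE] left by blast
    next
      case (mid x0 a0 b0 y0 c)
      then have "a = b" using b(1) by (auto split: if_splits)
      then show ?thesis using ne by simp
    next
      case (right y')
      from right(1) show ?thesis
      proof (cases rule: wc.merges_ConsE)
        case (head b0 y0 c)
        then obtain b' where "b0 = Lit b'" using b(4) by auto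
        then obtain g where "c = Mid g" using head by (auto split: if_splits)
        then have "a = (e @ [Lit f]) @ Mid g # y0" using head right by simp
        then have "rho a = Suc (length y0)" using rho_eq[of "e @ [Lit f]"] nmE[OF eE] by simp
        moreover have "rho b = Suc (length v)" using rho_eq[OF nmE[OF b(2)]] b(1) by simp
        ultimately show ?thesis using head by simp
      next
        case (tail y'')
        then show ?thesis using not1[OF nmE[OF eE]] right by blast
      qed
    qed
  qed
  have HDp: "wc.H n K Dp = 0" by (rule wc.H_acyclic[OF clDp acyc])
  have HD0: "wc.H n K (D - Dp) = wc.H n K D"
  proof -
    have "wc.H n K (D - Dp) = wc.H n K D + fps_X * wc.H n K Dp"
    proof (rule wc.H_quotient[OF clD clDp DpD])
      fix q and z :: "letter list \<Rightarrow> 'k" assume "z \<in> supp_on (wc.gr Dp q)" "wc.bd n z = 0"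
      then obtain y where y: "y \<in> supp_on (wc.gr Dp (Suc q))" "wc.bd n y = z" using acyc by blast
      have "y \<in> supp_on (wc.gr D (Suc q))" using y(1) DpD by (auto simp: supp_on_def wc.gr_def)
      then show "\<exists>y\<in>supp_on (wc.gr D (Suc q)). wc.bd n y = z" using y(2) by blast
    qed
    then show ?thesis by (simp add: HDp)
  qed
  \<comment> \<open>Cycles of \<open>Sc\<close> lie in \<open>Dp\<close>, where they bound. Hence
    the inclusion into \<open>D\<close> is zero on homology, as \<open>H_quotient\<close>
    requires.\<close>
  have HDS: "wc.H n K (D - Sc) = wc.H n K D + fps_X * wc.H n K Sc"
  proof (rule wc.H_quotient[OF clD clSc])
    show "Sc \<subseteq> D" using ScP DpD by (auto simp: Dp_def)
    fix q and z :: "letter list \<Rightarrow> 'k" assume z: "z \<in> supp_on (wc.gr Sc q)" "wc.bd n z = 0"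
    have "z \<in> supp_on (wc.gr Dp q)" using z(1) ScP by (auto simp: supp_on_def wc.gr_def Dp_def)
    then obtain y where y: "y \<in> supp_on (wc.gr Dp (Suc q))" "wc.bd n y = z" using acyc z(2) by blast
    have "y \<in> supp_on (wc.gr D (Suc q))" using y(1) DpD by (auto simp: supp_on_def wc.gr_def)
    then show "\<exists>y\<in>supp_on (wc.gr D (Suc q)). wc.bd n y = z" using y(2) by blast
  qed
  \<comment> \<open>The words left unmatched: the coefficient is 1 and no letter of \<open>W\<close>
    stands directly before it, since a word with letter g before 1 is the partner of the word with
    coefficient g.\<close>
  have D0: "D - Dp = mid Mid X {1} B"
  proof (intro equalityI subsetI)
    fix w assume w: "w \<in> D - Dp"
    then obtain e f v where efv: "w = e @ Mid f # v" "e \<in> E" "f \<in> F" "v \<in> lists (Lit ` B)"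
      unfolding D_def by (metis DiffD1 midE)
    have "f \<notin> W"
    proof
      assume "f \<in> W"
      then have "w \<in> P" unfolding efv(1) P_def by (rule midI[OF efv(2) _ efv(4)])
      then show False using w by (simp add: Dp_def)
    qed
    then have f1: "f = 1" using efv(3) by (simp add: F_def)
    obtain c y where cy: "e = c @ y" "c \<in> X" "y \<in> lists (Lit ` W)" using efv(2) by (auto simp: E_def cat_def)
    have "y = []"
    proof (rule ccontr)
      assume "y \<noteq> []"
      then obtain y0 l where y: "y = y0 @ [l]" by (metis rev_exhaust)
      then obtain g where g: "l = Lit g" "g \<in> W" using cy(3) by auto
      have "c @ y0 \<in> E" unfolding E_def by (rule catI[OF cy(2)]) (use cy(3) y in simp)
      from upPI[OF this g(2) efv(4)] have "w \<in> up ` P" using efv(1) f1 cy(1) y g by simp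
      then show False using w by (simp add: Dp_def)
    qed
    then have "e \<in> X" using cy by simp
    then show "w \<in> mid Mid X {1} B" unfolding efv(1) by (rule midI) (use f1 efv(4) in auto)
  next
    fix w assume "w \<in> mid Mid X {1} B"
    then obtain e f v where efv: "w = e @ Mid f # v" "e \<in> X" "f \<in> {1}" "v \<in> lists (Lit ` B)"
      by (rule midE)
    then have f1: "f = 1" by simp
    have eE: "e \<in> E" using XE efv(2) by blast
    have "w \<in> D" unfolding efv(1) D_def by (rule midI[OF eE _ efv(4)]) (simp add: f1 F_def)
    moreover have "w \<notin> P" using memD[OF nmE[OF eE], of f v W] efv(1) f1 one_W by (simp add: P_def)
    moreover have "w \<notin> up ` P"
    proof
      assume "w \<in> up ` P"
      then obtain e' f' v' where u: "w = e' @ Lit f' # Mid 1 # v'" "e' \<in> E" using upP by blast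
      then have "e @ Mid 1 # v = (e' @ [Lit f']) @ Mid 1 # v'" using efv(1) f1 by simp
      then have "e = e' @ [Lit f']" using uniq[OF _ nmE[OF eE]] nmE[OF u(2)] no_mid_snoc by blast
      then show False using good_snoc_Sep[OF X] efv(2) by blast
    qed
    ultimately show "w \<in> D - Dp" by (simp add: Dp_def)
  qed

  \<comment> \<open>Series of \<open>D\<close> and of its socle part\<close>
  have DS: "D - Sc = mid Mid E F1 B"
  proof (intro equalityI subsetI)
    fix w assume w: "w \<in> D - Sc"
    then obtain e f v where efv: "w = e @ Mid f # v" "e \<in> E" "f \<in> F" "v \<in> lists (Lit ` B)"
      unfolding D_def by (metis DiffD1 midE)
    have "f \<notin> F2" using w memD[OF nmE[OF efv(2)], of f v F2] efv by (simp add: Sc_def)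
    then have "f \<in> F1" using efv(3) by (simp add: F1_def F2_def)
    then show "w \<in> mid Mid E F1 B" unfolding efv(1) by (rule midI[OF efv(2) _ efv(4)])
  next
    fix w assume "w \<in> mid Mid E F1 B"
    then obtain e f v where efv: "w = e @ Mid f # v" "e \<in> E" "f \<in> F1" "v \<in> lists (Lit ` B)"
      by (rule midE)
    have f: "f \<in> F" "f \<notin> F2" using efv(3) by (auto simp: F1_def F2_def)
    have "w \<in> D" unfolding efv(1) D_def by (rule midI[OF efv(2) f(1) efv(4)])
    moreover have "w \<notin> Sc" using memD[OF nmE[OF efv(2)], of f v F2] efv f by (simp add: Sc_def)
    ultimately show "w \<in> D - Sc" by simp
  qed
  \<comment> \<open>Modulo \<open>Dp\<close> the coefficient 1 cannot absorb a letter on its right,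
    and on its left there is a separator or nothing. It thus behaves like a separator, and any label
    would do; \<open>n\<close> is an available one because \<open>1 \<le> n\<close>.\<close>
  have HD: "wc.H n K D = fps_X * wc.H n K X * Pbar"
  proof -
    have Sn: "Sep n \<in> letters n" using n1 unfolding letters_def by auto
    have m: "mid (\<lambda>f. Sep n) X {1} B = mid Sep X {n} B" by (auto simp: mid_def)
    have "wc.H n K (mid (\<lambda>f. Sep n) X {1} B) = wc.H n K (mid Mid X {1} B)"
    proof (rule H_mid[OF clX nmX mcB])
      fix e f v e' f' v'
      assume "e @ Sep n # v = e' @ Sep n # v'" "f \<in> {1::nat}" "f' \<in> {1::nat}" "v \<in> lists (Lit ` B)" "v' \<in> lists (Lit ` B)"
      then show "e = e' \<and> f = f' \<and> v = v'"
        using append_Cons_right_unique[of e "Sep n" v e' "Sep n" v' "\<lambda>x. \<exists>g. x = Sep g"] by auto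
    next
      fix e a f assume "e @ [a] \<in> X"
      then obtain g where "a = Sep g" using good_snoc_Sep[OF X] by blast
      then show "(\<exists>f'\<in>{1}. e \<in> X \<and> lmul n a (Mid f) = Some (Mid f') \<and> lmul n a (Sep n) = Some (Sep n)) \<or>
         (\<forall>f'. lmul n a (Mid f) = Some (Mid f') \<longrightarrow> f' \<notin> {1}) \<and> lmul n a (Sep n) = None" by simp
    next
      fix b f assume "b \<in> B" "f \<in> {1::nat}"
      then show "(\<exists>f'\<in>{1}. lmul n (Mid f) (Lit b) = Some (Mid f') \<and> lmul n (Sep n) (Lit b) = Some (Sep n)) \<or>
         (\<forall>f'. lmul n (Mid f) (Lit b) = Some (Mid f') \<longrightarrow> f' \<notin> {1}) \<and> lmul n (Sep n) (Lit b) = None"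
        using BW one_W by auto
    qed (use Sn n1 in auto)
    then have "wc.H n K D = wc.H n K (cat (seps X {n}) B)" using HD0 D0 m cat_seps[of X "{n}" B] by simp
    also have "\<dots> = wc.H n K (seps X {n}) * Pbar"
      unfolding B_def by (rule IH, rule good_seps[OF clX nmX]) (use n1 in auto)
    also have "wc.H n K (seps X {n}) = fps_X * wc.H n K X"
      using H_seps[of X n "{n}" K] clX n1 by (simp add: wc.closed_def)
    finally show ?thesis .
  qed
  \<comment> \<open>A socle coefficient has product zero with every letter of \<open>W\<close>, so
    it may be written as a separator. The left factor is then \<open>E\<close> itself, which is why
    the unknown series reappears on the right of the recursion.\<close>
  have HSc: "wc.H n K Sc = of_nat (card F2) * fps_X * wc.H n K E * Pbar"
  proof -
    have F2n: "F2 \<subseteq> {1..n}" using Fn by (auto simp: F2_def)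
    have big: "n < a * f" if "a \<in> W" "f \<in> F2" for a f
    proof -
      have "p * f \<le> a * f" using Wge(1)[OF that(1)] by simp
      moreover have "n < p * f" using that(2) by (simp add: F2_def)
      ultimately show ?thesis by linarith
    qed
    have "wc.H n K (mid Sep E F2 B) = wc.H n K (mid Mid E F2 B)"
    proof (rule H_mid[OF clE nmE mcB F2n])
      fix f assume "f \<in> F2" then show "Sep f \<in> letters n" using F2n unfolding letters_def by blast
    next
      fix e f v e' f' v'
      assume "e @ Sep f # v = e' @ Sep f' # v'" "v \<in> lists (Lit ` B)" "v' \<in> lists (Lit ` B)"
      then show "e = e' \<and> f = f' \<and> v = v'"
        using append_Cons_right_unique[of e "Sep f" v e' "Sep f'" v' "\<lambda>x. \<exists>g. x = Sep g"] by auto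
    next
      fix e a f assume "e @ [a] \<in> E" "f \<in> F2"
      then have "lmul n a (Mid f) = None" using E_snoc[of e a] big[of _ f] by fastforce
      then show "(\<exists>f'\<in>F2. e \<in> E \<and> lmul n a (Mid f) = Some (Mid f') \<and> lmul n a (Sep f) = Some (Sep f')) \<or>
         (\<forall>f'. lmul n a (Mid f) = Some (Mid f') \<longrightarrow> f' \<notin> F2) \<and> lmul n a (Sep f) = None" by simp
    next
      fix b f assume "b \<in> B" "f \<in> F2"
      then have "n < b * f" using big BW by blast
      then have "lmul n (Mid f) (Lit b) = None" by (simp add: mult.commute)
      then show "(\<exists>f'\<in>F2. lmul n (Mid f) (Lit b) = Some (Mid f') \<and> lmul n (Sep f) (Lit b) = Some (Sep f')) \<or>
         (\<forall>f'. lmul n (Mid f) (Lit b) = Some (Mid f') \<longrightarrow> f' \<notin> F2) \<and> lmul n (Sep f) (Lit b) = None"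
        by (simp del: lmul.simps(3))
    qed
    then have "wc.H n K Sc = wc.H n K (cat (seps E F2) B)" using cat_seps[of E F2 B] by (simp add: Sc_def)
    also have "\<dots> = wc.H n K (seps E F2) * Pbar"
      unfolding B_def by (rule IH, rule good_seps[OF clE nmE F2n])
    also have "wc.H n K (seps E F2) = of_nat (card F2) * fps_X * wc.H n K E"
      by (rule H_seps[OF _ _ F2n]) (use clE F2n finite_subset in \<open>auto simp: wc.closed_def\<close>)
    finally show ?thesis .
  qed
  \<comment> \<open>Multiplication by \<open>p\<close> is an isomorphism of R-modules from R / S to
    the ideal (p). The coefficient f of \<open>D - Sc\<close> is rewritten accordingly as the
    ordinary letter \<open>p * f\<close>.\<close>
  define B' where "B' = mid (\<lambda>f. Lit (p * f)) E F1 B"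
  have pF1: "p * f \<in> W" if "f \<in> F1" for f
    using rough_prime_mult[OF p(1), of f n] that by (simp add: F1_def F_def W_def)
  have HB': "wc.H n K B' = wc.H n K (D - Sc)"
    unfolding DS B'_def
  proof (rule H_mid[OF clE nmE mcB])
    show "F1 \<subseteq> {1..n}" using Fn by (auto simp: F1_def)
    fix f assume "f \<in> F1"
    from Wge(2,3)[OF pF1[OF this]] have "p * f \<in> {1..n}" unfolding atLeastAtMost_iff by linarith
    then show "Lit (p * f) \<in> letters n" unfolding letters_def by blast
  next
    fix e f v e' f' v'
    assume *: "e @ Lit (p * f) # v = e' @ Lit (p * f') # v'" "v \<in> lists (Lit ` B)" "v' \<in> lists (Lit ` B)"
    \<comment> \<open>Letters from \<open>B\<close> are not divisible by \<open>p\<close>, so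
      \<open>Lit (p * f)\<close> is recognised as the last letter divisible by
      \<open>p\<close>.\<close>
    have "e = e' \<and> Lit (p * f) = Lit (p * f') \<and> v = v'"
      by (rule append_Cons_right_unique[OF *(1), of "\<lambda>x. \<exists>g. x = Lit (p * g)"])
        (use *(2,3) in \<open>auto simp: B_def\<close>)
    then show "e = e' \<and> f = f' \<and> v = v'" using p2 by auto
  next
    fix e a f assume ea: "e @ [a] \<in> E" and f: "f \<in> F1"
    have f0: "0 < f" "f \<in> F" using f Fn by (auto simp: F1_def)
    show "(\<exists>f'\<in>F1. e \<in> E \<and> lmul n a (Mid f) = Some (Mid f') \<and> lmul n a (Lit (p * f)) = Some (Lit (p * f'))) \<or>
       (\<forall>f'. lmul n a (Mid f) = Some (Mid f') \<longrightarrow> f' \<notin> F1) \<and> lmul n a (Lit (p * f)) = None"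
      using E_snoc[OF ea]
    proof (elim disjE exE bexE conjE)
      fix b assume b: "b \<in> W" "a = Lit b" "e \<in> E"
      have comm: "b * (p * f) = p * (b * f)" by (simp add: mult_ac)
      show ?thesis
      proof (cases "p * (b * f) \<le> n")
        case True
        have "b * f \<le> p * (b * f)" using p2 by simp
        then have bf: "b * f \<le> n" using True by linarith
        then have "b * f \<in> F1" using WF[OF b(1) f0(2)] True by (simp add: F1_def F_def)
        moreover have "0 < b * f" using f0 Wge(2)[OF b(1)] by simp
        ultimately show ?thesis using b bf True p2 by (intro disjI1 bexI[of _ "b * f"]) (simp_all add: comm)
      next
        case False
        then show ?thesis using b by (intro disjI2) (auto simp: comm F1_def split: if_splits)
      qed
    qed simp
  next
    fix b f assume bB: "b \<in> B" and f: "f \<in> F1"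
    have f0: "0 < f" "f \<in> F" using f Fn by (auto simp: F1_def)
    have b: "b \<in> W" using bB BW by blast
    have comm: "p * f * b = p * (b * f)" "f * b = b * f" by (simp_all add: mult_ac)
    show "(\<exists>f'\<in>F1. lmul n (Mid f) (Lit b) = Some (Mid f') \<and> lmul n (Lit (p * f)) (Lit b) = Some (Lit (p * f'))) \<or>
       (\<forall>f'. lmul n (Mid f) (Lit b) = Some (Mid f') \<longrightarrow> f' \<notin> F1) \<and> lmul n (Lit (p * f)) (Lit b) = None"
    proof (cases "p * (b * f) \<le> n")
      case True
      have "b * f \<le> p * (b * f)" using p2 by simp
      then have bf: "b * f \<le> n" using True by linarith
      then have "b * f \<in> F1" using WF[OF b f0(2)] True by (simp add: F1_def F_def)
      moreover have "0 < b * f" using f0 Wge(2)[OF b] by simp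
      ultimately show ?thesis using bf True p2 by (intro disjI1 bexI[of _ "b * f"]) (simp_all add: comm)
    next
      case False
      then show ?thesis by (intro disjI2) (auto simp: comm F1_def split: if_splits)
    qed
  qed

  \<comment> \<open>Splitting the bar complex at the last multiple of the prime\<close>
  have split: "E = cat X B \<union> B'"
  proof (intro equalityI subsetI)
    fix w assume "w \<in> E"
    then obtain c y where cy: "w = c @ y" "c \<in> X" "y \<in> lists (Lit ` W)" by (auto simp: E_def cat_def)
    show "w \<in> cat X B \<union> B'"
    proof (cases "\<exists>x\<in>set y. \<exists>g. x = Lit (p * g)")
      case False
      have "y \<in> lists (Lit ` B)"
        unfolding in_lists_conv_set
      proof
        fix x assume x: "x \<in> set y"
        then obtain g where g: "x = Lit g" "g \<in> W" using cy(3) by auto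
        then have "\<not> p dvd g" using False x by (auto simp: dvd_def)
        then show "x \<in> Lit ` B" using g by (auto simp: B_def W_def)
      qed
      then show ?thesis using catI cy by blast
    next
      case True
      then obtain y1 x y2 where y: "y = y1 @ x # y2" "\<exists>g. x = Lit (p * g)" "\<forall>z\<in>set y2. \<not> (\<exists>g. z = Lit (p * g))"
        using split_list_last_prop[of y "\<lambda>x. \<exists>g. x = Lit (p * g)"] by blast
      have y2: "y2 \<in> lists (Lit ` B)"
        unfolding in_lists_conv_set
      proof
        fix x assume x: "x \<in> set y2"
        then obtain g where g: "x = Lit g" "g \<in> W" using cy(3) y(1) by auto
        then have "\<not> p dvd g" using y(3) x by (auto simp: dvd_def)
        then show "x \<in> Lit ` B" using g by (auto simp: B_def W_def)
      qed
      obtain g where g: "x = Lit (p * g)" using y(2) by blast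
      then have "p * g \<in> W" using cy(3) y(1) by auto
      then obtain f where f: "f \<in> F" "p * g = p * f" "p * f \<le> n"
        using rough_prime_dvdE[OF p(1), of "p * g" n] by (auto simp: W_def F_def)
      have "c @ y1 \<in> E" unfolding E_def by (rule catI[OF cy(2)]) (use cy(3) y(1) in simp)
      moreover have "f \<in> F1" using f by (simp add: F1_def)
      ultimately have "(c @ y1) @ Lit (p * f) # y2 \<in> B'" unfolding B'_def using y2 by (rule midI)
      then show ?thesis using cy(1) y(1) g f(2) by simp
    qed
  next
    fix w assume "w \<in> cat X B \<union> B'"
    then show "w \<in> E"
    proof
      assume "w \<in> cat X B" then show "w \<in> E" using Bl unfolding cat_def E_def by blast
    next
      assume "w \<in> B'"
      then obtain e f v where efv: "w = e @ Lit (p * f) # v" "e \<in> E" "f \<in> F1" "v \<in> lists (Lit ` B)"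
        unfolding B'_def by (rule midE)
      obtain c y where cy: "e = c @ y" "c \<in> X" "y \<in> lists (Lit ` W)" using efv(2) by (auto simp: E_def cat_def)
      have "y @ Lit (p * f) # v \<in> lists (Lit ` W)" using cy(3) pF1[OF efv(3)] Bl[OF efv(4)] by simp
      from catI[OF cy(2) this] show "w \<in> E" using efv(1) cy(1) by (simp add: E_def)
    qed
  qed
  have disj: "cat X B \<inter> B' = {}"
  proof (rule ccontr)
    assume "cat X B \<inter> B' \<noteq> {}"
    then obtain w where w: "w \<in> cat X B" "w \<in> B'" by blast
    from w(1) obtain c y where cy: "w = c @ y" "c \<in> X" "y \<in> lists (Lit ` B)" by (auto simp: cat_def)
    from w(2) obtain e f v where efv: "w = e @ Lit (p * f) # v" "e \<in> E" "f \<in> F1" "v \<in> lists (Lit ` B)"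
      unfolding B'_def by (rule midE)
    have ny: "Lit (p * f) \<notin> set y" using cy(3) by (auto simp: B_def)
    from cy(1) efv(1) have "e @ Lit (p * f) # v = c @ y" by simp
    then consider us where "c = e @ us" "Lit (p * f) # v = us @ y" | us where "e = c @ us" "us @ Lit (p * f) # v = y"
      by (auto simp: append_eq_append_conv2)
    then show False
    proof cases
      case 1
      then have "us \<noteq> []" using ny by (cases us) auto
      then obtain us0 l where us: "us = us0 @ [l]" by (metis rev_exhaust)
      then have "l \<in> set (Lit (p * f) # v)" using 1(2) by simp
      then obtain g where "l = Lit g" using efv(4) by auto
      moreover obtain h where "l = Sep h" using good_snoc_Sep[OF X, of "e @ us0" l] cy(2) 1(1) us by auto
      ultimately show False by simp
    next
      case 2
      then show False using ny by auto
    qed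
  qed
  have clXB: "wc.closed n (cat X B)" by (rule closed_cat[OF X mcB])
  have B'merges: "u \<in> B'" if w: "w \<in> B'" and m: "wc.merges n w u" for w u
  proof -
    from w obtain e f v where efv: "w = e @ Lit (p * f) # v" "e \<in> E" "f \<in> F1" "v \<in> lists (Lit ` B)"
      unfolding B'_def by (rule midE)
    have fF: "f \<in> F" using efv(3) by (simp add: F1_def)
    have F1I: "a * f \<in> F1" if "a \<in> W" "p * (a * f) \<le> n" for a
    proof -
      have "a * f \<le> p * (a * f)" using p2 by simp
      then have "a * f \<le> n" using that(2) by linarith
      then show ?thesis using WF[OF that(1) fF] that(2) by (simp add: F1_def F_def)
    qed
    from m have "wc.merges n (e @ Lit (p * f) # v) u" using efv(1) by simp
    then show ?thesis
    proof (cases rule: wc.merges_append)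
      case (left x')
      then have "x' \<in> E" using clE efv(2) unfolding wc.closed_def by blast
      then show ?thesis unfolding left(2) B'_def by (rule midI[OF _ efv(3,4)])
    next
      case (mid x0 a b y0 c)
      then consider g where "a = Sep g" | a' where "a' \<in> W" "a = Lit a'" "x0 \<in> E" using E_snoc efv(2) by blast
      then show ?thesis
      proof cases
        case 1
        then show ?thesis using mid by simp
      next
        case 2
        then have c: "c = Lit (p * (a' * f))" "p * (a' * f) \<le> n"
          using mid by (auto simp: mult_ac split: if_splits)
        have "x0 @ Lit (p * (a' * f)) # v \<in> B'" unfolding B'_def
          by (rule midI[OF 2(3) F1I[OF 2(1) c(2)] efv(4)])
        then show ?thesis using mid c by simp
      qed
    next
      case (right y')
      from right(1) show ?thesis
      proof (cases rule: wc.merges_ConsE)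
        case (head b y0 c)
        then obtain b' where b': "b = Lit b'" "b' \<in> B" "y0 \<in> lists (Lit ` B)" using efv(4) by auto
        then have c: "c = Lit (p * (b' * f))" "p * (b' * f) \<le> n"
          using head by (auto simp: mult_ac split: if_splits)
        have "e @ Lit (p * (b' * f)) # y0 \<in> B'" unfolding B'_def
          by (rule midI[OF efv(2) F1I[OF _ c(2)] b'(3)]) (use b' BW in blast)
        then show ?thesis using head right c by simp
      next
        case (tail y'')
        have "y'' \<in> lists (Lit ` B)" by (rule lists_Lit_merges[OF mcB efv(4) tail(1)])
        then show ?thesis unfolding right(2) tail(2) B'_def by (rule midI[OF efv(2,3)])
      qed
    qed
  qed
  \<comment> \<open>Both parts are closed under merging: a nonzero product of a multiple of
    \<open>p\<close> is again a multiple of \<open>p\<close>, and a product of letters of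
    \<open>B\<close> is not one because \<open>p\<close> is prime. So the sum of complexes is
    direct.\<close>
  have HE: "wc.H n K E = wc.H n K (cat X B) + wc.H n K B'"
  proof -
    have "cat X B \<subseteq> lists (letters n)" using clXB by (simp add: wc.closed_def)
    moreover have "B' \<subseteq> lists (letters n)" using split clE unfolding wc.closed_def by blast
    moreover have "\<not> wc.merges n y z" "\<not> wc.merges n z y" if "y \<in> cat X B" "z \<in> B'" for y z
      using that clXB B'merges disj unfolding wc.closed_def by blast+
    ultimately show ?thesis unfolding split using wc.H_disjoint[OF disj] by blast
  qed
  have HXB: "wc.H n K (cat X B) = wc.H n K X * Pbar" unfolding B_def by (rule IH[OF X])
  have ring: "e = (1 + t) * x * q + t ^ 2 * c * e' * q"
    if "e = x * q + (t * x * q + t * (c * t * e' * q))" for e x q t c e' :: "rat fps"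
    using that by (simp add: algebra_simps power2_eq_square)
  have "wc.H n K E = (1 + fps_X) * wc.H n K X * Pbar + fps_X ^ 2 * of_nat (card F2) * wc.H n K E * Pbar"
    by (rule ring) (simp only: HE[unfolded HXB HB' HDS HD HSc, symmetric])
  then show ?thesis unfolding E_def F2_def F_def W_def .
qed

section \<open>Prime factorisations\<close>

lemma pr_prime: "prime (pr i)"
  using enumerate_in_set[OF primes_infinite, of "i - 1"] by (simp add: pr_def)

text \<open>Indices start at 1: by truncated subtraction \<open>pr 0\<close> equals
  \<open>pr 1\<close>.\<close>

lemma pr_mono: "1 \<le> i \<Longrightarrow> i < j \<Longrightarrow> pr i < pr j"
  unfolding pr_def by (rule enumerate_mono[OF _ primes_infinite]) simp

lemma pr_le_iff: "1 \<le> i \<Longrightarrow> 1 \<le> j \<Longrightarrow> pr i \<le> pr j \<longleftrightarrow> i \<le> j"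
  using pr_mono[of i j] pr_mono[of j i] by (metis leD le_less_linear le_neq_implies_less nle_le)

lemma pr_eq_iff: "1 \<le> i \<Longrightarrow> 1 \<le> j \<Longrightarrow> pr i = pr j \<longleftrightarrow> i = j"
  using pr_le_iff[of i j] pr_le_iff[of j i] by auto

lemma prime_is_pr: "prime q \<Longrightarrow> \<exists>i\<ge>1. q = pr i"
proof -
  assume "prime q"
  then obtain k where "enumerate {q::nat. prime q} k = q" using enumerate_Ex[OF primes_infinite, of q] by auto
  then have "q = pr (Suc k)" by (simp add: pr_def)
  then show ?thesis by (intro exI[of _ "Suc k"]) simp
qed

text \<open>The indices of the primes up to \<open>n\<close> form an initial segment of the positive
  integers, and it has \<open>rr n\<close> elements.\<close>

lemma pr_le_rr_iff: "1 \<le> i \<Longrightarrow> pr i \<le> n \<longleftrightarrow> i \<le> rr n"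
proof -
  assume i: "1 \<le> i"
  define J where "J = {i. 1 \<le> i \<and> pr i \<le> n}"
  have "bij_betw pr J {q::nat. prime q \<and> q \<le> n}"
    using prime_is_pr pr_prime pr_eq_iff by (auto simp: bij_betw_def J_def inj_on_def)
  then have card: "card J = rr n" by (simp add: rr_def bij_betw_same_card)
  have "finite {q::nat. prime q \<and> q \<le> n}" by (rule finite_subset[of _ "{..n}"]) auto
  then have fin: "finite J" using \<open>bij_betw pr J _\<close> bij_betw_finite by blast
  show ?thesis
  proof
    assume "pr i \<le> n"
    have "{1..i} \<subseteq> J"
    proof
      fix j assume j: "j \<in> {1..i}"
      then have "pr j \<le> pr i" using pr_le_iff[of j i] i by simp
      then show "j \<in> J" using \<open>pr i \<le> n\<close> j by (simp add: J_def)
    qed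
    from card_mono[OF fin this] show "i \<le> rr n" using card by simp
  next
    assume le: "i \<le> rr n"
    show "pr i \<le> n"
    proof (rule ccontr)
      assume "\<not> pr i \<le> n"
      have "j < i" if "j \<in> J" for j
      proof (rule ccontr)
        assume "\<not> j < i"
        then have "pr i \<le> pr j" using pr_le_iff i by simp
        then show False using that \<open>\<not> pr i \<le> n\<close> by (simp add: J_def)
      qed
      then have "J \<subseteq> {1..<i}" by (auto simp: J_def)
      from card_mono[OF _ this] show False using card le i by simp
    qed
  qed
qed

text \<open>Dividing out the smallest prime of the ring gives the ring for the next prime, so the
  hypothesis of \<open>H_step\<close> is an instance of the same statement.\<close>

lemma rough_diff_pr:
  assumes "1 \<le> v"
  shows "{a\<in>rough n (pr v). \<not> pr v dvd a} = rough n (pr (Suc v))"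
proof -
  have "(\<forall>q. prime q \<longrightarrow> q dvd a \<longrightarrow> pr v \<le> q) \<and> \<not> pr v dvd a \<longleftrightarrow> (\<forall>q. prime q \<longrightarrow> q dvd a \<longrightarrow> pr (Suc v) \<le> q)" for a
  proof
    assume l: "(\<forall>q. prime q \<longrightarrow> q dvd a \<longrightarrow> pr v \<le> q) \<and> \<not> pr v dvd a"
    show "\<forall>q. prime q \<longrightarrow> q dvd a \<longrightarrow> pr (Suc v) \<le> q"
    proof (intro allI impI)
      fix q assume q: "prime q" "q dvd a"
      then obtain i where i: "i \<ge> 1" "q = pr i" using prime_is_pr by blast
      have "pr v \<le> pr i" "pr v \<noteq> pr i" using l q i by auto
      then have "Suc v \<le> i" using pr_le_iff[OF assms i(1)] by (metis Suc_leI le_neq_implies_less)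
      then show "pr (Suc v) \<le> q" using pr_le_iff[of "Suc v" i] i by simp
    qed
  next
    assume r: "\<forall>q. prime q \<longrightarrow> q dvd a \<longrightarrow> pr (Suc v) \<le> q"
    have lt: "pr v < pr (Suc v)" using pr_mono[OF assms] by simp
    have "\<not> pr v dvd a"
    proof
      assume "pr v dvd a"
      then have "pr (Suc v) \<le> pr v" using r pr_prime[of v] by blast
      then show False using lt by simp
    qed
    then show "(\<forall>q. prime q \<longrightarrow> q dvd a \<longrightarrow> pr v \<le> q) \<and> \<not> pr v dvd a"
      using r lt by (meson less_imp_le order_trans)
  qed
  then show ?thesis unfolding rough_def by blast
qed

lemma rough_rr: "rough n (pr (Suc (rr n))) = {}"
proof (rule ccontr)
  assume "rough n (pr (Suc (rr n))) \<noteq> {}"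
  then obtain a where a: "a \<in> rough n (pr (Suc (rr n)))" by blast
  then have "pr (Suc (rr n)) \<le> n" using rough_ge[OF a] by (simp add: rough_def)
  then show False using pr_le_rr_iff[of "Suc (rr n)" n] by simp
qed

lemma rough_pr_1: "rough n (pr 1) = {2..n}"
proof -
  have "pr 1 \<le> q" if "prime q" for q using prime_is_pr[OF that] pr_le_iff[of 1] by auto
  then show ?thesis by (auto simp: rough_def)
qed

definition nval :: "nat \<Rightarrow> (nat \<Rightarrow> nat) \<Rightarrow> nat" where
  "nval r b = (\<Prod>i=1..r. pr i ^ b i)"

lemma nval_pos: "0 < nval r b"
  unfolding nval_def by (rule prod_pos) (simp add: prime_gt_0_nat pr_prime)

lemma multiplicity_nval:
  assumes "j \<in> {1..r}"
  shows "multiplicity (pr j) (nval r b) = b j"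
proof -
  have "multiplicity (pr j) (nval r b) = (\<Sum>i=1..r. multiplicity (pr j) (pr i ^ b i))"
    unfolding nval_def
    by (rule prime_elem_multiplicity_prod_distrib)
      (auto simp: pr_prime prime_gt_0_nat[THEN gr_implies_not0])
  also have "\<dots> = (\<Sum>i=1..r. if i = j then b j else 0)"
  proof (rule sum.cong[OF refl])
    fix i assume i: "i \<in> {1..r}"
    show "multiplicity (pr j) (pr i ^ b i) = (if i = j then b j else 0)"
      using multiplicity_distinct_prime_power[of "pr j" "pr i" "b i"] pr_eq_iff[of i j] i assms pr_prime[of i] pr_prime[of j]
      by (auto simp: multiplicity_same_power prime_gt_0_nat prime_gt_1_nat)
  qed
  also have "\<dots> = b j" using assms by simp
  finally show ?thesis .
qed

lemma prime_dvd_nval: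
  assumes "prime q" "q dvd nval r b"
  obtains i where "i \<in> {1..r}" "q = pr i" "0 < b i"
proof -
  obtain i where i: "i \<in> {1..r}" "q dvd pr i ^ b i"
    using assms prime_dvd_prod_iff[of "{1..r}" q "\<lambda>i. pr i ^ b i"] by (auto simp: nval_def)
  have "q dvd pr i" using prime_dvd_power[OF assms(1) i(2)] .
  then have "q = pr i" using assms(1) pr_prime primes_dvd_imp_eq by blast
  moreover have "0 < b i" using i(2) assms(1) by (cases "b i") auto
  ultimately show thesis using that i by blast
qed

lemma nval_multiplicity:
  assumes "1 \<le> w" "w \<le> n"
  shows "nval (rr n) (\<lambda>i. multiplicity (pr i) w) = w"
proof -
  have fac: "prime_factors w \<subseteq> pr ` {1..rr n}"
  proof
    fix q assume q: "q \<in> prime_factors w"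
    then have qp: "prime q" "q dvd w" by auto
    then obtain i where i: "i \<ge> 1" "q = pr i" using prime_is_pr by blast
    have "q \<le> n" using dvd_imp_le[OF qp(2)] assms by simp
    then have "i \<le> rr n" using i pr_le_rr_iff by simp
    then show "q \<in> pr ` {1..rr n}" using i by simp
  qed
  have "w = (\<Prod>q\<in>prime_factors w. q ^ multiplicity q w)"
    using prime_factorization_nat[of w] assms by simp
  also have "\<dots> = (\<Prod>q\<in>pr ` {1..rr n}. q ^ multiplicity q w)"
  proof (rule prod.mono_neutral_left)
    show "\<forall>q\<in>pr ` {1..rr n} - prime_factors w. q ^ multiplicity q w = 1"
    proof
      fix q assume q: "q \<in> pr ` {1..rr n} - prime_factors w"
      then have "prime q" using pr_prime by auto
      then have "\<not> q dvd w" using q assms by (simp add: in_prime_factors_iff)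
      then show "q ^ multiplicity q w = 1" by (simp add: not_dvd_imp_multiplicity_0)
    qed
  qed (use fac in auto)
  also have "\<dots> = nval (rr n) (\<lambda>i. multiplicity (pr i) w)"
    unfolding nval_def by (subst prod.reindex) (auto simp: inj_on_def pr_eq_iff)
  finally show ?thesis by simp
qed

lemma ln_nval: "ln (real (nval r b)) = (\<Sum>i=1..r. real (b i) * ln (real (pr i)))"
proof -
  have "ln (real (nval r b)) = ln (\<Prod>i=1..r. real (pr i) ^ b i)" by (simp add: nval_def)
  also have "\<dots> = (\<Sum>i=1..r. ln (real (pr i) ^ b i))"
    by (rule ln_prod) (use prime_gt_0_nat[OF pr_prime] in auto)
  finally show ?thesis by (simp add: ln_realpow prime_gt_0_nat pr_prime)
qed

text \<open>The sum of logarithms is the logarithm of the integer with exponent vector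
  \<open>b\<close>, so exponentiating turns the real inequalities into inequalities between natural
  numbers.\<close>

lemma sols_iff:
  assumes "1 \<le> n" "1 \<le> v"
  shows "b \<in> sols n v \<longleftrightarrow> (\<forall>i. i < v \<or> rr n < i \<longrightarrow> b i = 0) \<and> n < pr v * nval (rr n) b \<and> nval (rr n) b \<le> n"
proof (cases "\<forall>i. i < v \<or> rr n < i \<longrightarrow> b i = 0")
  case True
  let ?N = "nval (rr n) b"
  have s: "(\<Sum>i=v..rr n. real (b i) * ln (real (pr i))) = ln (real ?N)"
    unfolding ln_nval by (rule sum.mono_neutral_left) (use assms True in auto)
  have pos: "0 < pr v" "0 < ?N" by (simp_all add: nval_pos pr_prime prime_gt_0_nat)
  have "ln (real n) - ln (real (pr v)) < ln (real ?N) \<longleftrightarrow> ln (real n) < ln (real (pr v * ?N))"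
    using pos by (auto simp: ln_mult)
  also have "\<dots> \<longleftrightarrow> real n < real (pr v * ?N)"
    by (rule ln_less_cancel_iff) (use assms pos in auto)
  also have "\<dots> \<longleftrightarrow> n < pr v * ?N" by (rule of_nat_less_iff)
  finally have 1: "ln (real n) - ln (real (pr v)) < ln (real ?N) \<longleftrightarrow> n < pr v * ?N" .
  have 2: "ln (real ?N) \<le> ln (real n) \<longleftrightarrow> ?N \<le> n"
    using assms pos ln_le_cancel_iff[of "real ?N" "real n"] by simp
  show ?thesis unfolding sols_def mem_Collect_eq s 1 2 by simp
next
  case False
  then show ?thesis unfolding sols_def by blast
qed

text \<open>Solutions are the exponent vectors of the basis integers of the socle: the bounds say
  \<open>f \<le> n < pr v * f\<close>, and the vanishing of \<open>b\<close> below \<open>v\<close>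
  says that all prime factors of \<open>f\<close> are at least \<open>pr v\<close>.\<close>

lemma Cnv_eq:
  assumes "1 \<le> n" "v \<in> {1..rr n}"
  shows "Cnv n v = card {f\<in>insert 1 (rough n (pr v)). n < pr v * f}"
proof -
  have v: "1 \<le> v" using assms by simp
  have "bij_betw (nval (rr n)) (sols n v) {f\<in>insert 1 (rough n (pr v)). n < pr v * f}"
    unfolding bij_betw_def
  proof
    show "inj_on (nval (rr n)) (sols n v)"
    proof (rule inj_onI)
      fix b c assume b: "b \<in> sols n v" and c: "c \<in> sols n v" and eq: "nval (rr n) b = nval (rr n) c"
      show "b = c"
      proof
        fix i show "b i = c i"
        proof (cases "i \<in> {1..rr n}")
          case True
          then show ?thesis using multiplicity_nval[OF True] eq by metis
        next
          case False
          then have "i < v \<or> rr n < i" using v by auto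
          then show ?thesis using b c sols_iff[OF assms(1) v] by metis
        qed
      qed
    qed
    show "nval (rr n) ` sols n v = {f\<in>insert 1 (rough n (pr v)). n < pr v * f}"
    proof (intro equalityI subsetI)
      fix f assume "f \<in> nval (rr n) ` sols n v"
      then obtain b where b: "b \<in> sols n v" "f = nval (rr n) b" by blast
      note b' = b(1)[unfolded sols_iff[OF assms(1) v]]
      have "pr v \<le> q" if q: "prime q" "q dvd f" for q
      proof -
        from q(2)[unfolded b(2)] obtain i where i: "i \<in> {1..rr n}" "q = pr i" "0 < b i"
          by (rule prime_dvd_nval[OF q(1)])
        then have "v \<le> i" using b' by (metis gr_implies_not0 not_le)
        then show ?thesis using i pr_le_iff[OF v] by simp
      qed
      moreover have "0 < f" using b nval_pos by simp
      ultimately have "f \<in> insert 1 (rough n (pr v))" using b' b(2) by (auto simp: rough_def)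
      then show "f \<in> {f\<in>insert 1 (rough n (pr v)). n < pr v * f}" using b' b(2) by simp
    next
      fix f assume f: "f \<in> {f\<in>insert 1 (rough n (pr v)). n < pr v * f}"
      then have f1: "1 \<le> f" "f \<le> n" using assms by (auto simp: rough_def)
      define b where "b = (\<lambda>i. if i \<in> {1..rr n} then multiplicity (pr i) f else 0)"
      have "nval (rr n) b = nval (rr n) (\<lambda>i. multiplicity (pr i) f)"
        unfolding nval_def by (rule prod.cong) (auto simp: b_def)
      then have nb: "nval (rr n) b = f" using nval_multiplicity[OF f1] by simp
      have "b i = 0" if "i < v \<or> rr n < i" for i
      proof (cases "i \<in> {1..rr n}")
        case True
        then have "pr i < pr v" using pr_mono[of i v] that by simp
        moreover have "pr v \<le> q" if "prime q" "q dvd f" for q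
          using f that by (auto simp: rough_def)
        ultimately have "\<not> pr i dvd f" using pr_prime[of i] by (meson not_le)
        then show ?thesis by (simp add: b_def not_dvd_imp_multiplicity_0)
      qed (auto simp: b_def)
      then have "b \<in> sols n v" using nb f f1 sols_iff[OF assms(1) v] by simp
      then show "f \<in> nval (rr n) ` sols n v" using nb by blast
    qed
  qed
  then show ?thesis unfolding Cnv_def by (rule bij_betw_same_card)
qed

section \<open>The Poincare series\<close>

text \<open>The denominator for the subring of the primes from \<open>pr v\<close> on, with the sum
  indexed by the prime. For \<open>v = 1\<close> it is the denominator of the theorem with the sum
  reversed; for \<open>v = Suc (rr n)\<close> the sum is empty.\<close>

definition poinc_denom :: "nat \<Rightarrow> nat \<Rightarrow> rat fps" where
  "poinc_denom n v = 1 - fps_X ^ 2 * (\<Sum>j\<in>{v..rr n}. (1 + fps_X) ^ (rr n - j) * of_nat (Cnv n j))"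

lemma poinc_denom_unit: "fps_nth (poinc_denom n v) 0 \<noteq> 0"
  by (simp add: poinc_denom_def)

lemma poinc_denom_inverse: "poinc_denom n v * inverse (poinc_denom n v) = 1"
  using inverse_mult_eq_1[OF poinc_denom_unit, of n v] by (simp add: mult.commute)

text \<open>Induction on the number \<open>d\<close> of primes of the subring, taken from the
  largest prime up to \<open>n\<close> downwards. For \<open>d = 0\<close> the ring is K and there
  are no letters. Quantifying over \<open>X\<close> is what supplies the hypothesis of
  \<open>H_step\<close>.\<close>

lemma H_cat_rough:
  fixes K :: "'k::field itself"
  assumes n: "1 \<le> n" and "d \<le> rr n" "good n X"
  shows "wc.H n K (cat X (rough n (pr (Suc (rr n) - d))))
    = wc.H n K X * ((1 + fps_X) ^ d * inverse (poinc_denom n (Suc (rr n) - d)))"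
  using assms(2,3)
proof (induction d arbitrary: X)
  case 0
  have "cat X {} = X" by (auto simp: cat_def)
  then show ?case by (simp add: rough_rr poinc_denom_def)
next
  case (Suc d)
  define v where "v = rr n - d"
  have v: "v \<in> {1..rr n}" "Suc (rr n) - Suc d = v" "Suc (rr n) - d = Suc v" "rr n - v = d"
    using Suc.prems by (auto simp: v_def)
  let ?Pbar = "(1 + fps_X) ^ d * inverse (poinc_denom n (Suc v)) :: rat fps"
  let ?H = "wc.H n K (cat X (rough n (pr v)))"
  have step: "?H = (1 + fps_X) * wc.H n K X * ?Pbar + fps_X ^ 2 * of_nat (Cnv n v) * ?H * ?Pbar"
  proof -
    have "pr v \<le> n" using pr_le_rr_iff v by simp
    moreover have "wc.H n K (cat Y {a\<in>rough n (pr v). \<not> pr v dvd a}) = wc.H n K Y * ?Pbar" if "good n Y" for Y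
      using Suc.IH[OF _ that] Suc.prems v rough_diff_pr[of v n] by simp
    ultimately show ?thesis
      using H_step[OF pr_prime _ Suc.prems(2), of v K ?Pbar] Cnv_eq[OF n v(1)] by simp
  qed
  have den: "poinc_denom n v = poinc_denom n (Suc v) - fps_X ^ 2 * ((1 + fps_X) ^ d * of_nat (Cnv n v))"
  proof -
    have "{v..rr n} = insert v {Suc v..rr n}" using v by auto
    then show ?thesis by (simp add: poinc_denom_def v(4) algebra_simps)
  qed
  \<comment> \<open>Multiplying the recursion by the old denominator \<open>q\<close> and collecting
    the terms with \<open>h\<close> shows that the new denominator is
    \<open>q - t2 * (a * c)\<close>.\<close>
  have ring: "h * (q - t2 * (a * c)) = (1 + t) * x * a"
    if "h = (1 + t) * x * (a * i) + t2 * c * h * (a * i)" "q * i = 1" for h t x a i t2 c q :: "rat fps"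
  proof -
    have "h * q = ((1 + t) * x * (a * i) + t2 * c * h * (a * i)) * q"
      by (rule arg_cong[OF that(1), of "\<lambda>y. y * q"])
    also have "\<dots> = (1 + t) * x * a * (q * i) + t2 * c * h * a * (q * i)"
      by (simp add: algebra_simps)
    finally have "h * q = (1 + t) * x * a + t2 * c * h * a" unfolding that(2) by simp
    then show ?thesis by (simp add: algebra_simps)
  qed
  have "?H * poinc_denom n v = (1 + fps_X) * wc.H n K X * (1 + fps_X) ^ d"
    unfolding den by (rule ring[OF step poinc_denom_inverse])
  then have "?H * (poinc_denom n v * inverse (poinc_denom n v))
      = (1 + fps_X) * wc.H n K X * (1 + fps_X) ^ d * inverse (poinc_denom n v)"
    by (simp only: mult.assoc[symmetric])
  then show ?case unfolding poinc_denom_inverse v(2) by (simp add: mult_ac)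
qed

section \<open>Comparison with the bar complex that defines Tor\<close>

lemma gmul_delta:
  assumes "1 \<le> a" "1 \<le> b"
  shows "gmul n (delta a) (delta b) c = (if c = a * b \<and> c \<le> n then 1 else (0::'k::field))"
proof (cases "1 \<le> c \<and> c \<le> n")
  case True
  have "(\<Sum>d\<in>{d. d dvd c}. delta a d * delta b (c div d) :: 'k)
      = (\<Sum>d\<in>{d. d dvd c}. if d = a then (if c = a * b then 1 else 0) else 0)"
  proof (rule sum.cong[OF refl])
    fix d assume "d \<in> {d. d dvd c}"
    then show "(delta a d * delta b (c div d) :: 'k) = (if d = a then (if c = a * b then 1 else 0) else 0)"
      using assms by (auto simp: delta_def dvd_div_eq_mult)
  qed
  also have "\<dots> = (if c = a * b then 1 else 0)"
    using True by (auto simp: sum.delta)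
  finally show ?thesis using True by (simp add: gmul_def)
next
  case False
  have "c \<noteq> a * b \<or> \<not> c \<le> n" using False assms by auto
  then show ?thesis unfolding gmul_def using False by auto
qed

text \<open>The term \<open>head_mul\<close> of the recursion is the summand with
  \<open>i = 1\<close>. A letter put in front shifts all other positions by one, which accounts for
  the sign in the second term of the recursion.\<close>

lemma cob_map_Lit:
  assumes "\<forall>w\<in>set ws. 1 \<le> w"
  shows "wc.cob n (map Lit ws) \<phi> = (\<Sum>i\<in>{1..<length ws}. (-1) ^ i *
     (if ws ! (i - 1) * ws ! i \<le> n then \<phi> (map Lit (take (i - 1) ws @ (ws ! (i - 1) * ws ! i) # drop (i + 1) ws)) else 0))"
  using assms
proof (induction ws arbitrary: \<phi>)
  case (Cons a ws)
  let ?t = "\<lambda>ws \<phi> i. (-1) ^ i *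
     (if ws ! (i - 1) * ws ! i \<le> n then \<phi> (map Lit (take (i - 1) ws @ (ws ! (i - 1) * ws ! i) # drop (i + 1) ws)) else 0)"
  show ?case
  proof (cases ws)
    case Nil
    then show ?thesis by (simp add: wc.head_mul_def)
  next
    case (Cons b vs)
    have "(\<Sum>i\<in>{1..<length (a # ws)}. ?t (a # ws) \<phi> i)
        = ?t (a # ws) \<phi> 1 + (\<Sum>i\<in>{Suc 1..<Suc (length ws)}. ?t (a # ws) \<phi> i)"
      using Cons by (subst sum.atLeast_Suc_lessThan) simp_all
    also have "(\<Sum>i\<in>{Suc 1..<Suc (length ws)}. ?t (a # ws) \<phi> i) = (\<Sum>i\<in>{1..<length ws}. ?t (a # ws) \<phi> (Suc i))"
      by (rule sum.shift_bounds_Suc_ivl)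
    also have "\<dots> = (\<Sum>i\<in>{1..<length ws}. - ?t ws (\<lambda>u. \<phi> (Lit a # u)) i)"
    proof (rule sum.cong[OF refl])
      fix i assume "i \<in> {1..<length ws}"
      then obtain j where "i = Suc j" by (cases i) auto
      then show "?t (a # ws) \<phi> (Suc i) = - ?t ws (\<lambda>u. \<phi> (Lit a # u)) i" by simp
    qed
    also have "\<dots> = - wc.cob n (map Lit ws) (\<lambda>u. \<phi> (Lit a # u))"
      using Cons.IH[of "\<lambda>u. \<phi> (Lit a # u)"] Cons.prems by (simp add: sum_negf)
    also have "?t (a # ws) \<phi> 1 = - wc.head_mul n (Lit a) \<phi> (map Lit ws)"
      using Cons Cons.prems by (simp add: wc.head_mul_def)
    finally show ?thesis by simp
  qed
qed simp

text \<open>A product of two basis elements is one basis element or zero, so the sum over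
  \<open>c\<close> has at most one term. Its lower limit 2 loses nothing, as letters are at least
  2.\<close>

lemma bar_d_basis_eq_bd_coeff:
  assumes "ws \<in> words n q" "set vs \<subseteq> {2..n}"
  shows "(bar_d_basis n ws vs :: 'k::field) = wc.bd_coeff n (map Lit ws) (map Lit vs)"
proof -
  have ws: "\<forall>w\<in>set ws. 2 \<le> w" using assms by (auto simp: words_def)
  have injL: "map Lit x = map Lit y \<longleftrightarrow> x = y" for x y
    by (rule inj_map_eq_map) (auto simp: inj_on_def)
  have "(\<Sum>c\<in>{2..n}. if vs = take (i - 1) ws @ c # drop (i + 1) ws
          then gmul n (delta (ws ! (i - 1))) (delta (ws ! i)) c else (0::'k))
      = (if ws ! (i - 1) * ws ! i \<le> n then (if map Lit (take (i - 1) ws @ (ws ! (i - 1) * ws ! i) # drop (i + 1) ws) = map Lit vs then 1 else 0) else 0)"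
    if i: "i \<in> {1..<length ws}" for i
  proof -
    let ?a = "ws ! (i - 1)" and ?b = "ws ! i"
    have "?a \<in> set ws" "?b \<in> set ws" using i by auto
    then have ab: "2 \<le> ?a" "2 \<le> ?b" using ws by auto
    have ab1: "1 \<le> ?a" "1 \<le> ?b" using ab by auto
    have "2 * 1 \<le> ?a * ?b" by (rule mult_le_mono) (use ab in auto)
    then have ab2: "2 \<le> ?a * ?b" by simp
    have "(\<Sum>c\<in>{2..n}. if vs = take (i - 1) ws @ c # drop (i + 1) ws
          then gmul n (delta ?a) (delta ?b) c else (0::'k))
      = (\<Sum>c\<in>{2..n}. if c = ?a * ?b then (if vs = take (i - 1) ws @ (?a * ?b) # drop (i + 1) ws then 1 else 0) else 0)"
      unfolding gmul_delta[OF ab1] by (rule sum.cong) auto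
    also have "\<dots> = (if ?a * ?b \<le> n then (if vs = take (i - 1) ws @ (?a * ?b) # drop (i + 1) ws then 1 else 0) else 0)"
      using ab2 by (auto simp: sum.delta)
    finally show ?thesis unfolding injL by (simp only: eq_commute[of vs])
  qed
  then have "(bar_d_basis n ws vs :: 'k) = (\<Sum>i\<in>{1..<length ws}. (-1) ^ i *
     (if ws ! (i - 1) * ws ! i \<le> n then (if map Lit (take (i - 1) ws @ (ws ! (i - 1) * ws ! i) # drop (i + 1) ws) = map Lit vs then 1 else 0) else 0))"
    unfolding bar_d_basis_def by (intro sum.cong refl) (simp only:)
  also have "\<dots> = wc.bd_coeff n (map Lit ws) (map Lit vs)"
    unfolding wc.bd_coeff_def by (subst cob_map_Lit) (use ws in force)+
  finally show ?thesis .
qed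

lemma map_Lit_in_lists: "map Lit ws \<in> lists (Lit ` B) \<longleftrightarrow> set ws \<subseteq> B"
  by (induction ws) auto

lemma cat_Nil: "cat {[]} B = lists (Lit ` B)"
  by (simp add: cat_def)

lemma bij_betw_map_Lit: "bij_betw (map Lit) (words n q) (wc.gr (cat {[]} {2..n}) q)"
proof -
  have "map Lit ` words n q = wc.gr (cat {[]} {2..n}) q"
  proof (intro equalityI subsetI)
    fix w assume "w \<in> map Lit ` words n q"
    then obtain ws where "w = map Lit ws" "length ws = q" "set ws \<subseteq> {2..n}" by (auto simp: words_def)
    then show "w \<in> wc.gr (cat {[]} {2..n}) q" by (simp add: wc.gr_def cat_Nil map_Lit_in_lists del: in_lists_conv_set)
  next
    fix w assume w: "w \<in> wc.gr (cat {[]} {2..n}) q"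
    then have "w \<in> lists (Lit ` {2..n})" "length w = q" by (auto simp: wc.gr_def cat_def)
    then have "w \<in> map Lit ` lists {2..n}" by (simp add: lists_image)
    then show "w \<in> map Lit ` words n q" using \<open>length w = q\<close> by (auto simp: words_def)
  qed
  moreover have "inj_on (map Lit) (words n q)" by (auto simp: inj_on_def inj_map_eq_map)
  ultimately show ?thesis by (simp add: bij_betw_def)
qed

lemma good_Nil: "good n {[]}"
  by (auto simp: good_def wc.closed_def no_mid_def wc.not_merges_Nil)

lemma mult_closed_full: "mult_closed n {2..n}"
  unfolding mult_closed_def
proof (intro conjI ballI impI)
  fix a b assume "a \<in> {2..n}" "b \<in> {2..n}" "a * b \<le> n"
  moreover from this have "2 * 1 \<le> a * b" by (intro mult_le_mono) auto
  ultimately show "a * b \<in> {2..n}" by simp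
qed auto

text \<open>\<open>T\<close> pulls functions back along \<open>map Lit\<close> and commutes with the
  differentials, so cycles and boundaries correspond. Rank-nullity rewrites the dimension of the
  cycles in terms of the ranks in \<open>hom_dim\<close>.\<close>

lemma tor_dim_eq: "int (tor_dim (K :: 'k::field itself) n q) = wc.hom_dim n K (cat {[]} {2..n}) q"
proof -
  let ?E = "cat {[]} {2..n}"
  have cl: "wc.closed n ?E" by (rule closed_cat[OF good_Nil mult_closed_full])
  have EA: "?E \<subseteq> lists (letters n)" using cl by (simp add: wc.closed_def)
  define T where "T = (\<lambda>x :: letter list \<Rightarrow> 'k. \<lambda>ws. x (map Lit ws))"
  have linT: "flinear T" by (rule flinearI) (auto simp: T_def fun_eq_iff)
  have ET: "map Lit ws \<in> ?E \<longleftrightarrow> set ws \<subseteq> {2..n}" for ws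
    unfolding cat_Nil by (rule map_Lit_in_lists)
  have grT: "map Lit ws \<in> wc.gr ?E k \<longleftrightarrow> ws \<in> words n k" for ws k
    using ET[of ws] by (auto simp: wc.gr_def words_def)
  have T0: "x = 0" if "x \<in> supp_on (wc.gr ?E k)" "T x = 0" for x k
  proof
    fix w show "x w = 0 w"
    proof (cases "w \<in> wc.gr ?E k")
      case True
      then obtain ws where "w = map Lit ws" using bij_betw_map_Lit[of n k] by (auto simp: bij_betw_def)
      then show ?thesis using fun_cong[OF that(2), of ws] by (simp add: T_def)
    qed (use that(1) in \<open>simp add: supp_on_def\<close>)
  qed
  have Tim: "T ` supp_on (wc.gr ?E k) = bchains K n k" for k
  proof (intro equalityI subsetI)
    fix y assume "y \<in> T ` supp_on (wc.gr ?E k)"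
    then show "y \<in> bchains K n k" using grT by (auto simp: T_def bchains_def supp_on_def)
  next
    fix y assume y: "y \<in> bchains K n k"
    define x where "x = (\<lambda>w. if w \<in> wc.gr ?E k then y (inv_into (words n k) (map Lit) w) else 0)"
    have "T x = y"
    proof
      fix ws
      show "T x ws = y ws"
      proof (cases "ws \<in> words n k")
        case True
        then have "inv_into (words n k) (map Lit) (map Lit ws) = ws"
          using bij_betw_map_Lit[of n k] by (intro inv_into_f_f) (auto simp: bij_betw_def)
        then show ?thesis using True grT by (simp add: T_def x_def)
      next
        case False
        then show ?thesis using y grT by (simp add: T_def x_def bchains_def)
      qed
    qed
    moreover have "x \<in> supp_on (wc.gr ?E k)" by (simp add: x_def supp_on_def)
    ultimately show "y \<in> T ` supp_on (wc.gr ?E k)" by blast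
  qed
  have Tbd: "bar_d n k (T x) = T (wc.bd n x)" if x: "x \<in> supp_on (wc.gr ?E k)" for x k
  proof
    fix vs
    have supp0: "bar_d_basis n ws vs = (0::'k)" if "ws \<in> words n k" "\<not> set vs \<subseteq> {2..n}" for ws
    proof -
      have "vs \<noteq> take (i - 1) ws @ c # drop (i + 1) ws" if "c \<in> {2..n}" for i c
      proof
        assume "vs = take (i - 1) ws @ c # drop (i + 1) ws"
        then have "set vs \<subseteq> insert c (set ws)" using set_take_subset[of "i - 1" ws] set_drop_subset[of "i + 1" ws] by auto
        then show False using that \<open>ws \<in> words n k\<close> \<open>\<not> set vs \<subseteq> {2..n}\<close> by (auto simp: words_def)
      qed
      then have "(\<Sum>c\<in>{2..n}. if vs = take (i - 1) ws @ c # drop (i + 1) ws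
          then gmul n (delta (ws ! (i - 1))) (delta (ws ! i)) c else (0::'k)) = 0" for i
        by (intro sum.neutral ballI) simp
      then show ?thesis unfolding bar_d_basis_def by simp
    qed
    show "bar_d n k (T x) vs = T (wc.bd n x) vs"
    proof (cases "set vs \<subseteq> {2..n}")
      case True
      have "bar_d n k (T x) vs = (\<Sum>ws\<in>words n k. x (map Lit ws) * wc.bd_coeff n (map Lit ws) (map Lit vs))"
        unfolding bar_d_def by (rule sum.cong) (simp_all add: T_def bar_d_basis_eq_bd_coeff True)
      also have "\<dots> = (\<Sum>w\<in>wc.gr ?E k. x w * wc.bd_coeff n w (map Lit vs))"
        by (rule sum.reindex_bij_betw[OF bij_betw_map_Lit])
      also have "\<dots> = wc.bd n x (map Lit vs)" by (rule wc.bd_supp[OF x EA, symmetric])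
      finally show ?thesis by (simp add: T_def)
    next
      case False
      have "wc.bd n x (map Lit vs) = 0"
      proof (cases k)
        case 0
        then show ?thesis using wc.bd_gr_0 x by (metis zero_fun_apply)
      next
        case (Suc j)
        have "wc.bd n x \<in> supp_on (wc.gr ?E j)" using wc.bd_in_gr[OF _ cl] x Suc by blast
        then show ?thesis using False ET[of vs] by (auto simp: supp_on_def wc.gr_def)
      qed
      moreover have "bar_d n k (T x) vs = 0" using supp0[OF _ False] by (simp add: bar_d_def)
      ultimately show ?thesis by (simp add: T_def)
    qed
  qed
  have restr_bd: "restr ?E (wc.bd n x) = wc.bd n x" if "x \<in> supp_on (wc.gr ?E k)" for k and x :: "letter list \<Rightarrow> 'k"
  proof (cases k)
    case 0
    then show ?thesis using wc.bd_gr_0[of x ?E n] that by (simp add: restr_def fun_eq_iff)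
  next
    case (Suc j)
    then show ?thesis using wc.restr_bd_closed[of x ?E j n] that cl by simp
  qed
  let ?Z = "{x\<in>supp_on (wc.gr ?E q). restr ?E (wc.bd n x) = (0 :: letter list \<Rightarrow> 'k)}"
  interpret f: Vector_Spaces.linear fscale fscale "\<lambda>x :: letter list \<Rightarrow> 'k. restr ?E (wc.bd n x)"
    by (rule wc.flinear_restr_bd)
  interpret T: Vector_Spaces.linear fscale fscale T
    by (rule linT)
  have subZ: "fvs.subspace ?Z"
  proof -
    have "fvs.subspace (supp_on (wc.gr ?E q) \<inter> {x. restr ?E (wc.bd n x) = (0 :: letter list \<Rightarrow> 'k)})"
      by (rule fvs.subspace_inter[OF subspace_supp_on f.subspace_kernel])
    moreover have "?Z = supp_on (wc.gr ?E q) \<inter> {x. restr ?E (wc.bd n x) = 0}" by auto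
    ultimately show ?thesis by simp
  qed
  have "T ` ?Z = {y\<in>bchains K n q. bar_d n q y = 0}"
  proof (intro equalityI subsetI)
    fix y assume "y \<in> T ` ?Z"
    then obtain x where x: "x \<in> ?Z" "y = T x" by blast
    then have xs: "x \<in> supp_on (wc.gr ?E q)" "wc.bd n x = 0" using restr_bd by auto
    have "bar_d n q y = 0" using Tbd[OF xs(1)] xs(2) x(2) T.zero by simp
    then show "y \<in> {y\<in>bchains K n q. bar_d n q y = 0}" using Tim[of q] xs x by blast
  next
    fix y assume y: "y \<in> {y\<in>bchains K n q. bar_d n q y = 0}"
    then obtain x where x: "x \<in> supp_on (wc.gr ?E q)" "y = T x" using Tim[of q] by blast
    have T0': "T (restr ?E (wc.bd n x)) = 0" using Tbd[OF x(1)] x y restr_bd[OF x(1)] by simp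
    have "restr ?E (wc.bd n x) = 0"
    proof (cases q)
      case 0
      then show ?thesis using wc.bd_gr_0[of x ?E n] x restr_bd[OF x(1)] by simp
    next
      case (Suc j)
      then show ?thesis using T0[OF _ T0'] wc.restr_bd_in_gr[OF _ EA] x by blast
    qed
    then show "y \<in> T ` ?Z" using x by blast
  qed
  moreover have "fvs.dim (T ` ?Z) = fvs.dim ?Z"
    by (rule dim_image_inj_on[OF linT subZ _ wc.finite_gr[OF EA]]) (use T0 in auto)
  ultimately have Z: "vdim {y\<in>bchains K n q. bar_d n q y = 0} = fvs.dim ?Z" by (simp add: vdim_eq)
  have "T ` wc.img n ?E (Suc q) = bar_d n (Suc q) ` bchains K n (Suc q)"
  proof -
    have "T ` wc.img n ?E (Suc q) = (\<lambda>x. T (wc.bd n x)) ` supp_on (wc.gr ?E (Suc q))"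
      unfolding wc.img_def image_image by (rule image_cong) (simp_all add: restr_bd)
    also have "\<dots> = (\<lambda>x. bar_d n (Suc q) (T x)) ` supp_on (wc.gr ?E (Suc q))"
      by (rule image_cong) (simp_all add: Tbd)
    also have "\<dots> = bar_d n (Suc q) ` (T ` supp_on (wc.gr ?E (Suc q)))" by (simp add: image_image)
    finally show ?thesis by (simp add: Tim)
  qed
  moreover have "fvs.dim (T ` wc.img n ?E (Suc q)) = wc.bd_rank n K ?E (Suc q)"
  proof -
    have "wc.bd_rank n K ?E (Suc q) = fvs.dim (wc.img n ?E (Suc q) :: (letter list \<Rightarrow> 'k) set)" by (simp add: wc.bd_rank_def)
    moreover have "fvs.dim (T ` wc.img n ?E (Suc q)) = fvs.dim (wc.img n ?E (Suc q) :: (letter list \<Rightarrow> 'k) set)"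
      by (rule dim_image_inj_on[OF linT wc.subspace_img wc.img_Suc_subset[OF EA] wc.finite_gr[OF EA]])
        (use T0 wc.img_Suc_subset[OF EA] in blast)
    ultimately show ?thesis by simp
  qed
  ultimately have Bd: "vdim (bar_d n (Suc q) ` bchains K n (Suc q)) = wc.bd_rank n K ?E (Suc q)" by (simp add: vdim_eq)
  \<comment> \<open>\<open>tor_dim\<close> subtracts natural numbers; the difference is not cut off
    at 0 because boundaries are cycles.\<close>
  have le: "wc.bd_rank n K ?E (Suc q) \<le> fvs.dim ?Z"
  proof -
    have "(wc.img n ?E (Suc q) :: (letter list \<Rightarrow> 'k) set) \<subseteq> ?Z"
    proof
      fix y assume y: "y \<in> (wc.img n ?E (Suc q) :: (letter list \<Rightarrow> 'k) set)"
      then obtain x where "x \<in> supp_on (wc.gr ?E (Suc q))" "y = restr ?E (wc.bd n x)" by (auto simp: wc.img_def)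
      then have "y = wc.bd n x" using restr_bd by simp
      then have "wc.bd n y = 0" by (simp only: wc.bd_bd)
      then have "restr ?E (wc.bd n y) = 0" by (simp add: restr_def fun_eq_iff)
      then show "y \<in> ?Z" using y wc.img_Suc_subset[OF EA] by blast
    qed
    from vdim_mono[OF this _ wc.finite_gr[OF EA, of q]] show ?thesis by (auto simp: wc.bd_rank_def)
  qed
  have "card (wc.gr ?E q) = fvs.dim ?Z + wc.bd_rank n K ?E q"
    using wc.bd_rank_nullity[OF EA, of q, where 'k='k] by (simp add: wc.bd_rank_def)
  then show ?thesis unfolding tor_dim_def Z Bd wc.hom_dim_def using le by linarith
qed

lemma H_Nil: "wc.H n (K :: 'k::field itself) {[]} = 1"
proof -
  have gr: "wc.gr {[]} q = (if q = 0 then {[]} else ({} :: letter list set))" for q by (auto simp: wc.gr_def)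
  have bd_rank: "wc.bd_rank n K {[]} q = 0" for q
  proof (cases q)
    case 0
    then show ?thesis by (simp add: wc.bd_rank_0)
  next
    case (Suc j)
    then have "supp_on (wc.gr {[]} q) = {0 :: letter list \<Rightarrow> 'k}" by (auto simp: gr supp_on_def)
    moreover have "restr {[]} (wc.bd n (0 :: letter list \<Rightarrow> 'k)) = 0" by (auto simp: restr_def wc.bd_def fun_eq_iff)
    ultimately have "wc.img n {[]} q = {0 :: letter list \<Rightarrow> 'k}" by (simp add: wc.img_def)
    then show ?thesis unfolding wc.bd_rank_def using fvs.dim_le_card[of "{0}" "{}"] by simp
  qed
  show ?thesis by (rule fps_ext) (simp add: wc.H_def wc.hom_dim_def bd_rank gr)
qed

text \<open>The left factor is the empty word alone, whose series is 1. Every integer from 2 to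
  \<open>n\<close> is rough for the first prime, so the words are those of the bar complex of the
  full ring.\<close>

theorem poincare_series:
  fixes K :: "'k::field itself"
  assumes n: "1 \<le> n"
  shows "Abs_fps (\<lambda>q. of_nat (tor_dim K n q) :: rat)
       = (1 + fps_X) ^ rr n *
         inverse (1 - fps_X ^ 2 * (\<Sum>i=1..rr n. (1 + fps_X) ^ (i - 1) * of_nat (Cnv n (rr n - i + 1))))"
proof -
  have "(\<Sum>i=1..rr n. (1 + fps_X :: rat fps) ^ (i - 1) * of_nat (Cnv n (rr n - i + 1)))
      = (\<Sum>j=1..rr n. (1 + fps_X) ^ (rr n - j) * of_nat (Cnv n j))"
    by (rule sum.reindex_bij_witness[of _ "\<lambda>j. rr n - j + 1" "\<lambda>i. rr n - i + 1"]) auto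
  then have den: "1 - fps_X ^ 2 * (\<Sum>i=1..rr n. (1 + fps_X) ^ (i - 1) * of_nat (Cnv n (rr n - i + 1))) = poinc_denom n 1"
    by (simp add: poinc_denom_def)
  have "Abs_fps (\<lambda>q. of_nat (tor_dim K n q) :: rat) = wc.H n K (cat {[]} {2..n})"
    by (rule fps_ext) (simp add: wc.H_def tor_dim_eq[symmetric])
  also have "\<dots> = wc.H n K {[]} * ((1 + fps_X) ^ rr n * inverse (poinc_denom n 1))"
    using H_cat_rough[OF n order_refl good_Nil, of K] rough_pr_1[of n] by simp
  finally show ?thesis unfolding den by (simp add: H_Nil)
qed

section \<open>Presentation, Hilbert series and minimal generators\<close>

abbreviation (input) "lkp \<equiv> Poly_Mapping.lookup"
abbreviation (input) "kys \<equiv> Poly_Mapping.keys"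

lemma Gamma_eq_supp_on: "Gamma n = supp_on {1..n}"
  unfolding Gamma_def supp_on_def by (auto simp: not_less_eq_eq Suc_le_eq)

lemma mval_superset:
  assumes "finite A" "kys \<alpha> \<subseteq> A"
  shows "mval \<alpha> = (\<Prod>i\<in>A. pr i ^ lkp \<alpha> i)"
  unfolding mval_def by (rule prod.mono_neutral_left) (use assms in \<open>auto simp: in_keys_iff\<close>)

lemma mval_eq_nval: "kys \<alpha> \<subseteq> {1..r} \<Longrightarrow> mval \<alpha> = nval r (lkp \<alpha>)"
  unfolding nval_def by (rule mval_superset) auto

lemma mval_add: "mval (\<alpha> + \<beta>) = mval \<alpha> * mval \<beta>"
proof -
  let ?A = "kys \<alpha> \<union> kys \<beta>"
  have "mval (\<alpha> + \<beta>) = (\<Prod>i\<in>?A. pr i ^ lkp (\<alpha> + \<beta>) i)"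
    by (rule mval_superset) (simp_all add: Poly_Mapping.keys_add)
  also have "\<dots> = (\<Prod>i\<in>?A. pr i ^ lkp \<alpha> i) * (\<Prod>i\<in>?A. pr i ^ lkp \<beta> i)"
    by (simp add: lookup_add power_add prod.distrib)
  also have "\<dots> = mval \<alpha> * mval \<beta>" by (simp add: mval_superset[of ?A \<alpha>] mval_superset[of ?A \<beta>])
  finally show ?thesis .
qed

lemma mval_single: "mval (Poly_Mapping.single i 1) = pr i"
  by (simp add: mval_def)

lemma mval_zero: "mval 0 = 1" by (simp add: mval_def)

lemma mval_pos: "0 < mval \<alpha>"
  unfolding mval_def by (rule prod_pos) (simp add: prime_gt_0_nat pr_prime)

lemma mval_inj:
  assumes "kys \<alpha> \<subseteq> {1..r}" "kys \<beta> \<subseteq> {1..r}" "mval \<alpha> = mval \<beta>"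
  shows "\<alpha> = \<beta>"
proof (rule poly_mapping_eqI)
  fix i
  show "lkp \<alpha> i = lkp \<beta> i"
  proof (cases "i \<in> {1..r}")
    case True
    then show ?thesis
      using multiplicity_nval[OF True, of "lkp \<alpha>"] multiplicity_nval[OF True, of "lkp \<beta>"] assms
      by (simp add: mval_eq_nval)
  next
    case False
    then have "i \<notin> kys \<alpha>" "i \<notin> kys \<beta>" using assms by auto
    then show ?thesis by (simp add: in_keys_iff)
  qed
qed

definition expv :: "nat \<Rightarrow> (nat \<Rightarrow> nat) \<Rightarrow> nat \<Rightarrow>\<^sub>0 nat" where
  "expv r b = Abs_poly_mapping (\<lambda>i. if i \<in> {1..r} then b i else 0)"

lemma lookup_expv: "lkp (expv r b) i = (if i \<in> {1..r} then b i else 0)"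
proof -
  have "finite {i. (if i \<in> {1..r} then b i else 0) \<noteq> 0}" by (rule finite_subset[of _ "{1..r}"]) auto
  then show ?thesis unfolding expv_def by (subst lookup_Abs_poly_mapping) auto
qed

lemma keys_expv: "kys (expv r b) \<subseteq> {1..r}"
  by (auto simp: in_keys_iff lookup_expv split: if_splits)

lemma mval_expv: "mval (expv r b) = nval r b"
  using mval_eq_nval[OF keys_expv, of r b] by (simp add: nval_def lookup_expv)

definition prim_exp :: "nat \<Rightarrow> nat \<Rightarrow> (nat \<Rightarrow>\<^sub>0 nat)" where
  "prim_exp n m = expv (rr n) (\<lambda>i. multiplicity (pr i) m)"

lemma mval_prim_exp: "1 \<le> m \<Longrightarrow> m \<le> n \<Longrightarrow> mval (prim_exp n m) = m"
  by (simp add: prim_exp_def mval_expv nval_multiplicity)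

text \<open>The substitution of \<open>chi i\<close> for the i-th variable: a monomial goes to the
  basis element of its value, and values above \<open>n\<close> are dropped.\<close>

definition Phi :: "nat \<Rightarrow> ((nat \<Rightarrow>\<^sub>0 nat) \<Rightarrow>\<^sub>0 'k::field) \<Rightarrow> nat \<Rightarrow> 'k" where
  "Phi n a = trunc n (\<lambda>m. \<Sum>\<alpha>\<in>kys a. if mval \<alpha> = m then lkp a \<alpha> else 0)"

lemma Phi_superset:
  assumes "finite A" "kys a \<subseteq> A"
  shows "Phi n a = trunc n (\<lambda>m. \<Sum>\<alpha>\<in>A. if mval \<alpha> = m then lkp a \<alpha> else 0)"
proof -
  have "(\<Sum>\<alpha>\<in>kys a. if mval \<alpha> = m then lkp a \<alpha> else 0) = (\<Sum>\<alpha>\<in>A. if mval \<alpha> = m then lkp a \<alpha> else 0)" for m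
    by (rule sum.mono_neutral_left) (use assms in \<open>auto simp: in_keys_iff\<close>)
  then show ?thesis by (simp add: Phi_def)
qed

lemma Phi_add: "Phi n (a + b) = Phi n a + Phi n b"
proof -
  let ?A = "kys a \<union> kys b"
  have "Phi n (a + b) = trunc n (\<lambda>m. \<Sum>\<alpha>\<in>?A. if mval \<alpha> = m then lkp (a + b) \<alpha> else 0)"
    by (rule Phi_superset) (simp_all add: Poly_Mapping.keys_add)
  also have "\<dots> = trunc n (\<lambda>m. (\<Sum>\<alpha>\<in>?A. if mval \<alpha> = m then lkp a \<alpha> else 0) + (\<Sum>\<alpha>\<in>?A. if mval \<alpha> = m then lkp b \<alpha> else 0))"
    unfolding sum.distrib[symmetric] lookup_add by (intro arg_cong[of _ _ "trunc n"] ext sum.cong refl) simp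
  also have "\<dots> = Phi n a + Phi n b"
    by (simp add: Phi_superset[of ?A a] Phi_superset[of ?A b] trunc_def fun_eq_iff)
  finally show ?thesis .
qed

lemma Phi_zero: "Phi n 0 = 0"
  by (simp add: Phi_def trunc_def fun_eq_iff)

lemma Phi_sum: "Phi n (\<Sum>i\<in>I. f i) = (\<Sum>i\<in>I. Phi n (f i))"
  by (induction I rule: infinite_finite_induct) (simp_all add: Phi_zero Phi_add)

lemma Phi_single: "Phi n (Poly_Mapping.single \<alpha> c) = gscale c (trunc n (delta (mval \<alpha>)))"
proof -
  have "Phi n (Poly_Mapping.single \<alpha> c) = trunc n (\<lambda>m. \<Sum>\<beta>\<in>{\<alpha>}. if mval \<beta> = m then lkp (Poly_Mapping.single \<alpha> c) \<beta> else 0)"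
    by (rule Phi_superset) simp_all
  then show ?thesis by (auto simp: trunc_def gscale_def delta_def fun_eq_iff)
qed

lemma gmul_add_left: "gmul n (f + g) h = gmul n f h + gmul n g h"
  by (auto simp: gmul_def fun_eq_iff sum.distrib algebra_simps)

lemma gmul_add_right: "gmul n f (g + h) = gmul n f g + gmul n f h"
  by (auto simp: gmul_def fun_eq_iff sum.distrib algebra_simps)

lemma gmul_zero: "gmul n 0 h = 0" "gmul n h 0 = 0"
  by (auto simp: gmul_def fun_eq_iff)

lemma gmul_scale: "gmul n (gscale c f) (gscale d g) = gscale (c * d) (gmul n f g)"
  by (auto simp: gmul_def gscale_def fun_eq_iff sum_distrib_left intro!: sum.cong)

lemma gmul_sum_left: "gmul n (\<Sum>i\<in>I. f i) h = (\<Sum>i\<in>I. gmul n (f i) h)"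
  by (induction I rule: infinite_finite_induct)
    (simp_all only: sum.infinite sum.empty sum.insert gmul_zero gmul_add_left not_False_eq_True)

lemma gmul_sum_right: "gmul n h (\<Sum>i\<in>I. f i) = (\<Sum>i\<in>I. gmul n h (f i))"
  by (induction I rule: infinite_finite_induct)
    (simp_all only: sum.infinite sum.empty sum.insert gmul_zero gmul_add_right not_False_eq_True)

text \<open>If one factor exceeds \<open>n\<close>, so does the product; hence truncating the
  factors first does no harm.\<close>

lemma gmul_trunc_delta:
  assumes "1 \<le> a" "1 \<le> b"
  shows "gmul n (trunc n (delta a)) (trunc n (delta b)) = trunc n (delta (a * b) :: nat \<Rightarrow> 'k::field)"
proof (cases "a \<le> n \<and> b \<le> n")
  case True
  then have "trunc n (delta a) = (delta a :: nat \<Rightarrow> 'k)" "trunc n (delta b) = (delta b :: nat \<Rightarrow> 'k)"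
    using assms by (auto simp: trunc_def delta_def fun_eq_iff)
  moreover have "gmul n (delta a) (delta b) = trunc n (delta (a * b) :: nat \<Rightarrow> 'k)"
  proof
    fix c
    show "gmul n (delta a) (delta b) c = trunc n (delta (a * b) :: nat \<Rightarrow> 'k) c"
      unfolding gmul_delta[OF assms] unfolding trunc_def delta_def using assms by auto
  qed
  ultimately show ?thesis by simp
next
  case False
  have "a \<le> a * b" "b \<le> a * b" using assms by auto
  then have "\<not> a * b \<le> n" using False by linarith
  then have "trunc n (delta (a * b)) = (0 :: nat \<Rightarrow> 'k)" by (auto simp: trunc_def delta_def fun_eq_iff)
  moreover have "trunc n (delta a) = (0 :: nat \<Rightarrow> 'k) \<or> trunc n (delta b) = (0 :: nat \<Rightarrow> 'k)"
    using False by (auto simp: trunc_def delta_def fun_eq_iff)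
  ultimately show ?thesis by (auto simp: gmul_zero)
qed

lemma sum_singles: "(\<Sum>\<alpha>\<in>kys a. Poly_Mapping.single \<alpha> (lkp a \<alpha>)) = a"
proof (rule poly_mapping_eqI)
  fix \<beta>
  have "lkp (\<Sum>\<alpha>\<in>kys a. Poly_Mapping.single \<alpha> (lkp a \<alpha>)) \<beta> = (\<Sum>\<alpha>\<in>kys a. if \<alpha> = \<beta> then lkp a \<alpha> else 0)"
    unfolding lookup_sum by (rule sum.cong) (auto simp: lookup_single when_def)
  also have "\<dots> = lkp a \<beta>" by (auto simp: sum.delta in_keys_iff)
  finally show "lkp (\<Sum>\<alpha>\<in>kys a. Poly_Mapping.single \<alpha> (lkp a \<alpha>)) \<beta> = lkp a \<beta>" .
qed

lemma Phi_mult: "Phi n (a * b) = gmul n (Phi n a) (Phi n b)"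
proof -
  let ?s = "\<lambda>a \<alpha>. Poly_Mapping.single \<alpha> (lkp a \<alpha>)"
  have "a * b = (\<Sum>\<alpha>\<in>kys a. \<Sum>\<beta>\<in>kys b. ?s a \<alpha> * ?s b \<beta>)"
    using sum_product[of "?s a" "kys a" "?s b" "kys b"] by (simp add: sum_singles)
  then have "Phi n (a * b) = (\<Sum>\<alpha>\<in>kys a. \<Sum>\<beta>\<in>kys b. Phi n (?s a \<alpha> * ?s b \<beta>))" by (simp add: Phi_sum)
  also have "\<dots> = (\<Sum>\<alpha>\<in>kys a. \<Sum>\<beta>\<in>kys b. gmul n (Phi n (?s a \<alpha>)) (Phi n (?s b \<beta>)))"
  proof (intro sum.cong refl)
    fix \<alpha> \<beta>
    have "1 \<le> mval \<alpha>" "1 \<le> mval \<beta>" using mval_pos[of \<alpha>] mval_pos[of \<beta>] by linarith+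
    then show "Phi n (?s a \<alpha> * ?s b \<beta>) = gmul n (Phi n (?s a \<alpha>)) (Phi n (?s b \<beta>))"
      by (simp add: mult_single Phi_single mval_add gmul_scale gmul_trunc_delta)
  qed
  also have "\<dots> = gmul n (\<Sum>\<alpha>\<in>kys a. Phi n (?s a \<alpha>)) (\<Sum>\<beta>\<in>kys b. Phi n (?s b \<beta>))"
    unfolding gmul_sum_left gmul_sum_right by (rule sum.swap)
  also have "\<dots> = gmul n (Phi n a) (Phi n b)" by (simp add: Phi_sum[symmetric] sum_singles)
  finally show ?thesis .
qed

lemma lookup_pscale: "lkp (pscale c a) \<alpha> = c * lkp a \<alpha>"
  unfolding pscale_def by (simp add: Poly_Mapping.map.rep_eq when_def)

lemma Phi_pscale: "Phi n (pscale c a) = gscale c (Phi n a)"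
proof -
  have "Phi n (pscale c a) = trunc n (\<lambda>m. \<Sum>\<alpha>\<in>kys a. if mval \<alpha> = m then lkp (pscale c a) \<alpha> else 0)"
    by (rule Phi_superset) (auto simp: in_keys_iff lookup_pscale)
  then show ?thesis
    by (auto simp: Phi_def trunc_def gscale_def fun_eq_iff lookup_pscale sum_distrib_left intro!: sum.cong)
qed

lemma Phi_one: "1 \<le> n \<Longrightarrow> Phi n 1 = (gunit :: nat \<Rightarrow> 'k::field)"
proof -
  assume n: "1 \<le> n"
  have "Phi n 1 = gscale (1::'k) (trunc n (delta 1))"
    using Phi_single[of n 0 "1::'k"] by (simp only: single_one mval_zero)
  also have "\<dots> = gunit" using n by (auto simp: gscale_def trunc_def delta_def gunit_def)
  finally show ?thesis .
qed

lemma Phi_monom: "Phi n (monom \<alpha>) = trunc n (delta (mval \<alpha>))"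
  by (simp add: monom_def Phi_single gscale_def)

lemma trunc_delta_eq_0_iff: "1 \<le> m \<Longrightarrow> trunc n (delta m) = (0 :: nat \<Rightarrow> 'k::field) \<longleftrightarrow> n < m"
  by (auto simp: trunc_def delta_def fun_eq_iff not_le)

lemma PR_add: "a \<in> PR r \<Longrightarrow> b \<in> PR r \<Longrightarrow> a + b \<in> PR r"
  using Poly_Mapping.keys_add[of a b] unfolding PR_def by blast

lemma PR_mult:
  assumes "a \<in> PR r" "b \<in> PR r"
  shows "a * b \<in> PR r"
  unfolding PR_def mem_Collect_eq
proof
  fix \<gamma> assume "\<gamma> \<in> kys (a * b)"
  then obtain \<alpha> \<beta> where "\<alpha> \<in> kys a" "\<beta> \<in> kys b" "\<gamma> = \<alpha> + \<beta>" using keys_mult[of a b] by blast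
  then show "kys \<gamma> \<subseteq> {1..r}" using assms Poly_Mapping.keys_add[of \<alpha> \<beta>] unfolding PR_def by blast
qed

lemma PR_sum: "(\<And>i. i \<in> I \<Longrightarrow> f i \<in> PR r) \<Longrightarrow> (\<Sum>i\<in>I. f i) \<in> PR r"
proof (induction I rule: infinite_finite_induct)
  case (insert x F)
  then show ?case using PR_add[of "f x" r "sum f F"] by simp
qed (simp_all add: PR_def)

lemma single_PR: "kys \<alpha> \<subseteq> {1..r} \<Longrightarrow> Poly_Mapping.single \<alpha> c \<in> PR r"
  by (simp add: PR_def)

lemma monom_inj: "(monom \<alpha> :: _ \<Rightarrow>\<^sub>0 'k::field) = monom \<beta> \<longleftrightarrow> \<alpha> = \<beta>"
proof
  assume "(monom \<alpha> :: _ \<Rightarrow>\<^sub>0 'k) = monom \<beta>"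
  then have "kys (monom \<alpha> :: _ \<Rightarrow>\<^sub>0 'k) = kys (monom \<beta> :: _ \<Rightarrow>\<^sub>0 'k)" by simp
  then show "\<alpha> = \<beta>" by (simp add: monom_def)
qed simp

text \<open>By unique factorisation distinct monomials in the variables \<open>1..rr n\<close> have
  distinct values, so nothing cancels under \<open>Phi\<close>. A polynomial in the kernel has only
  monomials of value above \<open>n\<close>, each of which is a generator of the ideal.\<close>

lemma kernel_Phi: "{a\<in>PR (rr n). Phi n a = 0} = In TYPE('k::field) n"
proof (intro equalityI subsetI)
  fix a :: "(nat \<Rightarrow>\<^sub>0 nat) \<Rightarrow>\<^sub>0 'k" assume "a \<in> {a\<in>PR (rr n). Phi n a = 0}"
  then have a: "a \<in> PR (rr n)" "Phi n a = 0" by auto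
  have keys_a: "kys \<alpha> \<subseteq> {1..rr n}" if "\<alpha> \<in> kys a" for \<alpha> using a(1) that by (simp add: PR_def)
  have big: "n < mval \<alpha>" if \<alpha>: "\<alpha> \<in> kys a" for \<alpha>
  proof (rule ccontr)
    assume "\<not> n < mval \<alpha>"
    then have "Phi n a (mval \<alpha>) = (\<Sum>\<beta>\<in>kys a. if mval \<beta> = mval \<alpha> then lkp a \<beta> else 0)"
      using mval_pos[of \<alpha>] by (simp add: Phi_def trunc_def)
    also have "\<dots> = (\<Sum>\<beta>\<in>kys a. if \<beta> = \<alpha> then lkp a \<beta> else 0)"
    proof (rule sum.cong[OF refl])
      fix \<beta> assume \<beta>: "\<beta> \<in> kys a"
      show "(if mval \<beta> = mval \<alpha> then lkp a \<beta> else 0) = (if \<beta> = \<alpha> then lkp a \<beta> else 0)"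
        using mval_inj[OF keys_a[OF \<beta>] keys_a[OF \<alpha>]] by auto
    qed
    also have "\<dots> = lkp a \<alpha>" using \<alpha> by simp
    finally show False using a(2) \<alpha> by (simp add: in_keys_iff)
  qed
  \<comment> \<open>The coefficient of the generator \<open>g\<close> in \<open>a\<close>, as a
    constant polynomial. The sums in \<open>ideal_gen\<close> run over polynomials, so the exponent
    vector is recovered by \<open>the_inv monom\<close>.\<close>
  define c where "c = (\<lambda>g :: (nat \<Rightarrow>\<^sub>0 nat) \<Rightarrow>\<^sub>0 'k. Poly_Mapping.single (0 :: nat \<Rightarrow>\<^sub>0 nat) (lkp a (the_inv monom g)))"
  have inj: "inj (monom :: _ \<Rightarrow> (nat \<Rightarrow>\<^sub>0 nat) \<Rightarrow>\<^sub>0 'k)" by (auto simp: inj_on_def monom_inj)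
  have "(\<Sum>g\<in>monom ` kys a. c g * g) = (\<Sum>\<alpha>\<in>kys a. c (monom \<alpha>) * monom \<alpha>)"
    by (rule sum.reindex_cong[OF inj_on_subset[OF inj]]) auto
  also have "\<dots> = (\<Sum>\<alpha>\<in>kys a. Poly_Mapping.single \<alpha> (lkp a \<alpha>))"
    by (rule sum.cong) (simp_all add: c_def the_inv_f_f[OF inj] monom_def[of "_ :: nat \<Rightarrow>\<^sub>0 nat", symmetric], simp add: monom_def mult_single)
  finally have sum: "a = (\<Sum>g\<in>monom ` kys a. c g * g)" by (simp add: sum_singles)
  have c: "\<forall>g\<in>monom ` kys a. c g \<in> PR (rr n)" unfolding c_def by (intro ballI single_PR) simp
  have gens: "monom ` kys a \<subseteq> {monom \<alpha> | \<alpha>. kys \<alpha> \<subseteq> {1..rr n} \<and> n < mval \<alpha>}"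
    using keys_a big by blast
  show "a \<in> In TYPE('k) n" unfolding In_def ideal_gen_def mem_Collect_eq
    by (intro exI[of _ "monom ` kys a"] exI[of _ c] conjI sum c gens finite_imageI finite_keys)
next
  fix a assume "a \<in> In TYPE('k) n"
  then obtain F c where F: "finite F" "F \<subseteq> {monom \<alpha> | \<alpha>. kys \<alpha> \<subseteq> {1..rr n} \<and> n < mval \<alpha>}"
    "\<forall>g\<in>F. c g \<in> PR (rr n)" "a = (\<Sum>g\<in>F. c g * g)"
    unfolding In_def ideal_gen_def by blast
  have "Phi n (c g * g) = 0" "c g * g \<in> PR (rr n)" if g: "g \<in> F" for g
  proof -
    obtain \<alpha> where \<alpha>: "g = monom \<alpha>" "kys \<alpha> \<subseteq> {1..rr n}" "n < mval \<alpha>" using F(2) g by blast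
    have "Phi n g = 0" unfolding \<alpha>(1) Phi_monom using \<alpha>(3) by (simp add: trunc_delta_eq_0_iff)
    then show "Phi n (c g * g) = 0" by (simp add: Phi_mult gmul_zero)
    show "c g * g \<in> PR (rr n)" using F(3) g \<alpha> by (auto simp: monom_def intro!: PR_mult single_PR)
  qed
  then show "a \<in> {a\<in>PR (rr n). Phi n a = 0}" using F(4) by (simp add: Phi_sum PR_sum)
qed

lemma monom_in_In:
  "(monom \<alpha> :: _ \<Rightarrow>\<^sub>0 'k::field) \<in> In TYPE('k) n \<longleftrightarrow> kys \<alpha> \<subseteq> {1..rr n} \<and> n < mval \<alpha>"
proof -
  have "1 \<le> mval \<alpha>" using mval_pos[of \<alpha>] by linarith
  then show ?thesis
    unfolding kernel_Phi[symmetric] mem_Collect_eq Phi_monom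
    by (simp add: trunc_delta_eq_0_iff PR_def monom_def)
qed

lemma Phi_image: "Phi n ` PR (rr n) = (Gamma n :: (nat \<Rightarrow> 'k::field) set)"
proof (intro equalityI subsetI)
  fix f :: "nat \<Rightarrow> 'k" assume "f \<in> Phi n ` PR (rr n)"
  then show "f \<in> Gamma n" by (auto simp: Phi_def Gamma_def trunc_def)
next
  fix f :: "nat \<Rightarrow> 'k" assume f: "f \<in> Gamma n"
  define a where "a = (\<Sum>m\<in>{1..n}. Poly_Mapping.single (prim_exp n m) (f m))"
  have "a \<in> PR (rr n)" unfolding a_def prim_exp_def by (intro PR_sum single_PR keys_expv)
  moreover have "Phi n a = f"
  proof
    fix k
    have "Phi n a k = (\<Sum>m\<in>{1..n}. gscale (f m) (trunc n (delta (mval (prim_exp n m)))) k)"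
      unfolding a_def Phi_sum Phi_single by (rule sum_fun_apply)
    also have "\<dots> = (\<Sum>m\<in>{1..n}. if m = k then f k else 0)"
      by (rule sum.cong) (auto simp: mval_prim_exp gscale_def trunc_def delta_def)
    also have "\<dots> = f k"
    proof (cases "k \<in> {1..n}")
      case False
      then have "k = 0 \<or> n < k" by auto
      then have "f k = 0" using f unfolding Gamma_def by blast
      then show ?thesis by (simp cong: if_cong)
    qed simp
    finally show "Phi n a k = f k" .
  qed
  ultimately show "f \<in> Phi n ` PR (rr n)" by blast
qed

section \<open>Ideals and the descending chain condition\<close>

lemma gmul_gscale_gunit:
  assumes "1 \<le> n" "x \<in> Gamma n"
  shows "gmul n (gscale c gunit) x = (\<lambda>m. c * x m)"
proof
  fix m
  show "gmul n (gscale c gunit) x m = c * x m"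
  proof (cases "1 \<le> m \<and> m \<le> n")
    case True
    have "(\<Sum>a\<in>{a. a dvd m}. gscale c gunit a * x (m div a)) = (\<Sum>a\<in>{a. a dvd m}. if a = 1 then c * x m else 0)"
      by (rule sum.cong) (auto simp: gscale_def gunit_def)
    also have "\<dots> = c * x m" using True by (subst sum.delta) auto
    finally show ?thesis using True by (simp add: gmul_def)
  next
    case False
    then have "m = 0 \<or> n < m" by linarith
    then have "x m = 0" using assms(2) unfolding Gamma_def by blast
    then show ?thesis using False by (auto simp: gmul_def)
  qed
qed

text \<open>Closure under scalars comes from multiplying by scalar multiples of the unit element,
  which lie in \<open>Gamma n\<close>.\<close>

lemma gideal_subspace:
  fixes I :: "(nat \<Rightarrow> 'k::field) set"
  assumes "1 \<le> n" "gideal n I"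
  shows "fvs.subspace I"
  unfolding fvs.subspace_def
proof (intro conjI ballI allI)
  fix c :: 'k and x assume x: "x \<in> I"
  have "gscale c gunit \<in> Gamma n" using assms(1) by (auto simp: Gamma_def gscale_def gunit_def)
  then have "gmul n (gscale c gunit) x \<in> I" using assms(2) x by (simp add: gideal_def)
  then show "(\<lambda>m. c * x m) \<in> I" using gmul_gscale_gunit[OF assms(1), of x c] assms(2) x by (auto simp: gideal_def)
qed (use assms in \<open>auto simp: gideal_def\<close>)

text \<open>Ideals are subspaces of a finite-dimensional space, so the chain is constant from a
  member of least dimension on.\<close>

lemma artinian_Gamma:
  assumes "1 \<le> n"
  shows "artinian TYPE('k::field) n"
  unfolding artinian_def
proof (intro allI impI)
  fix I :: "nat \<Rightarrow> (nat \<Rightarrow> 'k) set"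
  assume I: "\<forall>k. gideal n (I k) \<and> I (Suc k) \<subseteq> I k"
  obtain N where N: "\<And>k. fvs.dim (I N) \<le> fvs.dim (I k)"
    using ex_has_least_nat[of "\<lambda>_. True" 0 "\<lambda>k. fvs.dim (I k)"] by auto
  have "I k = I N" if "N \<le> k" for k
  proof (rule subspace_eq_of_dim_eq)
    show "fvs.subspace (I k)" using gideal_subspace[OF assms] I by blast
    show sub: "I k \<subseteq> I N" using that I by (induction k rule: dec_induct) auto
    show NQ: "I N \<subseteq> supp_on {1..n}" using I by (auto simp: gideal_def Gamma_eq_supp_on)
    show "finite {1..n}" by simp
    show "fvs.dim (I k) = fvs.dim (I N)" using N[of k] vdim_mono[OF sub NQ] by simp
  qed
  then show "\<exists>N. \<forall>k\<ge>N. I k = I N" by blast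
qed

section \<open>The grading by number of prime factors\<close>

lemma gprod_chi:
  assumes "1 \<le> n"
  shows "gprod n (map (\<lambda>j. trunc n (chi j)) js) = trunc n (delta (prod_list (map pr js)) :: nat \<Rightarrow> 'k::field)"
proof (induction js)
  case Nil
  then show ?case using assms by (auto simp: trunc_def delta_def gunit_def fun_eq_iff)
next
  case (Cons j js)
  have chi: "chi j = (delta (pr j) :: nat \<Rightarrow> 'k)" by (simp add: chi_def delta_def)
  have "1 \<le> pr j" using pr_prime[of j] prime_ge_1_nat by blast
  moreover have "1 \<le> prod_list (map pr js)"
    by (induction js) (use pr_prime prime_gt_0_nat in \<open>auto simp: Suc_le_eq\<close>)
  ultimately show ?case using Cons by (simp add: chi gmul_trunc_delta)
qed

lemma lam_prod_list: "lam (prod_list (map pr js)) = length js"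
proof (induction js)
  case (Cons j js)
  have "prod_list (map pr js) \<noteq> 0"
    by (induction js) (use pr_prime prime_gt_0_nat in \<open>auto\<close>)
  then have "prime_factorization (pr j * prod_list (map pr js)) = prime_factorization (pr j) + prime_factorization (prod_list (map pr js))"
    using prime_gt_0_nat[OF pr_prime[of j]] by (intro prime_factorization_mult) auto
  then show ?case using Cons by (simp add: lam_def prime_factorization_prime pr_prime)
qed (simp add: lam_def)

lemma prod_list_primes:
  assumes "1 \<le> w" "w \<le> n"
  obtains js where "set js \<subseteq> {1..rr n}" "length js = lam w" "prod_list (map pr js) = w"
proof -
  obtain ps where ps: "mset ps = prime_factorization w" using ex_mset by blast
  have "\<exists>i\<in>{1..rr n}. pr i = q" if "q \<in> set ps" for q
  proof -
    have "q \<in># prime_factorization w" using that ps by (metis set_mset_mset)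
    then have q: "prime q" "q dvd w" by auto
    then obtain i where i: "i \<ge> 1" "q = pr i" using prime_is_pr by blast
    have "q \<le> n" using dvd_imp_le[OF q(2)] assms by simp
    then show ?thesis using i pr_le_rr_iff by auto
  qed
  then obtain idx where idx: "\<And>q. q \<in> set ps \<Longrightarrow> idx q \<in> {1..rr n} \<and> pr (idx q) = q" by metis
  have "prod_list ps = w"
    using ps assms prod_mset_prime_factorization_nat[of w] by (metis One_nat_def Suc_le_eq prod_mset_prod_list)
  moreover have "map pr (map idx ps) = ps" using idx by (auto intro: map_idI)
  moreover have "length ps = lam w" using ps by (metis lam_def size_mset)
  moreover have "set (map idx ps) \<subseteq> {1..rr n}" using idx by auto
  ultimately show thesis using that[of "map idx ps"] by simp
qed

text \<open>A product of \<open>i\<close> generators is the basis element of an integer with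
  \<open>i\<close> prime factors, or zero if that integer exceeds \<open>n\<close>. Conversely, a
  prime factorisation writes every such basis element as a product of this kind.\<close>

lemma vdim_gdeg:
  assumes "1 \<le> n"
  shows "vdim (gdeg TYPE('k::field) n i) = card {w\<in>{1..n}. lam w = i}"
proof -
  let ?Q = "{w\<in>{1..n}. lam w = i}"
  let ?G = "{gprod n (map (\<lambda>j. trunc n (chi j :: nat \<Rightarrow> 'k)) js) | js. length js = i \<and> set js \<subseteq> {1..rr n}}"
  have "fvs.span ?G = supp_on ?Q"
  proof
    show "fvs.span ?G \<subseteq> supp_on ?Q"
    proof (rule fvs.span_minimal[OF _ subspace_supp_on])
      show "?G \<subseteq> supp_on ?Q"
      proof
        fix x assume "x \<in> ?G"
        then obtain js where js: "x = trunc n (delta (prod_list (map pr js)))" "length js = i"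
          using gprod_chi[OF assms, where 'k='k] by auto
        then show "x \<in> supp_on ?Q" using lam_prod_list[of js] by (auto simp: supp_on_def trunc_def delta_def)
      qed
    qed
    show "supp_on ?Q \<subseteq> fvs.span ?G"
    proof -
      have fin: "finite ?Q" by simp
      have "(\<lambda>a b. if b = a then 1 else 0 :: 'k) ` ?Q \<subseteq> fvs.span ?G"
      proof
        fix x assume "x \<in> (\<lambda>a b. if b = a then 1 else 0 :: 'k) ` ?Q"
        then obtain w where w: "w \<in> ?Q" "x = (\<lambda>b. if b = w then 1 else 0)" by blast
        then obtain js where js: "set js \<subseteq> {1..rr n}" "length js = lam w" "prod_list (map pr js) = w"
          using prod_list_primes[of w n] by auto
        have "trunc n (delta w) = x" using w by (auto simp: trunc_def delta_def fun_eq_iff)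
        then have "x = gprod n (map (\<lambda>j. trunc n (chi j)) js)" using gprod_chi[OF assms, of js, where 'k='k] js(3) by simp
        then have "x \<in> ?G" using js w by auto
        then show "x \<in> fvs.span ?G" by (rule fvs.span_base)
      qed
      then have "fvs.span ((\<lambda>a b. if b = a then 1 else 0 :: 'k) ` ?Q) \<subseteq> fvs.span ?G"
        by (rule fvs.span_minimal[OF _ fvs.subspace_span])
      then show ?thesis using supp_on_span[OF fin, where 'k='k] by simp
    qed
  qed
  then show ?thesis by (simp add: gdeg_def vspan_def vdim_eq dim_supp_on)
qed

section \<open>Minimal monomial generators\<close>

lemma mval_diff_single:
  assumes "i \<in> kys \<alpha>"
  shows "mval \<alpha> = pr i * mval (\<alpha> - Poly_Mapping.single i 1)"
proof -
  have "\<alpha> = (\<alpha> - Poly_Mapping.single i 1) + Poly_Mapping.single i 1"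
    using assms by (intro poly_mapping_eqI) (auto simp: lookup_add lookup_minus lookup_single when_def in_keys_iff)
  then show ?thesis using mval_add[of "\<alpha> - Poly_Mapping.single i 1" "Poly_Mapping.single i 1"]
    unfolding mval_single by (simp add: mult.commute)
qed

lemma mval_mono:
  assumes "\<And>j. lkp \<beta> j \<le> lkp \<alpha> j"
  shows "mval \<beta> \<le> mval \<alpha>"
proof -
  have "\<alpha> = (\<alpha> - \<beta>) + \<beta>"
    using assms by (intro poly_mapping_eqI) (simp add: lookup_add lookup_minus)
  then have "mval \<alpha> = mval (\<alpha> - \<beta>) * mval \<beta>" using mval_add[of "\<alpha> - \<beta>" \<beta>] by simp
  then show ?thesis using mval_pos[of "\<alpha> - \<beta>"] by simp
qed

text \<open>Dividing a monomial by its smallest variable removes the smallest prime and so leaves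
  the largest value. Minimality therefore needs to be tested only at this one quotient.\<close>

lemma mingens_iff:
  assumes "1 \<le> n"
  shows "\<alpha> \<in> mingens TYPE('k::field) n \<and> Min (kys \<alpha>) = v \<longleftrightarrow>
    kys \<alpha> \<subseteq> {v..rr n} \<and> 1 \<le> v \<and> v \<in> kys \<alpha> \<and> n < mval \<alpha> \<and> mval (\<alpha> - Poly_Mapping.single v 1) \<le> n"
proof
  assume l: "\<alpha> \<in> mingens TYPE('k) n \<and> Min (kys \<alpha>) = v"
  then have a: "kys \<alpha> \<subseteq> {1..rr n}" "n < mval \<alpha>" and
    m: "\<And>\<beta>. (\<forall>j. lkp \<beta> j \<le> lkp \<alpha> j) \<Longrightarrow> \<beta> \<noteq> \<alpha> \<Longrightarrow> \<not> (kys \<beta> \<subseteq> {1..rr n} \<and> n < mval \<beta>)"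
    unfolding mingens_def monom_in_In by blast+
  \<comment> \<open>The constant monomial has value 1, which does not exceed \<open>n\<close>; so
    \<open>Min\<close> is taken of a nonempty set.\<close>
  have "kys \<alpha> \<noteq> {}" using a(2) assms by (auto simp: mval_def)
  then have v: "v \<in> kys \<alpha>" "\<forall>i\<in>kys \<alpha>. v \<le> i" using l Min_in[of "kys \<alpha>"] Min_le[of "kys \<alpha>"] by auto
  let ?\<beta> = "\<alpha> - Poly_Mapping.single v 1"
  have le: "\<forall>j. lkp ?\<beta> j \<le> lkp \<alpha> j" by (simp add: lookup_minus)
  have "lkp ?\<beta> v \<noteq> lkp \<alpha> v" using v(1) by (simp add: lookup_minus in_keys_iff)
  then have "?\<beta> \<noteq> \<alpha>" by metis
  moreover have "kys ?\<beta> \<subseteq> {1..rr n}"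
  proof
    fix j assume "j \<in> kys ?\<beta>"
    then have "j \<in> kys \<alpha>" using le by (metis in_keys_iff le_zero_eq)
    then show "j \<in> {1..rr n}" using a by blast
  qed
  ultimately have "mval ?\<beta> \<le> n" using m[OF le] by auto
  then show "kys \<alpha> \<subseteq> {v..rr n} \<and> 1 \<le> v \<and> v \<in> kys \<alpha> \<and> n < mval \<alpha> \<and> mval ?\<beta> \<le> n"
    using a v by auto
next
  assume r: "kys \<alpha> \<subseteq> {v..rr n} \<and> 1 \<le> v \<and> v \<in> kys \<alpha> \<and> n < mval \<alpha> \<and> mval (\<alpha> - Poly_Mapping.single v 1) \<le> n"
  then have keys: "kys \<alpha> \<subseteq> {1..rr n}" by force
  have "Min (kys \<alpha>) = v" using r by (intro Min_eqI) auto
  moreover have "\<not> (kys \<beta> \<subseteq> {1..rr n} \<and> n < mval \<beta>)" if le: "\<forall>j. lkp \<beta> j \<le> lkp \<alpha> j" and ne: "\<beta> \<noteq> \<alpha>" for \<beta>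
  proof -
    obtain i where i: "lkp \<beta> i < lkp \<alpha> i" using le ne by (metis le_neq_implies_less poly_mapping_eqI)
    then have ik: "i \<in> kys \<alpha>" by (simp add: in_keys_iff)
    let ?\<gamma> = "\<alpha> - Poly_Mapping.single i 1" and ?\<delta> = "\<alpha> - Poly_Mapping.single v 1"
    have "lkp \<beta> j \<le> lkp ?\<gamma> j" for j using le[rule_format, of j] i by (auto simp: lookup_minus lookup_single when_def)
    then have "mval \<beta> \<le> mval ?\<gamma>" by (rule mval_mono)
    \<comment> \<open>Both \<open>pr i * mval ?\<gamma>\<close> and
      \<open>pr v * mval ?\<delta>\<close> equal \<open>mval \<alpha>\<close>, and
      \<open>pr v \<le> pr i\<close>.\<close>
    also have "mval ?\<gamma> \<le> mval ?\<delta>"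
    proof (rule ccontr)
      assume "\<not> mval ?\<gamma> \<le> mval ?\<delta>"
      moreover have "pr v \<le> pr i" using pr_le_iff[of v i] r ik by force
      moreover have "0 < pr v" using prime_gt_0_nat[OF pr_prime] .
      ultimately have "pr v * mval ?\<delta> < pr i * mval ?\<gamma>"
        by (intro mult_le_less_imp_less) auto
      then show False using mval_diff_single[OF ik] mval_diff_single[of v \<alpha>] r by simp
    qed
    finally show ?thesis using r by simp
  qed
  ultimately show "\<alpha> \<in> mingens TYPE('k) n \<and> Min (kys \<alpha>) = v"
    unfolding mingens_def monom_in_In using keys r by blast
qed

text \<open>The bijection divides a generator by its smallest variable, and its inverse multiplies
  by that variable. The quotient has value at most \<open>n\<close>, and the generator, whose value
  is \<open>pr v\<close> times as large, has value above \<open>n\<close>: these are the two bounds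
  in \<open>sols\<close>. The exponent of the smallest variable may drop to 0.\<close>

lemma mingens_sols_bij:
  assumes "1 \<le> n" "v \<in> {1..rr n}"
  shows "\<exists>f. bij_betw f {\<alpha>\<in>mingens TYPE('k::field) n. Min (kys \<alpha>) = v} (sols n v)"
proof -
  have v: "1 \<le> v" using assms by simp
  let ?S = "Poly_Mapping.single v (1::nat)"
  let ?G = "{\<alpha>. kys \<alpha> \<subseteq> {v..rr n} \<and> v \<in> kys \<alpha> \<and> n < mval \<alpha> \<and> mval (\<alpha> - ?S) \<le> n}"
  have G: "{\<alpha>\<in>mingens TYPE('k) n. Min (kys \<alpha>) = v} = ?G"
    using mingens_iff[OF assms(1), where v=v and 'k='k] v by blast
  have keys_diff: "kys (\<alpha> - ?S) \<subseteq> kys \<alpha>" for \<alpha>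
    by (auto simp: in_keys_iff lookup_minus)
  have "bij_betw (\<lambda>\<alpha>. lkp (\<alpha> - ?S)) ?G (sols n v)"
  proof (rule bij_betw_byWitness[where f' = "\<lambda>b. expv (rr n) b + ?S"])
    show "\<forall>\<alpha>\<in>?G. expv (rr n) (lkp (\<alpha> - ?S)) + ?S = \<alpha>"
    proof
      fix \<alpha> assume a: "\<alpha> \<in> ?G"
      show "expv (rr n) (lkp (\<alpha> - ?S)) + ?S = \<alpha>"
      proof (rule poly_mapping_eqI)
        fix i
        have "lkp \<alpha> i = 0" if "i \<notin> {1..rr n}" using that a v by (auto simp: in_keys_iff)
        moreover have "0 < lkp \<alpha> v" using a by (simp add: in_keys_iff)
        ultimately show "lkp (expv (rr n) (lkp (\<alpha> - ?S)) + ?S) i = lkp \<alpha> i"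
          using assms(2) by (auto simp: lookup_add lookup_expv lookup_minus lookup_single when_def)
      qed
    qed
    have diff_expv: "lkp (expv (rr n) b + ?S - ?S) = b" if "b \<in> sols n v" for b
    proof
      fix i
      have "b i = 0" if "i \<notin> {1..rr n}" using \<open>b \<in> sols n v\<close> that v sols_iff[OF assms(1) v, of b] by auto
      then show "lkp (expv (rr n) b + ?S - ?S) i = b i" by (simp add: lookup_expv)
    qed
    then show "\<forall>b\<in>sols n v. lkp (expv (rr n) b + ?S - ?S) = b" by blast
    show "(\<lambda>\<alpha>. lkp (\<alpha> - ?S)) ` ?G \<subseteq> sols n v"
    proof
      fix b assume "b \<in> (\<lambda>\<alpha>. lkp (\<alpha> - ?S)) ` ?G"
      then obtain \<alpha> where a: "\<alpha> \<in> ?G" "b = lkp (\<alpha> - ?S)" by blast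
      have "kys (\<alpha> - ?S) \<subseteq> {v..rr n}" using keys_diff a by blast
      then have z: "b i = 0" if "i < v \<or> rr n < i" for i using that a(2) by (auto simp: in_keys_iff)
      have "kys (\<alpha> - ?S) \<subseteq> {1..rr n}" using \<open>kys (\<alpha> - ?S) \<subseteq> {v..rr n}\<close> v by force
      then have "nval (rr n) b = mval (\<alpha> - ?S)" using a(2) mval_eq_nval by simp
      then show "b \<in> sols n v" unfolding sols_iff[OF assms(1) v]
        using z a mval_diff_single[of v \<alpha>] by simp
    qed
    show "(\<lambda>b. expv (rr n) b + ?S) ` sols n v \<subseteq> ?G"
    proof
      fix \<alpha> assume "\<alpha> \<in> (\<lambda>b. expv (rr n) b + ?S) ` sols n v"
      then obtain b where b: "b \<in> sols n v" "\<alpha> = expv (rr n) b + ?S" by blast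
      note b' = b(1)[unfolded sols_iff[OF assms(1) v]]
      have "kys \<alpha> \<subseteq> {v..rr n}"
      proof
        fix i assume "i \<in> kys \<alpha>"
        then have "(i \<in> {1..rr n} \<and> b i \<noteq> 0) \<or> i = v"
          using b(2) by (auto simp: in_keys_iff lookup_add lookup_expv lookup_single when_def split: if_splits)
        moreover have "b i = 0" if "i < v" using b'[THEN conjunct1, rule_format, of i] that by simp
        ultimately show "i \<in> {v..rr n}" using assms(2) by (cases "i < v") auto
      qed
      moreover have "v \<in> kys \<alpha>" using b(2) by (simp add: in_keys_iff lookup_add)
      moreover have "mval \<alpha> = nval (rr n) b * pr v" using b(2) by (simp only: mval_add mval_expv mval_single)
      moreover have "\<alpha> - ?S = expv (rr n) b" using b(2) by simp
      ultimately show "\<alpha> \<in> ?G" using b' by (simp add: mval_expv mult.commute)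
    qed
  qed
  then show ?thesis unfolding G by blast
qed

theorem mainTheorem1:
  fixes n :: nat
  assumes "1 \<le> n"
  shows
   \<comment> \<open>(I) isomorphism Gamma_n = K[x_1..x_r]/I_n, via a surjective K-algebra map with kernel I_n\<close>
   "(\<exists>\<phi> :: ((nat \<Rightarrow>\<^sub>0 nat) \<Rightarrow>\<^sub>0 'k::field_char_0) \<Rightarrow> (nat \<Rightarrow> 'k).
        (\<forall>a\<in>PR (rr n). \<forall>b\<in>PR (rr n). \<phi> (a + b) = \<phi> a + \<phi> b \<and> \<phi> (a * b) = gmul n (\<phi> a) (\<phi> b))
      \<and> (\<forall>c. \<forall>a\<in>PR (rr n). \<phi> (pscale c a) = gscale c (\<phi> a))
      \<and> \<phi> 1 = gunit
      \<and> \<phi> ` PR (rr n) = Gamma n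
      \<and> {a\<in>PR (rr n). \<phi> a = 0} = In TYPE('k) n)
   \<and> (\<forall>\<alpha> i j. Poly_Mapping.keys \<alpha> \<subseteq> {1..rr n} \<and> 1 \<le> j \<and> j \<le> i \<and> i \<le> rr n \<and>
        (monom (\<alpha> + Poly_Mapping.single j 1) :: (_ \<Rightarrow>\<^sub>0 'k)) \<in> In TYPE('k) n \<longrightarrow>
        (monom (\<alpha> + Poly_Mapping.single i 1) :: (_ \<Rightarrow>\<^sub>0 'k)) \<in> In TYPE('k) n)
   \<comment> \<open>(II)\<close>
   \<and> artinian TYPE('k) n
   \<and> vdim (Gamma n :: (nat \<Rightarrow> 'k) set) = n
   \<and> (\<forall>i. vdim (gdeg TYPE('k) n i) = card {w\<in>{1..n}. lam w = i})
   \<comment> \<open>(III)\<close>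
   \<and> (\<forall>v\<in>{1..rr n}. \<exists>f. bij_betw f {\<alpha>\<in>mingens TYPE('k) n. Min (Poly_Mapping.keys \<alpha>) = v} (sols n v))
   \<comment> \<open>(IV)\<close>
   \<and> Abs_fps (\<lambda>q. of_nat (tor_dim TYPE('k) n q) :: rat)
       = (1 + fps_X) ^ rr n *
         inverse (1 - fps_X ^ 2 * (\<Sum>i=1..rr n. (1 + fps_X) ^ (i - 1) * of_nat (Cnv n (rr n - i + 1))))"
proof -
  have iso: "\<exists>\<phi> :: ((nat \<Rightarrow>\<^sub>0 nat) \<Rightarrow>\<^sub>0 'k) \<Rightarrow> (nat \<Rightarrow> 'k).
        (\<forall>a\<in>PR (rr n). \<forall>b\<in>PR (rr n). \<phi> (a + b) = \<phi> a + \<phi> b \<and> \<phi> (a * b) = gmul n (\<phi> a) (\<phi> b))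
      \<and> (\<forall>c. \<forall>a\<in>PR (rr n). \<phi> (pscale c a) = gscale c (\<phi> a))
      \<and> \<phi> 1 = gunit
      \<and> \<phi> ` PR (rr n) = Gamma n
      \<and> {a\<in>PR (rr n). \<phi> a = 0} = In TYPE('k) n"
    by (rule exI[of _ "Phi n"], intro conjI ballI allI)
      (rule Phi_add Phi_mult Phi_pscale Phi_one[OF assms] Phi_image kernel_Phi)+
  have stable: "(monom (\<alpha> + Poly_Mapping.single i 1) :: (_ \<Rightarrow>\<^sub>0 'k)) \<in> In TYPE('k) n"
    if "Poly_Mapping.keys \<alpha> \<subseteq> {1..rr n} \<and> 1 \<le> j \<and> j \<le> i \<and> i \<le> rr n \<and>
        (monom (\<alpha> + Poly_Mapping.single j 1) :: (_ \<Rightarrow>\<^sub>0 'k)) \<in> In TYPE('k) n" for \<alpha> i j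
  proof -
    \<comment> \<open>Strong stability is monotonicity of values: exchanging the j-th variable for a
      later one replaces a prime factor by one at least as large.\<close>
    have "n < mval \<alpha> * pr j" using that unfolding monom_in_In mval_add mval_single by blast
    also have "mval \<alpha> * pr j \<le> mval \<alpha> * pr i" using that pr_le_iff[of j i] by simp
    finally have "n < mval (\<alpha> + Poly_Mapping.single i 1)" unfolding mval_add mval_single .
    moreover have "Poly_Mapping.keys (\<alpha> + Poly_Mapping.single i 1) \<subseteq> {1..rr n}"
      using Poly_Mapping.keys_add[of \<alpha> "Poly_Mapping.single i 1"] that by auto
    ultimately show ?thesis unfolding monom_in_In by blast
  qed
  have dim_Gamma: "vdim (Gamma n :: (nat \<Rightarrow> 'k) set) = n"
    by (simp add: vdim_eq Gamma_eq_supp_on dim_supp_on)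
  have hilbert: "\<forall>i. vdim (gdeg TYPE('k) n i) = card {w\<in>{1..n}. lam w = i}"
    using vdim_gdeg[OF assms] by blast
  have gens: "\<forall>v\<in>{1..rr n}. \<exists>f. bij_betw f {\<alpha>\<in>mingens TYPE('k) n. Min (Poly_Mapping.keys \<alpha>) = v} (sols n v)"
    by (intro ballI mingens_sols_bij[OF assms])
  show ?thesis
    by (intro conjI iso artinian_Gamma[OF assms] dim_Gamma hilbert gens poincare_series[OF assms])
      (intro allI impI, rule stable)
qed

end
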